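(* Let $\mathbf t=(t_0,u_0,t_1,u_1)\in\mathbb C^4$ be generic (in the sense specified in the context) and $\mathbf t^\sigma=(u_1,u_0,t_1,t_0)$. The assignments, for $f\in F$ and $\gamma\in\Gamma$, $$(T_0^\sigma f)(\gamma)=u_1f(\gamma)+\frac{(u_1+u_0+\frac12-\gamma)(u_1-u_0+\frac12-\gamma)}{1-2\gamma}\big(f(1-\gamma)-f(\gamma)\big),$$ $$(T_1^\sigma f)(\gamma)=t_1f(\gamma)+\frac{(t_1+t_0+\gamma)(t_1-t_0+\gamma)}{2\gamma}\big(f(-\gamma)-f(\gamma)\big),$$ $$(p(z)f)(\gamma)=p(\gamma)f(\gamma),\qquad p\in\mathcal A,$$ extend uniquely to a representation of $\mathcal H(\mathbf t^\sigma)$ on $F$. With this representation, $\mathbb F:\mathcal A\to F$ is a Fourier transform associated to $\sigma$, i.e. $\mathbb F$ is linear and $\mathbb F\circ X=\sigma(X)\circ\mathbb F$ for all $X\in\mathcal H(\mathbf t)$.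
   Context: $\mathbb N=\{1,2,\dots\}$; $\mathcal A=\mathbb C[x]$; $(a,b,c,d)=(t_1+u_1,t_1-u_1,t_0+u_0+\frac12,t_0-u_0+\frac12)$. Generic means: $t_0,t_1\ne0$; $t_0+t_1\notin-\frac12\mathbb N$; $a,b,c,d\notin-\frac12\mathbb Z_{\ge0}$; no sum of two of $a,b,c,d$ (at distinct positions) lies in $\mathbb Z$. For any 4-tuple $\mathbf t$, operators $T_i=T_i(\mathbf t)$ on $\mathcal A$: $$(T_0f)(x)=t_0f(x)+\frac{(t_0+u_0+\frac12-x)(t_0-u_0+\frac12-x)}{1-2x}\big(f(1-x)-f(x)\big),$$ $$(T_1f)(x)=t_1f(x)+\frac{(t_1+u_1+x)(t_1-u_1+x)}{2x}\big(f(-x)-f(x)\big),$$ $Y=T_0+T_1$, $z$ = multiplication by $x$; $\mathcal H(\mathbf t)\subset\mathrm{End}(\mathcal A)$ is the unital subalgebra generated by $T_0,T_1,z$. Write $T_i^\sigma=T_i(\mathbf t^\sigma)\in\mathcal H(\mathbf t^\sigma)$. $\sigma:\mathcal H(\mathbf t)\to\mathcal H(\mathbf t^\sigma)$ is the algebra isomorphism with $T_0\mapsto-(T_1^\sigma+z)$, $T_1\mapsto T_1^\sigma$, $z\mapsto-(T_0^\sigma+T_1^\sigma)$. $\gamma_{2n}=t_0+t_1+n$ ($n\ge0$), $\gamma_{2n-1}=-(t_0+t_1+n)$ ($n\ge1$); $p_m$ is the unique monic polynomial of degree $m$ with $Yp_m=\gamma_mp_m$; $x_0=t_1+u_1$;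 $E(x,\gamma_m)=p_m(x)/p_m(-x_0)$. $\Gamma=\{-\gamma_m:m\in\mathbb Z_{\ge0}\}$ and $F$ is the space of finitely supported functions $\Gamma\to\mathbb C$. For $f\in F$ one sets $f(\gamma_0):=f(-\gamma_0)$, so that $f(-\gamma)$ and $f(1-\gamma)$ make sense for all $\gamma\in\Gamma$. (If $0\in\Gamma$, the term with denominator $2\gamma$ is $0$ at $\gamma=0$.) Let $\Gamma(\cdot)$ also denote the Gamma function and $\Gamma(\alpha\pm\beta)=\Gamma(\alpha+\beta)\Gamma(\alpha-\beta)$, and $$\Delta(x)=\frac{\Gamma(a+x)\Gamma(a+1-x)\Gamma(b+x)\Gamma(b+1-x)\Gamma(c\pm x)\Gamma(d\pm x)}{\Gamma(2x)\Gamma(1-2x)}.$$ $\mathcal C$ is a contour along the imaginary axis from $-i\infty$ to $i\infty$, indented so that it separates the sequences $a+n,b+n,c+n,d+n$ from $-(a+n),-(b+n),-(c+n),-(d+n)$ ($n\in\mathbb Z_{\ge0}$), with $\mathcal C=-\mathcal C$ as a set; $\langle f,g\rangle_{\mathbf t}=\frac1{2\pi i}\int_{\mathcal C}f(x)g(x)\Delta(x)dx$. The polynomial Fourier transform $\mathbb F:\mathcal A\to F$ is $(\mathbb Fp)(\gamma)=\langle p,E(\cdot,-\gamma)\rangle_{\mathbf t}$, $\gamma\in\Gamma$. *)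

theory Defs
  imports "HOL-Analysis.Analysis" "HOL-Computational_Algebra.Polynomial"
begin

text \<open>A parameter tuple is \<open>(t0, u0, t1, u1)\<close>, in this order.\<close>

type_synonym params = "complex \<times> complex \<times> complex \<times> complex"

fun par_a :: "params \<Rightarrow> complex" where "par_a (t0, u0, t1, u1) = t1 + u1"
fun par_b :: "params \<Rightarrow> complex" where "par_b (t0, u0, t1, u1) = t1 - u1"
fun par_c :: "params \<Rightarrow> complex" where "par_c (t0, u0, t1, u1) = t0 + u0 + 1/2"
fun par_d :: "params \<Rightarrow> complex" where "par_d (t0, u0, t1, u1) = t0 - u0 + 1/2"

fun dual :: "params \<Rightarrow> params" where
  "dual (t0, u0, t1, u1) = (u1, u0, t1, t0)"

definition generic :: "params \<Rightarrow> bool" where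
  "generic t \<longleftrightarrow> (case t of (t0, u0, t1, u1) \<Rightarrow>
     t0 \<noteq> 0 \<and> t1 \<noteq> 0 \<and>
     (\<forall>n::nat. n \<ge> 1 \<longrightarrow> t0 + t1 \<noteq> - of_nat n / 2)) \<and>
     (\<forall>e \<in> {par_a t, par_b t, par_c t, par_d t}. \<forall>n::nat. e \<noteq> - of_nat n / 2) \<and>
     par_a t + par_b t \<notin> \<int> \<and> par_a t + par_c t \<notin> \<int> \<and> par_a t + par_d t \<notin> \<int> \<and>
     par_b t + par_c t \<notin> \<int> \<and> par_b t + par_d t \<notin> \<int> \<and> par_c t + par_d t \<notin> \<int>"


section \<open>The algebra acting on polynomials\<close>

text \<open>The polynomial divisions below are exact, see \<open>poly_opT0\<close> and \<open>poly_opT1\<close>.\<close>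

fun opT0 :: "params \<Rightarrow> complex poly \<Rightarrow> complex poly" where
  "opT0 (t0, u0, t1, u1) f = smult t0 f +
     [:t0 + u0 + 1/2, -1:] * [:t0 - u0 + 1/2, -1:] * ((pcompose f [:1, -1:] - f) div [:1, -2:])"

fun opT1 :: "params \<Rightarrow> complex poly \<Rightarrow> complex poly" where
  "opT1 (t0, u0, t1, u1) f = smult t1 f +
     [:t1 + u1, 1:] * [:t1 - u1, 1:] * ((pcompose f [:0, -1:] - f) div [:0, 2:])"

definition opZ :: "complex poly \<Rightarrow> complex poly" where
  "opZ f = [:0, 1:] * f"

definition opY :: "params \<Rightarrow> complex poly \<Rightarrow> complex poly" where
  "opY t f = opT0 t f + opT1 t f"

lemma poly_opT0:
  assumes "x \<noteq> 1/2"
  shows "poly (opT0 (t0, u0, t1, u1) f) x = t0 * poly f x +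
    (t0 + u0 + 1/2 - x) * (t0 - u0 + 1/2 - x) / (1 - 2 * x) * (poly f (1 - x) - poly f x)"
proof -
  let ?g = "pcompose f [:1, -1:] - f"
  have "poly ?g (1/2) = 0" by (simp add: poly_pcompose)
  then have "[:-(1/2), 1:] dvd ?g" by (simp only: poly_eq_0_iff_dvd)
  then have "smult (-2) [:-(1/2), 1:] dvd ?g" by (subst smult_dvd_iff) simp
  then have "[:1, -2:] dvd ?g" by simp
  then obtain h where h: "?g = [:1, -2:] * h" by (rule dvdE)
  have quot: "?g div [:1, -2:] = h" unfolding h by (intro nonzero_mult_div_cancel_left) simp
  then have "(1 - 2 * x) * poly (?g div [:1, -2:]) x = poly ?g x"
    unfolding quot unfolding h poly_mult by (simp add: algebra_simps)
  moreover have "1 - 2 * x \<noteq> 0" using assms by (auto simp: field_simps)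
  ultimately have "poly (?g div [:1, -2:]) x = poly ?g x / (1 - 2 * x)"
    by (simp add: field_simps)
  then show ?thesis
    unfolding opT0.simps poly_add poly_mult poly_smult by (simp add: poly_pcompose)
qed

lemma poly_opT1:
  assumes "x \<noteq> 0"
  shows "poly (opT1 (t0, u0, t1, u1) f) x = t1 * poly f x +
    (t1 + u1 + x) * (t1 - u1 + x) / (2 * x) * (poly f (- x) - poly f x)"
proof -
  let ?g = "pcompose f [:0, -1:] - f"
  have "poly ?g 0 = 0" by (simp add: poly_pcompose)
  then have "[:-0, 1:] dvd ?g" by (simp only: poly_eq_0_iff_dvd)
  then have "smult 2 [:0, 1:] dvd ?g" by (subst smult_dvd_iff) simp
  then have "[:0, 2:] dvd ?g" by simp
  then obtain h where h: "?g = [:0, 2:] * h" by (rule dvdE)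
  have quot: "?g div [:0, 2:] = h" unfolding h by (intro nonzero_mult_div_cancel_left) simp
  then have "2 * x * poly (?g div [:0, 2:]) x = poly ?g x"
    unfolding quot unfolding h poly_mult by (simp add: algebra_simps)
  then have "poly (?g div [:0, 2:]) x = poly ?g x / (2 * x)"
    using assms by (simp add: field_simps)
  then show ?thesis
    unfolding opT1.simps poly_add poly_mult poly_smult by (simp add: poly_pcompose)
qed

inductive_set hecke :: "params \<Rightarrow> (complex poly \<Rightarrow> complex poly) set" for t :: params where
  id: "id \<in> hecke t"
| T0: "opT0 t \<in> hecke t"
| T1: "opT1 t \<in> hecke t"
| Z: "opZ \<in> hecke t"
| add: "A \<in> hecke t \<Longrightarrow> B \<in> hecke t \<Longrightarrow> (\<lambda>q. A q + B q) \<in> hecke t"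
| scale: "A \<in> hecke t \<Longrightarrow> (\<lambda>q. smult k (A q)) \<in> hecke t"
| comp: "A \<in> hecke t \<Longrightarrow> B \<in> hecke t \<Longrightarrow> A \<circ> B \<in> hecke t"

text \<open>\<open>hecke_iso t s \<sigma>\<close>: \<open>\<sigma>\<close> is an isomorphism of unital complex algebras from \<open>hecke t\<close>
  onto \<open>hecke s\<close>.  Values of \<open>\<sigma>\<close> outside \<open>hecke t\<close> are irrelevant.\<close>

definition hecke_iso ::
    "params \<Rightarrow> params \<Rightarrow> ((complex poly \<Rightarrow> complex poly) \<Rightarrow> (complex poly \<Rightarrow> complex poly)) \<Rightarrow> bool" where
  "hecke_iso t s \<sigma> \<longleftrightarrow>
     bij_betw \<sigma> (hecke t) (hecke s) \<and>
     \<sigma> id = id \<and>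
     (\<forall>A\<in>hecke t. \<forall>B\<in>hecke t. \<sigma> (\<lambda>q. A q + B q) = (\<lambda>q. \<sigma> A q + \<sigma> B q)) \<and>
     (\<forall>k. \<forall>A\<in>hecke t. \<sigma> (\<lambda>q. smult k (A q)) = (\<lambda>q. smult k (\<sigma> A q))) \<and>
     (\<forall>A\<in>hecke t. \<forall>B\<in>hecke t. \<sigma> (A \<circ> B) = \<sigma> A \<circ> \<sigma> B)"

definition is_sigma ::
    "params \<Rightarrow> ((complex poly \<Rightarrow> complex poly) \<Rightarrow> (complex poly \<Rightarrow> complex poly)) \<Rightarrow> bool" where
  "is_sigma t \<sigma> \<longleftrightarrow>
     hecke_iso t (dual t) \<sigma> \<and>
     \<sigma> (opT0 t) = (\<lambda>q. - (opT1 (dual t) q + opZ q)) \<and>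
     \<sigma> (opT1 t) = opT1 (dual t) \<and>
     \<sigma> opZ = (\<lambda>q. - (opT0 (dual t) q + opT1 (dual t) q))"


section \<open>The eigenpolynomials and the spectrum\<close>

fun gam :: "params \<Rightarrow> nat \<Rightarrow> complex" where
  "gam (t0, u0, t1, u1) m =
     (if even m then t0 + t1 + of_nat (m div 2) else - (t0 + t1 + of_nat ((m + 1) div 2)))"

definition eigpoly :: "params \<Rightarrow> nat \<Rightarrow> complex poly" where
  "eigpoly t m = (THE p. degree p = m \<and> lead_coeff p = 1 \<and> opY t p = smult (gam t m) p)"

text \<open>\<open>eigE t \<mu>\<close> is the polynomial \<open>E(\<cdot>, \<mu>)\<close>, for \<open>\<mu>\<close> one of the (distinct) \<open>gam t m\<close>.
  The base point \<open>x\<^sub>0 = t\<^sub>1 + u\<^sub>1\<close> is \<open>par_a t\<close>.\<close>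

definition eigE :: "params \<Rightarrow> complex \<Rightarrow> complex poly" where
  "eigE t \<mu> = (let p = eigpoly t (THE m. gam t m = \<mu>) in smult (1 / poly p (- par_a t)) p)"

definition spec :: "params \<Rightarrow> complex set" where
  "spec t = {- gam t m | m. True}"


section \<open>Finitely supported functions on the spectrum\<close>

text \<open>A function on \<open>spec t\<close> is represented by its extension by zero to the complex plane.\<close>

definition finsupp :: "params \<Rightarrow> (complex \<Rightarrow> complex) set" where
  "finsupp t = {f. finite {\<gamma>. f \<gamma> \<noteq> 0} \<and> {\<gamma>. f \<gamma> \<noteq> 0} \<subseteq> spec t}"

text \<open>The convention \<open>f(\<gamma>\<^sub>0) := f(-\<gamma>\<^sub>0)\<close>.\<close>

definition ext :: "params \<Rightarrow> (complex \<Rightarrow> complex) \<Rightarrow> complex \<Rightarrow> complex" where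
  "ext t f \<gamma> = (if \<gamma> = gam t 0 then f (- gam t 0) else f \<gamma>)"

fun spT0 :: "params \<Rightarrow> (complex \<Rightarrow> complex) \<Rightarrow> complex \<Rightarrow> complex" where
  "spT0 (t0, u0, t1, u1) f \<gamma> =
     (if \<gamma> \<in> spec (t0, u0, t1, u1) then
        u1 * f \<gamma> + (u1 + u0 + 1/2 - \<gamma>) * (u1 - u0 + 1/2 - \<gamma>) / (1 - 2 * \<gamma>)
          * (ext (t0, u0, t1, u1) f (1 - \<gamma>) - f \<gamma>)
      else 0)"

text \<open>For \<open>\<gamma> = 0\<close> the second summand is \<open>0\<close>, because division by zero yields zero.\<close>

fun spT1 :: "params \<Rightarrow> (complex \<Rightarrow> complex) \<Rightarrow> complex \<Rightarrow> complex" where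
  "spT1 (t0, u0, t1, u1) f \<gamma> =
     (if \<gamma> \<in> spec (t0, u0, t1, u1) then
        t1 * f \<gamma> + (t1 + t0 + \<gamma>) * (t1 - t0 + \<gamma>) / (2 * \<gamma>)
          * (ext (t0, u0, t1, u1) f (- \<gamma>) - f \<gamma>)
      else 0)"

definition finsupp_end :: "params \<Rightarrow> ((complex \<Rightarrow> complex) \<Rightarrow> (complex \<Rightarrow> complex)) set" where
  "finsupp_end t = {L.
     (\<forall>f\<in>finsupp t. L f \<in> finsupp t) \<and>
     (\<forall>f\<in>finsupp t. \<forall>g\<in>finsupp t. L (\<lambda>\<gamma>. f \<gamma> + g \<gamma>) = (\<lambda>\<gamma>. L f \<gamma> + L g \<gamma>)) \<and>
     (\<forall>k. \<forall>f\<in>finsupp t. L (\<lambda>\<gamma>. k * f \<gamma>) = (\<lambda>\<gamma>. k * L f \<gamma>))}"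

text \<open>\<open>is_rep t \<rho>\<close>: \<open>\<rho>\<close> is a representation of the unital algebra \<open>hecke (dual t)\<close> on
  \<open>finsupp t\<close>.  Only the values \<open>\<rho> A f\<close> with \<open>A \<in> hecke (dual t)\<close>, \<open>f \<in> finsupp t\<close> matter.\<close>

definition is_rep ::
    "params \<Rightarrow> ((complex poly \<Rightarrow> complex poly) \<Rightarrow> (complex \<Rightarrow> complex) \<Rightarrow> (complex \<Rightarrow> complex)) \<Rightarrow> bool" where
  "is_rep t \<rho> \<longleftrightarrow>
     (\<forall>A\<in>hecke (dual t). \<rho> A \<in> finsupp_end t) \<and>
     (\<forall>f\<in>finsupp t. \<rho> id f = f) \<and>
     (\<forall>A\<in>hecke (dual t). \<forall>B\<in>hecke (dual t). \<forall>f\<in>finsupp t.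
        \<rho> (\<lambda>q. A q + B q) f = (\<lambda>\<gamma>. \<rho> A f \<gamma> + \<rho> B f \<gamma>)) \<and>
     (\<forall>k. \<forall>A\<in>hecke (dual t). \<forall>f\<in>finsupp t. \<rho> (\<lambda>q. smult k (A q)) f = (\<lambda>\<gamma>. k * \<rho> A f \<gamma>)) \<and>
     (\<forall>A\<in>hecke (dual t). \<forall>B\<in>hecke (dual t). \<forall>f\<in>finsupp t. \<rho> (A \<circ> B) f = \<rho> A (\<rho> B f))"

text \<open>The multiplication operator \<open>(*) p\<close> on polynomials is \<open>p(z)\<close>.\<close>

definition extends_assignments ::
    "params \<Rightarrow> ((complex poly \<Rightarrow> complex poly) \<Rightarrow> (complex \<Rightarrow> complex) \<Rightarrow> (complex \<Rightarrow> complex)) \<Rightarrow> bool" where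
  "extends_assignments t \<rho> \<longleftrightarrow>
     (\<forall>f\<in>finsupp t.
        \<rho> (opT0 (dual t)) f = spT0 t f \<and>
        \<rho> (opT1 (dual t)) f = spT1 t f \<and>
        (\<forall>p. \<rho> ((*) p) f = (\<lambda>\<gamma>. poly p \<gamma> * f \<gamma>)))"


section \<open>The polynomial Fourier transform\<close>

text \<open>\<open>Gamma\<close> is \<open>0\<close> at its poles.  Since \<open>2 x\<close> and \<open>1 - 2 x\<close> are never both poles, the quotient by
  \<open>Gamma (2 * x) * Gamma (1 - 2 * x)\<close> then has its correct value \<open>0\<close> wherever one of them is.\<close>

definition Delta :: "params \<Rightarrow> complex \<Rightarrow> complex" where
  "Delta t x =
     Gamma (par_a t + x) * Gamma (par_a t + 1 - x) *
     Gamma (par_b t + x) * Gamma (par_b t + 1 - x) *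
     (Gamma (par_c t + x) * Gamma (par_c t - x)) *
     (Gamma (par_d t + x) * Gamma (par_d t - x)) /
     (Gamma (2 * x) * Gamma (1 - 2 * x))"

text \<open>A contour from \<open>-\<i>\<infinity>\<close> to \<open>\<i>\<infinity>\<close> is a piecewise continuously differentiable map on the real line
  that follows the imaginary axis outside a compact interval.  A point lies to the right (left)
  of it if it is connected in the complement of the contour to all large positive (negative) reals;
  these two components are distinct.\<close>

definition axis_contour :: "(real \<Rightarrow> complex) \<Rightarrow> bool" where
  "axis_contour C \<longleftrightarrow> (\<exists>R>0. (\<forall>s. \<bar>s\<bar> \<ge> R \<longrightarrow> C s = \<i> * of_real s) \<and>
      C piecewise_C1_differentiable_on {-R..R})"

definition right_of :: "(real \<Rightarrow> complex) \<Rightarrow> complex \<Rightarrow> bool" where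
  "right_of C w \<longleftrightarrow> (\<exists>r0. \<forall>r\<ge>r0. connected_component (- range C) w (of_real r))"

definition left_of :: "(real \<Rightarrow> complex) \<Rightarrow> complex \<Rightarrow> bool" where
  "left_of C w \<longleftrightarrow> (\<exists>r0. \<forall>r\<ge>r0. connected_component (- range C) w (- of_real r))"

definition separating_contour :: "params \<Rightarrow> (real \<Rightarrow> complex) \<Rightarrow> bool" where
  "separating_contour t C \<longleftrightarrow>
     axis_contour C \<and>
     uminus ` range C = range C \<and>
     (\<forall>e\<in>{par_a t, par_b t, par_c t, par_d t}. \<forall>n::nat.
        right_of C (e + of_nat n) \<and> left_of C (- (e + of_nat n)))"

definition pairing :: "params \<Rightarrow> (real \<Rightarrow> complex) \<Rightarrow> complex poly \<Rightarrow> complex poly \<Rightarrow> complex" where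
  "pairing t C f g = 1 / (2 * of_real pi * \<i>) *
     integral UNIV (\<lambda>s. poly f (C s) * poly g (C s) * Delta t (C s) * vector_derivative C (at s))"

definition fourier :: "params \<Rightarrow> (real \<Rightarrow> complex) \<Rightarrow> complex poly \<Rightarrow> complex \<Rightarrow> complex" where
  "fourier t C p \<gamma> = (if \<gamma> \<in> spec t then pairing t C p (eigE t (- \<gamma>)) else 0)"

definition is_fourier_transform ::
    "params \<Rightarrow> ((complex poly \<Rightarrow> complex poly) \<Rightarrow> (complex poly \<Rightarrow> complex poly)) \<Rightarrow>
     ((complex poly \<Rightarrow> complex poly) \<Rightarrow> (complex \<Rightarrow> complex) \<Rightarrow> (complex \<Rightarrow> complex)) \<Rightarrow>
     (complex poly \<Rightarrow> complex \<Rightarrow> complex) \<Rightarrow> bool" where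
  "is_fourier_transform t \<sigma> \<rho> \<Phi> \<longleftrightarrow>
     (\<forall>p. \<Phi> p \<in> finsupp t) \<and>
     (\<forall>p q. \<Phi> (p + q) = (\<lambda>\<gamma>. \<Phi> p \<gamma> + \<Phi> q \<gamma>)) \<and>
     (\<forall>k p. \<Phi> (smult k p) = (\<lambda>\<gamma>. k * \<Phi> p \<gamma>)) \<and>
     (\<forall>A\<in>hecke t. \<forall>p. \<Phi> (A p) = \<rho> (\<sigma> A) (\<Phi> p))"

end

theory Submission
  imports Defs "HOL-Complex_Analysis.Complex_Analysis"
begin

text \<open>The quadratic relations \<open>T\<^sub>0\<^sup>2 = t\<^sub>0\<^sup>2\<close>, \<open>T\<^sub>1\<^sup>2 = t\<^sub>1\<^sup>2\<close>, \<open>(T\<^sub>1 + z)\<^sup>2 = u\<^sub>1\<^sup>2\<close> and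
  \<open>(T\<^sub>0 - z + 1/2)\<^sup>2 = u\<^sub>0\<^sup>2\<close> make \<open>T\<^sub>1\<close> and \<open>S = - (T\<^sub>1 + z)\<close> ladder operators for \<open>Y\<close>: up to a multiple
  of the identity they map the \<open>\<mu>\<close>-eigenspace to the eigenspaces of \<open>- \<mu>\<close> and \<open>- 1 - \<mu>\<close>.
  Starting from \<open>1\<close> they produce all the \<open>p\<^sub>m\<close>.  Both act as a scalar after evaluation at \<open>- x\<^sub>0\<close>, so
  in the normalisation \<open>E(- x\<^sub>0) = 1\<close> the ladder coefficients are those of \<open>T\<^sub>1\<^sup>\<sigma>\<close> and \<open>T\<^sub>0\<^sup>\<sigma>\<close> in the
  spectral variable.  The intertwining property is thereby reduced to the self-adjointness of
  \<open>T\<^sub>0\<close> and \<open>T\<^sub>1\<close> for the pairing.  There the defect is the integral of a function \<open>k\<close> with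
  \<open>k(d - x) = - k(x)\<close>, where \<open>d = 1\<close> for \<open>T\<^sub>0\<close> and \<open>d = 0\<close> for \<open>T\<^sub>1\<close>; it vanishes because the contour and
  its image under \<open>x \<mapsto> d - x\<close>, traversed upwards, separate the poles of \<open>k\<close> in the same way
  and \<open>\<Delta>\<close> decays exponentially.\<close>

section \<open>Quadratic relations and ladder operators\<close>

text \<open>T1, S and Y generate the algebra (T0 = Y - T1, z = - S - T1), and \<sigma> sends them to
  T1^\<sigma>, T0^\<sigma> and -z. They are therefore the natural operators to transform: T1 and S
  yield the two difference operators on the spectrum, Y yields multiplication. The delicate point in
  the self-adjointness of T0 is the reflection x \<mapsto> 1 - x. The points a, b, c, d lie to the
  right of the contour, but nothing is known about their position relative to the reflected contour.
  So the right-hand pole sequences of the integrand must start at a + 1, b + 1, c + 1, d + 1: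
  \<open>Delta\<close> contains Gamma(a + 1 - x) and Gamma(b + 1 - x) from the start, and the factor
  (c - x)(d - x) of T0 shifts the other two. The contour need not be a simple curve, and its sides
  are known only as components of a complement. The position of a pole is therefore expressed by the
  winding number of an open truncated piece, compared with principal logarithms at its ends.\<close>

lemma poly_eqI_off_finite:
  fixes p q :: "complex poly"
  assumes "finite S" and eq: "\<And>x. x \<notin> S \<Longrightarrow> poly p x = poly q x"
  shows "p = q"
proof (rule ccontr)
  assume "p \<noteq> q"
  then have "finite {x. poly (p - q) x = 0}"
    using poly_roots_finite[of "p - q"] by simp
  moreover have "UNIV \<subseteq> S \<union> {x. poly (p - q) x = 0}"
    using eq by auto
  ultimately show False
    using assms(1) infinite_UNIV_char_0[where 'a = complex] by (meson finite_UnI finite_subset)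
qed

section \<open>Linearity of the operators\<close>

lemma opT0_add: "opT0 t (f + g) = opT0 t f + opT0 t g"
proof (cases t)
  case (fields t0 u0 t1 u1)
  \<comment> \<open>The pointwise formula for \<open>opT0\<close> is available only off 1/2;
    polynomials that agree off a finite set are equal.\<close>
  show ?thesis unfolding fields
    by (rule poly_eqI_off_finite[of "{1/2}"])
       (auto simp: poly_opT0 add_divide_distrib diff_divide_distrib algebra_simps simp del: opT0.simps)
qed

lemma opT1_add: "opT1 t (f + g) = opT1 t f + opT1 t g"
proof (cases t)
  case (fields t0 u0 t1 u1)
  show ?thesis unfolding fields
    by (rule poly_eqI_off_finite[of "{0}"])
       (auto simp: poly_opT1 add_divide_distrib diff_divide_distrib algebra_simps simp del: opT1.simps)
qed

lemma opT0_smult: "opT0 t (smult k f) = smult k (opT0 t f)"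
proof (cases t)
  case (fields t0 u0 t1 u1)
  show ?thesis unfolding fields
    by (rule poly_eqI_off_finite[of "{1/2}"])
       (auto simp: poly_opT0 add_divide_distrib diff_divide_distrib algebra_simps simp del: opT0.simps)
qed

lemma opT1_smult: "opT1 t (smult k f) = smult k (opT1 t f)"
proof (cases t)
  case (fields t0 u0 t1 u1)
  show ?thesis unfolding fields
    by (rule poly_eqI_off_finite[of "{0}"])
       (auto simp: poly_opT1 add_divide_distrib diff_divide_distrib algebra_simps simp del: opT1.simps)
qed

lemma opZ_add: "opZ (f + g) = opZ f + opZ g"
  by (simp add: opZ_def algebra_simps)

lemma opZ_smult: "opZ (smult k f) = smult k (opZ f)"
  by (simp add: opZ_def)

lemma additive_minus:
  fixes A :: "complex poly \<Rightarrow> complex poly"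
  assumes "\<And>f g. A (f + g) = A f + A g"
  shows "A (f - g) = A f - A g"
  using assms[of "f - g" g] by simp

lemmas opT0_diff = additive_minus[where A = "opT0 t" for t, OF opT0_add]
lemmas opZ_diff = additive_minus[where A = opZ, OF opZ_add]

lemma opY_add: "opY t (f + g) = opY t f + opY t g"
  by (simp add: opY_def opT0_add opT1_add)

lemma opY_smult: "opY t (smult k f) = smult k (opY t f)"
  by (simp add: opY_def opT0_smult opT1_smult smult_add_right)

lemmas opY_diff = additive_minus[where A = "opY t" for t, OF opY_add]

section \<open>Quadratic relations\<close>

lemma opT0_square: "opT0 (t0, u0, t1, u1) (opT0 (t0, u0, t1, u1) f) = smult (t0\<^sup>2) f"
proof (rule poly_eqI_off_finite[of "{1/2}"])
  fix x :: complex assume "x \<notin> {1/2}"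
  then have x: "x \<noteq> 1/2" by simp
  \<comment> \<open>With the denominator as variable, the reflection becomes D \<mapsto> -D, and
    clearing fractions leaves a polynomial identity.\<close>
  define D where "D = 1 - 2 * x"
  have D: "D \<noteq> 0" using x by (auto simp: D_def field_simps)
  have x': "1 - x \<noteq> 1/2" using x by (auto simp: field_simps)
  have xD: "x = (1 - D) / 2" by (simp add: D_def)
  define A where "A = poly f x" define B where "B = poly f (1 - x)"
  have e: "1 - 2 * (1 - x) = - D" by (simp add: D_def)
  have "poly (opT0 (t0, u0, t1, u1) (opT0 (t0, u0, t1, u1) f)) x
    = t0 * (t0 * A + (t0 + u0 + 1/2 - x) * (t0 - u0 + 1/2 - x) / D * (B - A)) +
      (t0 + u0 + 1/2 - x) * (t0 - u0 + 1/2 - x) / D *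
      ((t0 * B + (t0 + u0 + 1/2 - (1 - x)) * (t0 - u0 + 1/2 - (1 - x)) / (- D) * (A - B))
        - (t0 * A + (t0 + u0 + 1/2 - x) * (t0 - u0 + 1/2 - x) / D * (B - A)))"
    unfolding poly_opT0[OF x] poly_opT0[OF x'] e A_def B_def D_def by simp
  also have "\<dots> = t0\<^sup>2 * A"
    unfolding xD using D by (simp add: divide_simps) algebra
  finally show "poly (opT0 (t0, u0, t1, u1) (opT0 (t0, u0, t1, u1) f)) x = poly (smult (t0\<^sup>2) f) x"
    by (simp add: A_def)
qed simp

lemma opT1_square: "opT1 (t0, u0, t1, u1) (opT1 (t0, u0, t1, u1) f) = smult (t1\<^sup>2) f"
proof (rule poly_eqI_off_finite[of "{0}"])
  fix x :: complex assume "x \<notin> {0}"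
  then have x: "x \<noteq> 0" "- x \<noteq> 0" by simp_all
  define A where "A = poly f x" define B where "B = poly f (- x)"
  have "poly (opT1 (t0, u0, t1, u1) (opT1 (t0, u0, t1, u1) f)) x
    = t1 * (t1 * A + (t1 + u1 + x) * (t1 - u1 + x) / (2 * x) * (B - A)) +
      (t1 + u1 + x) * (t1 - u1 + x) / (2 * x) *
      ((t1 * B + (t1 + u1 - x) * (t1 - u1 - x) / (- (2 * x)) * (A - B))
        - (t1 * A + (t1 + u1 + x) * (t1 - u1 + x) / (2 * x) * (B - A)))"
    unfolding poly_opT1[OF x(1)] poly_opT1[OF x(2)] A_def B_def by simp
  also have "\<dots> = t1\<^sup>2 * A"
    using x by (simp add: divide_simps) algebra
  finally show "poly (opT1 (t0, u0, t1, u1) (opT1 (t0, u0, t1, u1) f)) x = poly (smult (t1\<^sup>2) f) x"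
    by (simp add: A_def)
qed simp

text \<open>Equivalent to (T1 + z)^2 = u1^2 in view of T1^2 = t1^2.\<close>

lemma opT1_anticommute:
  "opT1 (t0, u0, t1, u1) (opZ f) + opZ (opT1 (t0, u0, t1, u1) f)
    = smult (u1\<^sup>2 - t1\<^sup>2) f - opZ (opZ f)"
proof (rule poly_eqI_off_finite[of "{0}"])
  fix x :: complex assume "x \<notin> {0}"
  then have x: "x \<noteq> 0" by simp
  show "poly (opT1 (t0, u0, t1, u1) (opZ f) + opZ (opT1 (t0, u0, t1, u1) f)) x
     = poly (smult (u1\<^sup>2 - t1\<^sup>2) f - opZ (opZ f)) x"
    unfolding poly_add opZ_def poly_mult poly_opT1[OF x] poly_diff poly_smult
    using x by (simp add: divide_simps) algebra
qed simp

text \<open>Equivalent to (T0 - z + 1/2)^2 = u0^2 in view of T0^2 = t0^2.\<close>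

lemma opT0_anticommute:
  "opT0 (t0, u0, t1, u1) (opZ f) + opZ (opT0 (t0, u0, t1, u1) f)
    = smult (t0\<^sup>2 - u0\<^sup>2 + 1/4) f - opZ f + opZ (opZ f) + opT0 (t0, u0, t1, u1) f"
proof (rule poly_eqI_off_finite[of "{1/2}"])
  fix x :: complex assume "x \<notin> {1/2}"
  then have x: "x \<noteq> 1/2" by simp
  define D where "D = 1 - 2 * x"
  have D: "D \<noteq> 0" using x by (auto simp: D_def field_simps)
  have xD: "x = (1 - D) / 2" by (simp add: D_def)
  define A where "A = poly f x" define B where "B = poly f (1 - x)"
  show "poly (opT0 (t0, u0, t1, u1) (opZ f) + opZ (opT0 (t0, u0, t1, u1) f)) x
     = poly (smult (t0\<^sup>2 - u0\<^sup>2 + 1/4) f - opZ f + opZ (opZ f) + opT0 (t0, u0, t1, u1) f) x"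
    unfolding poly_add opZ_def poly_mult poly_opT0[OF x] poly_diff poly_smult
      D_def[symmetric] A_def[symmetric] B_def[symmetric]
    apply (simp add: A_def[symmetric] B_def[symmetric])
    unfolding xD using D by (simp add: divide_simps) algebra
qed simp

text \<open>With the divided difference given as a polynomial q, the formulas hold at every point,
  including 1/2.\<close>

lemma opT0_quotient:
  obtains q where "opT0 (t0, u0, t1, u1) f = smult t0 f + [:t0 + u0 + 1/2, -1:] * [:t0 - u0 + 1/2, -1:] * q"
    and "\<And>x. (1 - 2 * x) * poly q x = poly f (1 - x) - poly f x"
proof
  define q where "q = (pcompose f [:1, -1:] - f) div [:1, -2:]"
  show "opT0 (t0, u0, t1, u1) f = smult t0 f + [:t0 + u0 + 1/2, -1:] * [:t0 - u0 + 1/2, -1:] * q"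
    by (simp add: q_def)
  let ?g = "pcompose f [:1, -1:] - f"
  have "poly ?g (1/2) = 0" by (simp add: poly_pcompose)
  then have "[:-(1/2), 1:] dvd ?g" by (simp only: poly_eq_0_iff_dvd)
  then have "smult (-2) [:-(1/2), 1:] dvd ?g" by (subst smult_dvd_iff) simp
  then have "[:1, -2:] dvd ?g" by simp
  then have "[:1, -2:] * q = ?g" unfolding q_def by (rule dvd_mult_div_cancel)
  then have "poly ([:1, -2:] * q) x = poly ?g x" for x by simp
  then show "(1 - 2 * x) * poly q x = poly f (1 - x) - poly f x" for x
    by (simp add: poly_pcompose algebra_simps)
qed

lemma opT1_quotient:
  obtains q where "opT1 (t0, u0, t1, u1) f = smult t1 f + [:t1 + u1, 1:] * [:t1 - u1, 1:] * q"
    and "\<And>x. 2 * x * poly q x = poly f (- x) - poly f x"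
    and "[:0, 2:] * q = pcompose f [:0, -1:] - f"
proof
  define q where "q = (pcompose f [:0, -1:] - f) div [:0, 2:]"
  show "opT1 (t0, u0, t1, u1) f = smult t1 f + [:t1 + u1, 1:] * [:t1 - u1, 1:] * q"
    by (simp add: q_def)
  let ?g = "pcompose f [:0, -1:] - f"
  have "poly ?g 0 = 0" by (simp add: poly_pcompose)
  then have "[:-0, 1:] dvd ?g" by (simp only: poly_eq_0_iff_dvd)
  then have "smult 2 [:0, 1:] dvd ?g" by (subst smult_dvd_iff) simp
  then have "[:0, 2:] dvd ?g" by simp
  then show q: "[:0, 2:] * q = ?g" unfolding q_def by (rule dvd_mult_div_cancel)
  then have "poly ([:0, 2:] * q) x = poly ?g x" for x by simp
  then show "2 * x * poly q x = poly f (- x) - poly f x" for x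
    by (simp add: poly_pcompose algebra_simps)
qed

section \<open>Growth of degrees under T1\<close>

declare opT0.simps [simp del] opT1.simps [simp del]

text \<open>The divided difference kills even powers and turns x^(2n+1) into -x^(2n); the quadratic
  factor then adds two to the degree. So T1 can raise odd degrees by one.\<close>

lemma coeff_opT1_ge:
  assumes "degree f < 2 * n + 2"
  shows "coeff (opT1 t f) (2 * n + 2) = - coeff f (2 * n + 1)"
    and "k > 2 * n + 2 \<Longrightarrow> coeff (opT1 t f) k = 0"
proof -
  obtain t0 u0 t1 u1 where t: "t = (t0, u0, t1, u1)" by (cases t)
  obtain q where T: "opT1 t f = smult t1 f + [:t1 + u1, 1:] * [:t1 - u1, 1:] * q"
    and q: "[:0, 2:] * q = pcompose f [:0, -1:] - f"
    unfolding t by (rule opT1_quotient)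
  have "coeff ([:0, 2:] * q) (Suc k) = ((-1) ^ Suc k - 1) * coeff f (Suc k)" for k
    unfolding q by (simp add: coeff_pcompose_linear algebra_simps)
  then have cq: "2 * coeff q k = ((-1) ^ Suc k - 1) * coeff f (Suc k)" for k
    by simp
  have big: "coeff q k = 0" if "k > 2 * n" for k
    using cq[of k] that assms by (simp add: coeff_eq_0)
  have lead: "coeff q (2 * n) = - coeff f (2 * n + 1)"
    using cq[of "2 * n"] by simp
  have P: "[:t1 + u1, 1:] * [:t1 - u1, 1:] * q
      = smult (t1\<^sup>2 - u1\<^sup>2) q + pCons 0 (smult (2 * t1) q) + pCons 0 (pCons 0 q)"
    by (intro poly_eqI) (simp add: coeff_pCons algebra_simps power2_eq_square split: nat.splits)
  show "coeff (opT1 t f) (2 * n + 2) = - coeff f (2 * n + 1)"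
    unfolding T P using assms by (simp add: big lead coeff_eq_0 coeff_pCons)
  show "k > 2 * n + 2 \<Longrightarrow> coeff (opT1 t f) k = 0"
    unfolding T P using assms by (auto simp add: big coeff_eq_0 coeff_pCons split: nat.splits)
qed

lemma degree_opT1_even:
  assumes "degree f \<le> 2 * n"
  shows "degree (opT1 t f) \<le> 2 * n"
proof (rule degree_le, intro allI impI)
  fix k assume k: "k > 2 * n"
  show "coeff (opT1 t f) k = 0"
  proof (cases n)
    case 0
    then obtain c where "f = [:c:]" using assms degree_eq_zeroE by auto
    then show ?thesis using k 0 by (cases t) (simp add: coeff_eq_0 opT1.simps)
  next
    case (Suc m)
    show ?thesis
    proof -
      obtain t0 u0 t1 u1 where t: "t = (t0, u0, t1, u1)" by (cases t)
      \<comment> \<open>The top even monomial is an eigenvector of T1, and the rest has degree at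
        most 2n - 1, which T1 raises to at most 2n.\<close>
      define g where "g = f - monom (coeff f (2 * n)) (2 * n)"
      have "coeff g j = 0" if "j \<ge> 2 * n" for j
        using that assms by (auto simp: g_def coeff_eq_0)
      then have "degree g < 2 * m + 2"
        using Suc by (intro degree_lessI) auto
      then have "coeff (opT1 t g) k = 0"
        using coeff_opT1_ge(2)[of g m k t] k Suc by simp
      moreover have "opT1 t (monom (coeff f (2 * n)) (2 * n)) = smult t1 (monom (coeff f (2 * n)) (2 * n))"
        unfolding t by (rule poly_eqI_off_finite[of "{0}"]) (auto simp: poly_opT1 poly_monom simp del: opT1.simps)
      moreover have "f = g + monom (coeff f (2 * n)) (2 * n)" by (simp add: g_def)
      ultimately have "coeff (opT1 t f) k = coeff (smult t1 (monom (coeff f (2 * n)) (2 * n))) k"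
        using opT1_add[of t g "monom (coeff f (2 * n)) (2 * n)"] by simp
      then show ?thesis using k by simp
    qed
  qed
qed

lemma degree_opZ_le: "degree f \<le> n \<Longrightarrow> degree (opZ f) \<le> Suc n"
  unfolding opZ_def using degree_mult_le[of "[:0,1:]" f] by simp

lemma coeff_opZ: "coeff (opZ f) (Suc k) = coeff f k"
  by (simp add: opZ_def)

definition opS :: "params \<Rightarrow> complex poly \<Rightarrow> complex poly" where
  "opS t f = - (opT1 t f + opZ f)"

text \<open>Putting T0 = Y - T1 into T0^2 = t0^2 gives Y T1 + T1 Y = Y^2 + t1^2 - t0^2, here applied
  to an eigenvector.\<close>

lemma opT1_opY:
  assumes "opY (t0, u0, t1, u1) f = smult \<mu> f" (is "opY ?t f = _")
  shows "opY ?t (opT1 ?t f) = smult (\<mu>\<^sup>2 + t1\<^sup>2 - t0\<^sup>2) f - smult \<mu> (opT1 ?t f)"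
proof -
  have T0: "opT0 ?t f = smult \<mu> f - opT1 ?t f"
    using assms unfolding opY_def by (simp add: algebra_simps)
  have "smult (t0\<^sup>2) f = smult \<mu> (opT0 ?t f) - opT0 ?t (opT1 ?t f)"
    using opT0_square[of t0 u0 t1 u1 f] unfolding T0 opT0_diff opT0_smult by simp
  then have T01: "opT0 ?t (opT1 ?t f) = smult \<mu> (smult \<mu> f - opT1 ?t f) - smult (t0\<^sup>2) f"
    unfolding T0 by (simp add: algebra_simps)
  show ?thesis
    unfolding opY_def opT1_square T01
    by (intro poly_eqI) (simp add: algebra_simps power2_eq_square)
qed

text \<open>Since T0 - z + 1/2 = Y + 1/2 + S, the squares u0^2 of this operator and u1^2 of S amount
  to (Y + 1/2) S + S (Y + 1/2) = u0^2 - u1^2 - (Y + 1/2)^2.\<close>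

lemma opS_opY:
  assumes "opY (t0, u0, t1, u1) f = smult \<mu> f" (is "opY ?t f = _")
  shows "opY ?t (opS ?t f) = smult (u0\<^sup>2 - u1\<^sup>2 - (\<mu> + 1/2)\<^sup>2) f - smult (1 + \<mu>) (opS ?t f)"
proof -
  let ?h = "opT1 ?t f"
  have T0: "opT0 ?t f = smult \<mu> f - ?h"
    using assms unfolding opY_def by (simp add: algebra_simps)
  have Yh: "opY ?t ?h = smult (\<mu>\<^sup>2 + t1\<^sup>2 - t0\<^sup>2) f - smult \<mu> ?h"
    by (rule opT1_opY[OF assms])
  have zT0: "opZ (opT0 ?t f) = smult \<mu> (opZ f) - opZ ?h"
    unfolding T0 opZ_diff opZ_smult ..
  have "opY ?t (opZ f) = smult (u1\<^sup>2 - t1\<^sup>2 + t0\<^sup>2 - u0\<^sup>2 + 1/4) f - opZ f + opT0 ?t f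
      - opZ (opT0 ?t f) - opZ ?h"
  proof (rule poly_eqI)
    fix n
    show "coeff (opY ?t (opZ f)) n = coeff (smult (u1\<^sup>2 - t1\<^sup>2 + t0\<^sup>2 - u0\<^sup>2 + 1/4) f - opZ f
        + opT0 ?t f - opZ (opT0 ?t f) - opZ ?h) n"
      using arg_cong[OF opT1_anticommute[of t0 u0 t1 u1 f], of "\<lambda>p. coeff p n"]
        arg_cong[OF opT0_anticommute[of t0 u0 t1 u1 f], of "\<lambda>p. coeff p n"]
      unfolding opY_def coeff_add coeff_diff coeff_smult by algebra
  qed
  then have "opY ?t (opZ f) = smult (u1\<^sup>2 - t1\<^sup>2 + t0\<^sup>2 - u0\<^sup>2 + 1/4 + \<mu>) f
      - smult (1 + \<mu>) (opZ f) - ?h"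
    unfolding zT0 unfolding T0
    by (simp only:) (intro poly_eqI, simp add: algebra_simps)
  moreover have "opY ?t (opS ?t f) = - (opY ?t ?h + opY ?t (opZ f))"
    unfolding opS_def using opY_smult[of ?t "-1" "?h + opZ f"] by (simp add: opY_add)
  ultimately have S: "opY ?t (opS ?t f) = - (smult (\<mu>\<^sup>2 + t1\<^sup>2 - t0\<^sup>2) f - smult \<mu> ?h
      + (smult (u1\<^sup>2 - t1\<^sup>2 + t0\<^sup>2 - u0\<^sup>2 + 1/4 + \<mu>) f - smult (1 + \<mu>) (opZ f) - ?h))"
    unfolding Yh by simp
  show ?thesis
    unfolding S unfolding opS_def
    by (intro poly_eqI) (simp add: algebra_simps power2_eq_square)
qed

text \<open>The subtracted multiple c solves 2 \<mu> c = \<mu>^2 + t1^2 - t0^2, which removes the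
  unwanted f-component. The new vector could still be zero; its value at the base point decides
  that.\<close>

lemma opT1_ladder:
  assumes "opY (t0, u0, t1, u1) f = smult \<mu> f" (is "opY ?t f = _") and "\<mu> \<noteq> 0"
  shows "opY ?t (opT1 ?t f - smult ((\<mu>\<^sup>2 + t1\<^sup>2 - t0\<^sup>2) / (2 * \<mu>)) f)
    = smult (- \<mu>) (opT1 ?t f - smult ((\<mu>\<^sup>2 + t1\<^sup>2 - t0\<^sup>2) / (2 * \<mu>)) f)"
  unfolding opY_diff opY_smult opT1_opY[OF assms(1)] assms(1) using assms(2)
  by (intro poly_eqI) (simp add: field_simps power2_eq_square)

lemma opS_ladder:
  assumes "opY (t0, u0, t1, u1) f = smult \<mu> f" (is "opY ?t f = _") and "2 * \<mu> + 1 \<noteq> 0"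
  defines "c \<equiv> (u0\<^sup>2 - u1\<^sup>2 - (\<mu> + 1/2)\<^sup>2) / (2 * \<mu> + 1)"
  shows "opY ?t (opS ?t f - smult c f) = smult (- 1 - \<mu>) (opS ?t f - smult c f)"
proof -
  have c: "u0\<^sup>2 - u1\<^sup>2 - (\<mu> + 1/2)\<^sup>2 = (2 * \<mu> + 1) * c"
    using assms(2) by (simp add: c_def)
  show ?thesis
    unfolding opY_diff opY_smult opS_opY[OF assms(1)] assms(1) c
    by (intro poly_eqI) (simp add: algebra_simps)
qed

section \<open>Evaluation at the base point\<close>

declare gam.simps [simp del]

text \<open>The factor t1 + u1 + x of the difference term vanishes at x = -x0. Consequently S acts
  there as -(t1 - x0) = u1.\<close>

lemma poly_opT1_base:
  assumes "par_a t \<noteq> 0"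
  shows "poly (opT1 t f) (- par_a t) = (case t of (t0, u0, t1, u1) \<Rightarrow> t1) * poly f (- par_a t)"
proof (cases t)
  case (fields t0 u0 t1 u1)
  then have "- (t1 + u1) \<noteq> 0" using assms by (simp only: neg_equal_0_iff_equal par_a.simps not_False_eq_True)
  from poly_opT1[OF this] show ?thesis by (simp add: fields)
qed

lemma poly_opS_base:
  assumes "par_a t \<noteq> 0"
  shows "poly (opS t f) (- par_a t) = (case t of (t0, u0, t1, u1) \<Rightarrow> u1) * poly f (- par_a t)"
  using poly_opT1_base[OF assms] by (cases t) (simp add: opS_def opZ_def algebra_simps)

section \<open>Eigenpolynomials of \<open>Y\<close>\<close>

lemma opY_1: "opY (t0, u0, t1, u1) 1 = [:t0 + t1:]"
  by (simp add: opY_def opT0.simps opT1.simps pcompose_1)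

locale generic_params =
  fixes t0 u0 t1 u1 :: complex
  assumes generic: "generic (t0, u0, t1, u1)"
begin

abbreviation "t \<equiv> (t0, u0, t1, u1)"

section \<open>The spectrum under the genericity assumptions\<close>

lemma t01: "2 * (t0 + t1) + of_nat n \<noteq> 0" if "n \<ge> 1"
proof
  assume "2 * (t0 + t1) + of_nat n = 0"
  then have "t0 + t1 = - of_nat n / 2" by (simp add: field_simps eq_neg_iff_add_eq_0)
  then show False using generic that unfolding generic_def by auto
qed

text \<open>Here 2 t1 = a + b and 2 t0 + 1 = c + d.\<close>

lemma t1_Ints: "2 * t1 \<notin> \<int>" and t0_Ints: "2 * t0 \<notin> \<int>"
proof -
  have "2 * t1 \<notin> \<int>" "2 * t0 + 1 \<notin> \<int>"
    using generic by (auto simp: generic_def algebra_simps)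
  then show "2 * t1 \<notin> \<int>" "2 * t0 \<notin> \<int>"
    by (auto dest: Ints_add[OF _ Ints_1])
qed

lemma ac_Ints: "t1 + u1 + (t0 + u0 + 1/2) \<notin> \<int>" and ad_Ints: "t1 + u1 + (t0 - u0 + 1/2) \<notin> \<int>"
  using generic by (auto simp: generic_def)

lemma par_a_nz: "par_a t \<noteq> 0"
proof -
  have "par_a t \<noteq> - of_nat 0 / 2" using generic unfolding generic_def by blast
  then show ?thesis by simp
qed

lemma gam_even: "gam t (2 * n) = t0 + t1 + of_nat n"
  and gam_odd: "gam t (2 * n + 1) = - (t0 + t1 + of_nat n + 1)"
  by (simp_all add: gam.simps algebra_simps)

lemma gam_parity:
  obtains n where "m = 2 * n" "gam t m = t0 + t1 + of_nat n"
  | n where "m = 2 * n + 1" "gam t m = - (t0 + t1 + of_nat n + 1)"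
proof (cases "even m")
  case True
  then obtain n where "m = 2 * n" by (rule evenE)
  then show thesis using that(1) gam_even by simp
next
  case False
  then obtain n where "m = 2 * n + 1" by (rule oddE)
  then show thesis using that(2) gam_odd by simp
qed

lemma gam_even_odd: "t0 + t1 + of_nat n \<noteq> - (t0 + t1 + of_nat k + 1)"
proof
  assume "t0 + t1 + of_nat n = - (t0 + t1 + of_nat k + 1)"
  then have "2 * (t0 + t1) + of_nat (n + k + 1) = 0" by (simp add: algebra_simps eq_neg_iff_add_eq_0)
  then show False using t01[of "n + k + 1"] by simp
qed

lemma inj_gam: "inj (gam t)"
proof
  fix m k assume "gam t m = gam t k"
  then show "m = k"
    using gam_even_odd gam_even_odd[symmetric]
    by (cases m rule: gam_parity; cases k rule: gam_parity) auto
qed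

text \<open>The index 0 is left out because genericity permits t0 + t1 = 0.\<close>

lemma gam_nz: "gam t m \<noteq> 0" if "m \<ge> 1"
proof
  assume 0: "gam t m = 0"
  show False
  proof (cases m rule: gam_parity)
    case (1 n)
    then have "2 * (t0 + t1) + of_nat (2 * n) = 2 * gam t m" by (simp)
    then show False using 0 that t01[of "2 * n"] 1(1) by (simp)
  next
    case (2 n)
    then have "2 * (t0 + t1) + of_nat (2 * (n + 1)) = - 2 * gam t m" by (simp)
    then show False using 0 t01[of "2 * (n + 1)"] by (simp)
  qed
qed

lemma gam_half: "2 * gam t m + 1 \<noteq> 0"
proof
  assume 0: "2 * gam t m + 1 = 0"
  show False
  proof (cases m rule: gam_parity)
    case (1 n)
    then have "2 * (t0 + t1) + of_nat (2 * n + 1) = 2 * gam t m + 1" by (simp)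
    then show False using 0 t01[of "2 * n + 1"] by (simp)
  next
    case (2 n)
    then have "2 * (t0 + t1) + of_nat (2 * n + 1) = - (2 * gam t m + 1)" by (simp)
    then show False using 0 t01[of "2 * n + 1"] by (simp)
  qed
qed

lemma gam_Suc_even: "even m \<Longrightarrow> gam t (Suc m) = - 1 - gam t m"
  and gam_Suc_odd: "odd m \<Longrightarrow> gam t (Suc m) = - gam t m"
  by (auto elim!: evenE oddE simp: gam.simps algebra_simps)

text \<open>Up to a nonzero factor the difference is (\<mu> - t1 - t0)(\<mu> - t1 + t0). The first
  factor vanishes only if \<mu> equals the different eigenvalue \<open>gam t 0\<close>, the second
  only if a + b = 2 t1 is an integer.\<close>

lemma opT1_ladder_coeff:
  "gam t (2 * n + 1) = \<mu> \<Longrightarrow> t1 - (\<mu>\<^sup>2 + t1\<^sup>2 - t0\<^sup>2) / (2 * \<mu>) \<noteq> 0"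
proof
  assume \<mu>: "gam t (2 * n + 1) = \<mu>" and 0: "t1 - (\<mu>\<^sup>2 + t1\<^sup>2 - t0\<^sup>2) / (2 * \<mu>) = 0"
  have "\<mu> \<noteq> 0" using gam_nz[of "2 * n + 1"] \<mu> by simp
  with 0 have "(\<mu> - t1 - t0) * (\<mu> - t1 + t0) = 0"
    by (simp add: field_simps power2_eq_square)
  then have "\<mu> - t1 - t0 = 0 \<or> \<mu> - t1 + t0 = 0" by (simp only: mult_eq_0_iff)
  then consider "\<mu> = t1 + t0" | "\<mu> = t1 - t0" by (metis diff_diff_add diff_eq_diff_eq eq_iff_diff_eq_0 diff_add_eq diff_diff_eq2)
  then show False
  proof cases
    case 1
    then have "t0 + t1 + of_nat 0 = - (t0 + t1 + of_nat n + 1)"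
      using \<mu> gam_odd[of n] by (simp only: add.commute of_nat_0 add_0_left)
    then show False using gam_even_odd by blast
  next
    case 2
    moreover have "2 * t1 = (t1 - t0 - \<mu>) - of_nat (n + 1)" using \<mu> gam_odd[of n] by simp
    ultimately have "2 * t1 = - of_nat (n + 1)" by simp
    then show False using t1_Ints by (metis Ints_minus Ints_of_nat)
  qed
qed

text \<open>Up to a nonzero factor the difference is (u1 + \<mu> + 1/2 - u0)(u1 + \<mu> + 1/2 + u0);
  for \<mu> = t0 + t1 + n the two factors are a + d + n and a + c + n.\<close>

lemma opS_ladder_coeff:
  "gam t (2 * n) = \<mu> \<Longrightarrow> u1 - (u0\<^sup>2 - u1\<^sup>2 - (\<mu> + 1/2)\<^sup>2) / (2 * \<mu> + 1) \<noteq> 0"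
proof
  assume \<mu>: "gam t (2 * n) = \<mu>" and 0: "u1 - (u0\<^sup>2 - u1\<^sup>2 - (\<mu> + 1/2)\<^sup>2) / (2 * \<mu> + 1) = 0"
  have "2 * \<mu> + 1 \<noteq> 0" using gam_half \<mu> by blast
  moreover have "u1 = (u0\<^sup>2 - u1\<^sup>2 - (\<mu> + 1/2)\<^sup>2) / (2 * \<mu> + 1)" using 0 by simp
  ultimately have "u1 * (2 * \<mu> + 1) = u0\<^sup>2 - u1\<^sup>2 - (\<mu> + 1/2)\<^sup>2"
    by (metis nonzero_mult_div_cancel_right nonzero_eq_divide_eq)
  then have *: "(u1 + (\<mu> + 1/2) - u0) * (u1 + (\<mu> + 1/2) + u0) = 0"
    by algebra
 have \<mu>': "\<mu> = t0 + t1 + of_nat n" using \<mu> gam_even[of n] by (simp only:)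
  from * consider "u1 + (\<mu> + 1/2) + u0 = 0" | "u1 + (\<mu> + 1/2) - u0 = 0" by auto
  then show False
  proof cases
    case 1
    moreover have "t1 + u1 + (t0 + u0 + 1/2) = u1 + (\<mu> + 1/2) + u0 - of_nat n"
      by (simp add: \<mu>')
    ultimately have "t1 + u1 + (t0 + u0 + 1/2) = - of_nat n" by simp
    then show False using ac_Ints by (metis Ints_minus Ints_of_nat)
  next
    case 2
    moreover have "t1 + u1 + (t0 - u0 + 1/2) = u1 + (\<mu> + 1/2) - u0 - of_nat n"
      by (simp add: \<mu>')
    ultimately have "t1 + u1 + (t0 - u0 + 1/2) = - of_nat n" by simp
    then show False using ad_Ints by (metis Ints_minus Ints_of_nat)
  qed
qed

text \<open>S leads from even degrees to odd ones, T1 from odd to even. Nonvanishing at the base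
  point is carried through the induction: each step multiplies the value by u1 - c or t1 - c, and
  the normalisation by E needs it.\<close>

lemma eigpoly_exists:
  "\<exists>p. degree p = m \<and> p \<noteq> 0 \<and> opY t p = smult (gam t m) p \<and> poly p (- par_a t) \<noteq> 0"
proof (induction m)
  case 0
  show ?case by (rule exI[of _ 1]) (simp add: opY_1 gam.simps)
next
  case (Suc m)
  then obtain p where p: "degree p = m" "p \<noteq> 0" "opY t p = smult (gam t m) p" "poly p (- par_a t) \<noteq> 0"
    by blast
  show ?case
  proof (cases "even m")
    case True
    then obtain n where m: "m = 2 * n" by (rule evenE)
    define c where "c = (u0\<^sup>2 - u1\<^sup>2 - (gam t m + 1/2)\<^sup>2) / (2 * gam t m + 1)"
    define q where "q = opS t p - smult c p"
    have "opY t q = smult (gam t (Suc m)) q"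
      unfolding q_def c_def gam_Suc_even[OF True] by (rule opS_ladder[OF p(3) gam_half])
    moreover have "poly q (- par_a t) = (u1 - c) * poly p (- par_a t)"
      unfolding q_def poly_diff poly_opS_base[OF par_a_nz] by (simp add: algebra_simps)
    then have "poly q (- par_a t) \<noteq> 0"
      using p(4) opS_ladder_coeff[of n "gam t m"] unfolding c_def m by simp
    \<comment> \<open>T1 does not raise an even degree, so the new leading term comes from z
      alone.\<close>
    moreover have "coeff (opT1 t p) (Suc m) = 0"
      using degree_opT1_even[of p n t] p(1) m by (intro coeff_eq_0) simp
    then have "coeff q (Suc m) = - lead_coeff p"
      unfolding q_def opS_def using p(1) by (simp add: coeff_opZ coeff_eq_0)
    then have "degree q \<ge> Suc m" using p(2) by (intro le_degree) simp
    moreover have "degree (opT1 t p + opZ p) \<le> Suc m"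
      using p(1) m degree_opT1_even[of p n t] by (intro degree_add_le degree_opZ_le) simp_all
    then have "degree q \<le> Suc m"
      unfolding q_def opS_def using p(1)
      by (intro degree_diff_le) (simp_all only: degree_minus, simp)
    ultimately show ?thesis by (metis le_antisym poly_0)
  next
    case False
    then obtain n where m: "m = 2 * n + 1" by (rule oddE)
    define c where "c = ((gam t m)\<^sup>2 + t1\<^sup>2 - t0\<^sup>2) / (2 * gam t m)"
    define q where "q = opT1 t p - smult c p"
    have "gam t m \<noteq> 0" using gam_nz m by simp
    then have "opY t q = smult (gam t (Suc m)) q"
      unfolding q_def c_def gam_Suc_odd[OF False] by (rule opT1_ladder[OF p(3)])
    moreover have "poly q (- par_a t) = (t1 - c) * poly p (- par_a t)"
      unfolding q_def poly_diff poly_opT1_base[OF par_a_nz] by (simp add: algebra_simps)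
    then have "poly q (- par_a t) \<noteq> 0"
      using p(4) opT1_ladder_coeff[of n "gam t m"] unfolding c_def m by simp
    \<comment> \<open>From an odd degree T1 itself raises the degree.\<close>
    moreover have "coeff q (Suc m) = - lead_coeff p"
      unfolding q_def using p(1) m coeff_opT1_ge(1)[of p n t] by (simp add: coeff_eq_0)
    then have "degree q \<ge> Suc m" using p(2) by (intro le_degree) simp
    moreover have "degree q \<le> Suc m"
      unfolding q_def using p(1) m coeff_opT1_ge(2)[of p n _ t]
      by (intro degree_diff_le) (auto intro!: degree_le)
    ultimately show ?thesis by (metis le_antisym poly_0)
  qed
qed

lemma eigpoly_monic_exists:
  "\<exists>p. degree p = m \<and> lead_coeff p = 1 \<and> opY t p = smult (gam t m) p \<and> poly p (- par_a t) \<noteq> 0"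
proof -
  obtain p where p: "degree p = m" "p \<noteq> 0" "opY t p = smult (gam t m) p" "poly p (- par_a t) \<noteq> 0"
    using eigpoly_exists by blast
  have "degree (smult (1 / lead_coeff p) p) = m \<and> lead_coeff (smult (1 / lead_coeff p) p) = 1 \<and>
    opY t (smult (1 / lead_coeff p) p) = smult (gam t m) (smult (1 / lead_coeff p) p) \<and>
    poly (smult (1 / lead_coeff p) p) (- par_a t) \<noteq> 0"
    using p by (simp add: opY_smult mult.commute leading_coeff_0_iff del: par_a.simps) (metis leading_coeff_0_iff)
  then show ?thesis by blast
qed

text \<open>T0 and T1 separately raise some degrees; only their sum is triangular. Expansion in
  eigenpolynomials, one for each degree, shows this without comparing leading terms of T0 and
  T1.\<close>

lemma degree_opY_le: "degree f \<le> n \<Longrightarrow> degree (opY t f) \<le> n"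
proof (induction n arbitrary: f)
  case 0
  then obtain c where "f = [:c:]" by (auto elim: degree_eq_zeroE)
  then have "f = smult c 1" by simp
  then have "opY t f = smult c [:t0 + t1:]" by (simp only: opY_smult opY_1)
  then show ?case by simp
next
  case (Suc n)
  obtain p where p: "degree p = Suc n" "lead_coeff p = 1" "opY t p = smult (gam t (Suc n)) p"
    using eigpoly_monic_exists by blast
  define r where "r = f - smult (coeff f (Suc n)) p"
  have "coeff r k = 0" if "k > n" for k
    using that p Suc.prems by (cases "k = Suc n") (auto simp: r_def coeff_eq_0)
  then have "degree r \<le> n" by (intro degree_le) simp
  then have "degree (opY t r) \<le> n" by (rule Suc.IH)
  moreover have "f = r + smult (coeff f (Suc n)) p" by (simp add: r_def)
  then have "opY t f = opY t r + smult (coeff f (Suc n)) (smult (gam t (Suc n)) p)"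
    using p(3) by (metis opY_add opY_smult)
  ultimately show ?case using p(1) by (simp add: degree_add_le le_SucI)
qed

text \<open>Y is triangular with diagonal entry \<open>gam t d\<close> in degree d, so the
  coefficients of degree d decide.\<close>

lemma eigenvalue_degree:
  assumes "opY t f = smult \<mu> f" "f \<noteq> 0"
  shows "\<mu> = gam t (degree f)"
proof -
  define d where "d = degree f"
  obtain p where p: "degree p = d" "lead_coeff p = 1" "opY t p = smult (gam t d) p"
    using eigpoly_monic_exists by blast
  define r where "r = f - smult (coeff f d) p"
  have f: "f = r + smult (coeff f d) p" by (simp add: r_def)
  have "coeff (opY t r) d = 0"
  proof (cases "d = 0")
    case True
    then obtain c where "f = [:c:]" by (metis d_def degree_eq_zeroE)
    moreover have "p = 1" using p(1,2) True by (metis degree_eq_zeroE lead_coeff_pCons(2) one_pCons)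
    ultimately have "r = 0" by (simp add: r_def True)
    then show ?thesis using opY_smult[of t 0 0] by simp
  next
    case False
    have "coeff r k = 0" if "k > d - 1" for k
      using that p False by (cases "k = d") (auto simp: r_def coeff_eq_0 d_def)
    then have "degree r \<le> d - 1" by (intro degree_le) simp
    then have "degree (opY t r) \<le> d - 1" by (rule degree_opY_le)
    then show ?thesis using False by (intro coeff_eq_0) simp
  qed
  then have "coeff (opY t f) d = coeff f d * gam t d"
    using p f by (metis add_0 coeff_add coeff_smult mult.right_neutral opY_add opY_smult)
  then show ?thesis using assms by (simp add: d_def)
qed

text \<open>A nonzero difference would be an eigenvector of a degree other than m, hence for another
  eigenvalue.\<close>

lemma eigenspace:
  assumes "opY t f = smult (gam t m) f" "opY t p = smult (gam t m) p" "degree p = m" "lead_coeff p = 1"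
  shows "f = smult (coeff f m) p"
proof (rule ccontr)
  assume ne: "f \<noteq> smult (coeff f m) p"
  define r where "r = f - smult (coeff f m) p"
  have r: "r \<noteq> 0" "opY t r = smult (gam t m) r"
    using ne assms by (simp_all add: r_def opY_diff opY_smult smult_diff_right mult.commute)
  then have "degree r = m" using eigenvalue_degree injD[OF inj_gam] by metis
  moreover have "coeff r m = 0" using assms by (simp add: r_def)
  ultimately show False using r(1) by (metis leading_coeff_0_iff)
qed

lemma eigpoly:
  shows degree_eigpoly: "degree (eigpoly t m) = m"
    and lead_coeff_eigpoly: "lead_coeff (eigpoly t m) = 1"
    and opY_eigpoly: "opY t (eigpoly t m) = smult (gam t m) (eigpoly t m)"
    and poly_eigpoly_nz: "poly (eigpoly t m) (- par_a t) \<noteq> 0"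
proof -
  obtain p where p: "degree p = m" "lead_coeff p = 1" "opY t p = smult (gam t m) p" "poly p (- par_a t) \<noteq> 0"
    using eigpoly_monic_exists by blast
  have "eigpoly t m = p"
    unfolding eigpoly_def
  proof (rule the_equality)
    fix q assume "degree q = m \<and> lead_coeff q = 1 \<and> opY t q = smult (gam t m) q"
    then show "q = p" using eigenspace[of q m p] p by (metis smult_1_left)
  qed (use p in simp)
  with p show "degree (eigpoly t m) = m" "lead_coeff (eigpoly t m) = 1"
    "opY t (eigpoly t m) = smult (gam t m) (eigpoly t m)" "poly (eigpoly t m) (- par_a t) \<noteq> 0"
    by simp_all
qed

section \<open>Normalised eigenpolynomials\<close>

definition E :: "nat \<Rightarrow> complex poly" where "E m = eigE t (gam t m)"

lemma E_altdef: "E m = smult (1 / poly (eigpoly t m) (- par_a t)) (eigpoly t m)"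
proof -
  have "(THE k. gam t k = gam t m) = m"
    using injD[OF inj_gam] by blast
  then show ?thesis by (simp add: E_def eigE_def Let_def par_a.simps)
qed

lemma opY_E: "opY t (E m) = smult (gam t m) (E m)"
  unfolding E_altdef opY_smult opY_eigpoly by (simp add: mult.commute)

lemma poly_E_base: "poly (E m) (- par_a t) = 1"
  using poly_eigpoly_nz[of m] by (simp add: E_altdef del: par_a.simps)

lemma degree_E: "degree (E m) = m"
  using poly_eigpoly_nz[of m] by (simp add: E_altdef degree_eigpoly del: par_a.simps)

lemma eigenspace_E:
  assumes "opY t f = smult (gam t m) f"
  shows "f = smult (poly f (- par_a t)) (E m)"
proof -
  have 1: "f = smult (coeff f m) (eigpoly t m)"
    using eigenspace[OF assms opY_eigpoly degree_eigpoly lead_coeff_eigpoly] .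
  then have "poly f (- par_a t) = coeff f m * poly (eigpoly t m) (- par_a t)"
    by (metis poly_smult)
  then show ?thesis using 1 poly_eigpoly_nz[of m] by (simp add: E_altdef del: par_a.simps)
qed

lemma opT1_E:
  assumes "gam t k = - gam t m" "gam t m \<noteq> 0"
  defines "c \<equiv> (t1 + t0 - gam t m) * (t1 - t0 - gam t m) / (- 2 * gam t m)"
  shows "opT1 t (E m) = smult t1 (E m) + smult c (E k - E m)"
proof -
  let ?\<mu> = "gam t m"
  define c' where "c' = (?\<mu>\<^sup>2 + t1\<^sup>2 - t0\<^sup>2) / (2 * ?\<mu>)"
  define g where "g = opT1 t (E m) - smult c' (E m)"
  have "opY t g = smult (gam t k) g"
    unfolding g_def c'_def assms(1) by (rule opT1_ladder[OF opY_E assms(2)])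
  then have "g = smult (poly g (- par_a t)) (E k)" by (rule eigenspace_E)
  moreover have "poly g (- par_a t) = t1 - c'"
    unfolding g_def poly_diff poly_opT1_base[OF par_a_nz] poly_smult poly_E_base by simp
  ultimately have "g = smult (t1 - c') (E k)" by simp
  then have "opT1 t (E m) = smult c' (E m) + smult (t1 - c') (E k)"
    by (simp add: g_def diff_eq_eq add.commute)
  moreover have c: "c' = t1 - c"
    using assms(2) unfolding c'_def c_def by (simp add: divide_simps) algebra
  ultimately show ?thesis unfolding c by (simp add: smult_diff_left smult_diff_right algebra_simps)
qed

text \<open>The ladder identity needs a nonzero eigenvalue and a partner index, neither of which is
  available for index 0 in general; constants are eigenvectors of T1 instead.\<close>

lemma opT1_E_0: "opT1 t (E 0) = smult t1 (E 0)"
proof -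
  have "degree (E 0) = 0" by (rule degree_E)
  then obtain c where "E 0 = [:c:]" by (rule degree_eq_zeroE)
  then show ?thesis by (simp add: opT1.simps)
qed

lemma opS_E:
  assumes "gam t k = - 1 - gam t m"
  defines "c \<equiv> (u1 + u0 + 1/2 + gam t m) * (u1 - u0 + 1/2 + gam t m) / (1 + 2 * gam t m)"
  shows "opS t (E m) = smult u1 (E m) + smult c (E k - E m)"
proof -
  let ?\<mu> = "gam t m"
  define c' where "c' = (u0\<^sup>2 - u1\<^sup>2 - (?\<mu> + 1/2)\<^sup>2) / (2 * ?\<mu> + 1)"
  define g where "g = opS t (E m) - smult c' (E m)"
  have "opY t g = smult (gam t k) g"
    unfolding g_def c'_def assms(1) by (rule opS_ladder[OF opY_E gam_half])
  then have "g = smult (poly g (- par_a t)) (E k)" by (rule eigenspace_E)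
  moreover have "poly g (- par_a t) = u1 - c'"
    unfolding g_def poly_diff poly_opS_base[OF par_a_nz] poly_smult poly_E_base by simp
  ultimately have "g = smult (u1 - c') (E k)" by simp
  then have "opS t (E m) = smult c' (E m) + smult (u1 - c') (E k)"
    by (simp add: g_def diff_eq_eq add.commute)
  moreover have c: "c' = u1 - c"
    using gam_half[of m] unfolding c'_def c_def by (simp add: divide_simps add.commute) algebra
  ultimately show ?thesis unfolding c by (simp add: smult_diff_left smult_diff_right algebra_simps)
qed

end

declare dual.simps [simp del]

section \<open>The representation on the spectrum\<close>

text \<open>Newton interpolation: the product over the earlier nodes corrects the value at the new
  one.\<close>

lemma interpolation_poly_exists:
  fixes z :: "nat \<Rightarrow> complex"
  assumes "inj z"
  shows "\<exists>p. \<forall>j\<le>K. poly p (z j) = v j"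
proof (induction K)
  case 0
  show ?case by (rule exI[of _ "[:v 0:]"]) simp
next
  case (Suc K)
  then obtain p where p: "\<And>j. j \<le> K \<Longrightarrow> poly p (z j) = v j" by blast
  define w where "w = (\<Prod>j\<le>K. [:- z j, 1:])"
  have w0: "poly w (z j) = 0" if "j \<le> K" for j
    unfolding w_def poly_prod using that by (intro prod_zero) auto
  have w1: "poly w (z (Suc K)) \<noteq> 0"
    unfolding w_def poly_prod by (auto simp: inj_eq[OF assms])
  define c where "c = (v (Suc K) - poly p (z (Suc K))) / poly w (z (Suc K))"
  have "poly (p + smult c w) (z j) = v j" if "j \<le> Suc K" for j
    using that p w0 w1 by (cases "j = Suc K") (auto simp: c_def)
  then show ?case by blast
qed

lemma hecke_additive: "A \<in> hecke s \<Longrightarrow> A (p + q) = A p + A q"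
  by (induction arbitrary: p q rule: hecke.induct)
     (auto simp: opT0_add opT1_add opZ_add smult_add_right)

lemma hecke_homogeneous: "A \<in> hecke s \<Longrightarrow> A (smult k p) = smult k (A p)"
  by (induction arbitrary: p rule: hecke.induct)
     (auto simp: opT0_smult opT1_smult opZ_smult smult_add_right mult.commute)

context generic_params
begin

section \<open>Reflections of the spectrum and the two difference operators\<close>

lemma gam_0: "gam t 0 = t0 + t1"
  by (simp add: gam.simps)

lemma in_spec: "- gam t m \<in> spec t"
  by (auto simp: spec_def)

lemma specE:
  assumes "\<gamma> \<in> spec t"
  obtains m where "\<gamma> = - gam t m"
  using assms by (auto simp: spec_def)

lemma reflect0: "\<exists>k. 1 + gam t m = - gam t k"
proof (cases "even m")
  case True
  then show ?thesis using gam_Suc_even[of m] by (intro exI[of _ "Suc m"]) simp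
next
  case False
  then obtain k where "m = Suc k" "even k" by (cases m) auto
  then show ?thesis using gam_Suc_even[of k] by (intro exI[of _ k]) simp
qed

lemma reflect1: "m \<noteq> 0 \<Longrightarrow> \<exists>k. gam t m = - gam t k"
proof (cases "odd m")
  case True
  then show ?thesis using gam_Suc_odd[of m] by (intro exI[of _ "Suc m"]) simp
next
  case False
  moreover assume "m \<noteq> 0"
  ultimately obtain k where "m = Suc k" "odd k" by (cases m) auto
  then show ?thesis using gam_Suc_odd[of k] by (intro exI[of _ k]) simp
qed

text \<open>By genericity \<open>gam t 0\<close> lies in the spectrum only when it is 0, and then it
  equals \<open>- gam t 0\<close>.\<close>

lemma ext_spec:
  assumes "\<gamma> \<in> spec t"
  shows "ext t f \<gamma> = f \<gamma>"
proof -
  obtain m where m: "\<gamma> = - gam t m" using assms by (rule specE)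
  have "gam t 0 = 0" if "\<gamma> = gam t 0"
  proof (cases m rule: gam_parity)
    case (1 n)
    then have "2 * (t0 + t1) + of_nat n = gam t 0 - \<gamma>"
      using m by (simp add: gam_0)
    then have "n = 0" using that t01[of n] by (cases n) auto
    then have "2 * gam t 0 = gam t 0 - \<gamma>" using 1 m by (simp add: gam_0)
    then show ?thesis using that by simp
  next
    case (2 n)
    then have "of_nat (n + 1) = \<gamma> - gam t 0" using m by (simp add: gam_0)
    then have "of_nat (n + 1) = (0 :: complex)" using that by simp
    then show ?thesis by (metis Suc_eq_plus1 of_nat_neq_0)
  qed
  then show ?thesis by (auto simp: ext_def)
qed

lemma spT0_spec:
  assumes "\<gamma> \<in> spec t"
  shows "1 - \<gamma> \<in> spec t"
    and "spT0 t f \<gamma> = u1 * f \<gamma> + (u1 + u0 + 1/2 - \<gamma>) * (u1 - u0 + 1/2 - \<gamma>) / (1 - 2 * \<gamma>)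
          * (f (1 - \<gamma>) - f \<gamma>)"
proof -
  obtain m where "\<gamma> = - gam t m" using assms by (rule specE)
  then show r: "1 - \<gamma> \<in> spec t" using reflect0[of m] in_spec by auto
  show "spT0 t f \<gamma> = u1 * f \<gamma> + (u1 + u0 + 1/2 - \<gamma>) * (u1 - u0 + 1/2 - \<gamma>) / (1 - 2 * \<gamma>)
          * (f (1 - \<gamma>) - f \<gamma>)"
    using assms ext_spec[OF r] by simp
qed

lemma spT1_spec:
  assumes "\<gamma> \<in> spec t" "\<gamma> \<noteq> - gam t 0"
  shows "- \<gamma> \<in> spec t"
    and "spT1 t f \<gamma> = t1 * f \<gamma> + (t1 + t0 + \<gamma>) * (t1 - t0 + \<gamma>) / (2 * \<gamma>) * (f (- \<gamma>) - f \<gamma>)"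
proof -
  obtain m where "\<gamma> = - gam t m" using assms(1) by (rule specE)
  moreover from this assms(2) have "m \<noteq> 0" by metis
  ultimately show r: "- \<gamma> \<in> spec t" using reflect1[of m] in_spec by auto
  show "spT1 t f \<gamma> = t1 * f \<gamma> + (t1 + t0 + \<gamma>) * (t1 - t0 + \<gamma>) / (2 * \<gamma>) * (f (- \<gamma>) - f \<gamma>)"
    using assms ext_spec[OF r] by simp
qed

text \<open>The factor t1 + t0 + \<gamma> vanishes at \<open>- gam t 0\<close>, the one point whose
  negative can leave the spectrum.\<close>

lemma spT1_base: "spT1 t f (- gam t 0) = t1 * f (- gam t 0)"
  using in_spec[of 0] by (simp add: gam_0)

lemma spT0_finsupp: "f \<in> finsupp t \<Longrightarrow> spT0 t f \<in> finsupp t"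
proof -
  assume f: "f \<in> finsupp t"
  have s: "{\<gamma>. spT0 t f \<gamma> \<noteq> 0} \<subseteq> {\<gamma>. f \<gamma> \<noteq> 0} \<union> (\<lambda>\<gamma>. 1 - \<gamma>) ` {\<gamma>. f \<gamma> \<noteq> 0}"
  proof
    fix \<gamma> assume "\<gamma> \<in> {\<gamma>. spT0 t f \<gamma> \<noteq> 0}"
    then have nz: "spT0 t f \<gamma> \<noteq> 0" by simp
    then have "\<gamma> \<in> spec t" by (auto split: if_splits)
    then have "f \<gamma> \<noteq> 0 \<or> f (1 - \<gamma>) \<noteq> 0" using nz spT0_spec(2) by fastforce
    moreover have "\<gamma> = 1 - (1 - \<gamma>)" by simp
    ultimately show "\<gamma> \<in> {\<gamma>. f \<gamma> \<noteq> 0} \<union> (\<lambda>\<gamma>. 1 - \<gamma>) ` {\<gamma>. f \<gamma> \<noteq> 0}" by blast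
  qed
  have "finite {\<gamma>. spT0 t f \<gamma> \<noteq> 0}"
    using f by (intro finite_subset[OF s]) (auto simp: finsupp_def)
  then show ?thesis by (auto simp: finsupp_def split: if_splits)
qed

lemma spT1_finsupp: "f \<in> finsupp t \<Longrightarrow> spT1 t f \<in> finsupp t"
proof -
  assume f: "f \<in> finsupp t"
  have s: "{\<gamma>. spT1 t f \<gamma> \<noteq> 0} \<subseteq> {\<gamma>. f \<gamma> \<noteq> 0} \<union> uminus ` {\<gamma>. f \<gamma> \<noteq> 0}"
  proof
    fix \<gamma> assume "\<gamma> \<in> {\<gamma>. spT1 t f \<gamma> \<noteq> 0}"
    then have nz: "spT1 t f \<gamma> \<noteq> 0" by simp
    then have \<gamma>: "\<gamma> \<in> spec t" by (auto split: if_splits)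
    have "f \<gamma> \<noteq> 0 \<or> f (- \<gamma>) \<noteq> 0"
    proof (cases "\<gamma> = - gam t 0")
      case True
      then show ?thesis using nz spT1_base by fastforce
    next
      case False
      then show ?thesis using nz spT1_spec(2)[OF \<gamma> False] by fastforce
    qed
    moreover have "\<gamma> = - (- \<gamma>)" by simp
    ultimately show "\<gamma> \<in> {\<gamma>. f \<gamma> \<noteq> 0} \<union> uminus ` {\<gamma>. f \<gamma> \<noteq> 0}" by blast
  qed
  have "finite {\<gamma>. spT1 t f \<gamma> \<noteq> 0}"
    using f by (intro finite_subset[OF s]) (auto simp: finsupp_def)
  then show ?thesis by (auto simp: finsupp_def split: if_splits)
qed

lemma finsupp_add: "f \<in> finsupp t \<Longrightarrow> g \<in> finsupp t \<Longrightarrow> (\<lambda>\<gamma>. f \<gamma> + g \<gamma>) \<in> finsupp t"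
proof -
  assume a: "f \<in> finsupp t" "g \<in> finsupp t"
  have s: "{\<gamma>. f \<gamma> + g \<gamma> \<noteq> 0} \<subseteq> {\<gamma>. f \<gamma> \<noteq> 0} \<union> {\<gamma>. g \<gamma> \<noteq> 0}" by auto
  then have "finite {\<gamma>. f \<gamma> + g \<gamma> \<noteq> 0}"
    using a by (intro finite_subset[OF s]) (auto simp: finsupp_def)
  then show ?thesis using a s by (auto simp: finsupp_def)
qed

lemma finsupp_scale: "f \<in> finsupp t \<Longrightarrow> (\<lambda>\<gamma>. h \<gamma> * f \<gamma>) \<in> finsupp t"
proof -
  assume a: "f \<in> finsupp t"
  have s: "{\<gamma>. h \<gamma> * f \<gamma> \<noteq> 0} \<subseteq> {\<gamma>. f \<gamma> \<noteq> 0}" by auto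
  then have "finite {\<gamma>. h \<gamma> * f \<gamma> \<noteq> 0}"
    using a by (intro finite_subset[OF s]) (auto simp: finsupp_def)
  then show ?thesis using a s by (auto simp: finsupp_def)
qed

section \<open>Transfer of operators from polynomials to functions on the spectrum\<close>

definition agree :: "nat \<Rightarrow> complex poly \<Rightarrow> (complex \<Rightarrow> complex) \<Rightarrow> bool" where
  "agree K p f \<longleftrightarrow> (\<forall>j\<le>K. poly p (- gam t j) = f (- gam t j))"

text \<open>The operators in the Hecke algebra are local on the spectrum, and every function on the
  spectrum agrees with a polynomial on any finite part of it.  So the action on polynomials
  determines an action on functions, and no presentation of the algebra is needed.\<close>

definition acts :: "(complex poly \<Rightarrow> complex poly) \<Rightarrow> (complex \<Rightarrow> complex) \<Rightarrow> (complex \<Rightarrow> complex) \<Rightarrow> bool" where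
  "acts A f g \<longleftrightarrow> (\<forall>m. \<exists>K. \<forall>p. agree K p f \<longrightarrow> poly (A p) (- gam t m) = g (- gam t m))"

lemma agree_mono: "agree K p f \<Longrightarrow> k \<le> K \<Longrightarrow> agree k p f"
  by (simp add: agree_def)

lemma agree_exists: "\<exists>p. agree K p f"
  unfolding agree_def
  by (rule interpolation_poly_exists) (use inj_gam in \<open>auto simp: inj_def\<close>)

text \<open>Interpolation supplies one polynomial that agrees with f up to both bounds; its image
  under A has the value of g and that of h.\<close>

lemma acts_unique:
  assumes "acts A f g" "acts A f h" "g \<in> finsupp t" "h \<in> finsupp t"
  shows "g = h"
proof
  fix \<gamma>
  show "g \<gamma> = h \<gamma>"
  proof (cases "\<gamma> \<in> spec t")
    case True
    then obtain m where m: "\<gamma> = - gam t m" by (rule specE)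
    obtain K L where K: "\<And>p. agree K p f \<Longrightarrow> poly (A p) (- gam t m) = g (- gam t m)"
      and L: "\<And>p. agree L p f \<Longrightarrow> poly (A p) (- gam t m) = h (- gam t m)"
      using assms(1,2) unfolding acts_def by metis
    obtain p where "agree (max K L) p f" using agree_exists by blast
    then show ?thesis using K L m agree_mono by (metis max.cobounded1 max.cobounded2)
  next
    case False
    then have "g \<gamma> = 0" "h \<gamma> = 0" using assms(3,4) unfolding finsupp_def by blast+
    then show ?thesis by simp
  qed
qed

lemma acts_id: "acts id f f"
  unfolding acts_def agree_def by auto

lemma acts_opT0: "acts (opT0 (dual t)) f (spT0 t f)"
  unfolding acts_def
proof
  fix m
  obtain k where k: "1 + gam t m = - gam t k" using reflect0 by blast
  have h: "- gam t m \<noteq> 1/2" using gam_half[of m] by (auto simp: field_simps neg_eq_iff_add_eq_0)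
  have "poly (opT0 (dual t) p) (- gam t m) = spT0 t f (- gam t m)" if "agree (max m k) p f" for p
    using that unfolding spT0_spec(2)[OF in_spec] dual.simps poly_opT0[OF h]
    by (simp add: agree_def k)
  then show "\<exists>K. \<forall>p. agree K p f \<longrightarrow> poly (opT0 (dual t) p) (- gam t m) = spT0 t f (- gam t m)"
    by blast
qed

lemma acts_opT1: "acts (opT1 (dual t)) f (spT1 t f)"
  unfolding acts_def
proof
  fix m
  show "\<exists>K. \<forall>p. agree K p f \<longrightarrow> poly (opT1 (dual t) p) (- gam t m) = spT1 t f (- gam t m)"
  proof (cases "m = 0")
    case True
    have "poly (opT1 (dual t) p) (- gam t 0) = t1 * poly p (- gam t 0)" for p
    proof -
      obtain q where q: "opT1 (u1, u0, t1, t0) p = smult t1 p + [:t1 + t0, 1:] * [:t1 - t0, 1:] * q"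
        by (rule opT1_quotient)
      have "poly [:t1 + t0, 1:] (- gam t 0) = 0" by (simp add: gam_0)
      then show ?thesis
        unfolding dual.simps q by (simp only: poly_add poly_smult poly_mult) simp
    qed
    then show ?thesis unfolding True spT1_base agree_def by auto
  next
    case False
    then obtain k where k: "gam t m = - gam t k" using reflect1 by blast
    have nz: "- gam t m \<noteq> 0" using gam_nz False by simp
    have ne: "- gam t m \<noteq> - gam t 0" using False injD[OF inj_gam] by auto
    have "poly (opT1 (dual t) p) (- gam t m) = spT1 t f (- gam t m)" if "agree (max m k) p f" for p
    proof -
      have k': "- (- gam t m) = - gam t k" using k by simp
      have "poly p (- gam t m) = f (- gam t m)" "poly p (- gam t k) = f (- gam t k)"
        using that by (simp_all add: agree_def)
      then show ?thesis
        unfolding spT1_spec(2)[OF in_spec ne] dual.simps poly_opT1[OF nz] k' by simp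
    qed
    then show ?thesis by blast
  qed
qed

lemma acts_mult: "acts ((*) p) f (\<lambda>\<gamma>. poly p \<gamma> * f \<gamma>)"
  unfolding acts_def agree_def by auto

lemma acts_add:
  assumes "acts A f g" "acts B f h"
  shows "acts (\<lambda>q. A q + B q) f (\<lambda>\<gamma>. g \<gamma> + h \<gamma>)"
  unfolding acts_def
proof
  fix m
  obtain K L where K: "\<And>p. agree K p f \<Longrightarrow> poly (A p) (- gam t m) = g (- gam t m)"
    and L: "\<And>p. agree L p f \<Longrightarrow> poly (B p) (- gam t m) = h (- gam t m)"
    using assms unfolding acts_def by metis
  show "\<exists>K. \<forall>p. agree K p f \<longrightarrow> poly (A p + B p) (- gam t m) = g (- gam t m) + h (- gam t m)"
    by (intro exI[of _ "max K L"]) (auto simp: K[OF agree_mono] L[OF agree_mono])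
qed

lemma acts_scale: "acts A f g \<Longrightarrow> acts (\<lambda>q. smult k (A q)) f (\<lambda>\<gamma>. k * g \<gamma>)"
  unfolding acts_def by (metis poly_smult)

lemma acts_comp:
  assumes B: "acts B f g" and A: "acts A g h"
  shows "acts (A \<circ> B) f h"
  unfolding acts_def
proof
  fix m
  obtain K where K: "\<And>p. agree K p g \<Longrightarrow> poly (A p) (- gam t m) = h (- gam t m)"
    using A unfolding acts_def by metis
  obtain L where L: "\<And>j p. agree (L j) p f \<Longrightarrow> poly (B p) (- gam t j) = g (- gam t j)"
    using B unfolding acts_def by metis
  \<comment> \<open>Only the points with j \<le> K matter to A, each with its own bound for B; the
    largest of these bounds serves all.\<close>
  have "agree K (B p) g" if "agree (Max (L ` {..K})) p f" for p
    unfolding agree_def by (intro allI impI L agree_mono[OF that]) simp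
  then have "poly ((A \<circ> B) p) (- gam t m) = h (- gam t m)" if "agree (Max (L ` {..K})) p f" for p
    using K that by simp
  then show "\<exists>K. \<forall>p. agree K p f \<longrightarrow> poly ((A \<circ> B) p) (- gam t m) = h (- gam t m)" by blast
qed

lemma acts_exists:
  assumes "A \<in> hecke (dual t)" "f \<in> finsupp t"
  shows "\<exists>g\<in>finsupp t. acts A f g"
  using assms
proof (induction arbitrary: f rule: hecke.induct)
  case id
  then show ?case using acts_id by (intro bexI[of _ f])
next
  case T0
  then show ?case using acts_opT0 spT0_finsupp by (intro bexI[of _ "spT0 t f"])
next
  case T1
  then show ?case using acts_opT1 spT1_finsupp by (intro bexI[of _ "spT1 t f"])
next
  case Z
  have "opZ = (*) [:0, 1:]" by (simp add: fun_eq_iff opZ_def)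
  then show ?case using acts_mult[of "[:0, 1:]"] finsupp_scale[OF Z]
    by (intro bexI[of _ "\<lambda>\<gamma>. poly [:0, 1:] \<gamma> * f \<gamma>"]) simp_all
next
  case (add A B)
  then obtain g h where "g \<in> finsupp t" "acts A f g" "h \<in> finsupp t" "acts B f h" by blast
  then show ?case by (intro bexI[of _ "\<lambda>\<gamma>. g \<gamma> + h \<gamma>"] acts_add finsupp_add)
next
  case (scale A k)
  then obtain g where "g \<in> finsupp t" "acts A f g" by blast
  then show ?case by (intro bexI[of _ "\<lambda>\<gamma>. k * g \<gamma>"] acts_scale finsupp_scale)
next
  case (comp A B)
  then obtain g where g: "g \<in> finsupp t" "acts B f g" by blast
  with comp obtain h where "h \<in> finsupp t" "acts A g h" by blast
  then show ?case using g by (intro bexI[of _ h] acts_comp)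
qed

lemma acts_additive:
  assumes A: "A \<in> hecke s" and f: "acts A f f'" and g: "acts A g g'"
  shows "acts A (\<lambda>\<gamma>. f \<gamma> + g \<gamma>) (\<lambda>\<gamma>. f' \<gamma> + g' \<gamma>)"
  unfolding acts_def
proof
  fix m
  obtain K L where K: "\<And>p. agree K p f \<Longrightarrow> poly (A p) (- gam t m) = f' (- gam t m)"
    and L: "\<And>p. agree L p g \<Longrightarrow> poly (A p) (- gam t m) = g' (- gam t m)"
    using f g unfolding acts_def by metis
  have "poly (A p) (- gam t m) = f' (- gam t m) + g' (- gam t m)"
    if p: "agree (max K L) p (\<lambda>\<gamma>. f \<gamma> + g \<gamma>)" for p
  proof -
    \<comment> \<open>Split p into an interpolant q of g and a remainder, which agrees with
      f.\<close>
    obtain q where q: "agree (max K L) q g" using agree_exists by blast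
    then have pq: "agree (max K L) (p - q) f" using p by (auto simp: agree_def)
    then have "poly (A (p - q)) (- gam t m) = f' (- gam t m)" by (intro K agree_mono[OF pq]) simp
    moreover have "poly (A q) (- gam t m) = g' (- gam t m)" by (intro L agree_mono[OF q]) simp
    moreover have "A p = A (p - q) + A q" using hecke_additive[OF A, of "p - q" q] by simp
    ultimately show ?thesis by simp
  qed
  then show "\<exists>K. \<forall>p. agree K p (\<lambda>\<gamma>. f \<gamma> + g \<gamma>) \<longrightarrow>
      poly (A p) (- gam t m) = f' (- gam t m) + g' (- gam t m)" by blast
qed

lemma acts_homogeneous:
  assumes A: "A \<in> hecke s" and f: "acts A f f'"
  shows "acts A (\<lambda>\<gamma>. k * f \<gamma>) (\<lambda>\<gamma>. k * f' \<gamma>)"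
  unfolding acts_def
proof
  fix m
  obtain K where K: "\<And>p. agree K p f \<Longrightarrow> poly (A p) (- gam t m) = f' (- gam t m)"
    using f unfolding acts_def by metis
  have "poly (A p) (- gam t m) = k * f' (- gam t m)" if p: "agree K p (\<lambda>\<gamma>. k * f \<gamma>)" for p
  proof (cases "k = 0")
    case True
    \<comment> \<open>Division by k is impossible here. Since p vanishes at the relevant points, p +
      q interpolates f just as q does, so A p must vanish at the given point.\<close>
    obtain q where q: "agree K q f" using agree_exists by blast
    then have "agree K (p + q) f" using p True by (auto simp: agree_def)
    then have "poly (A p + A q) (- gam t m) = poly (A q) (- gam t m)"
      using K q by (simp flip: hecke_additive[OF A])
    then show ?thesis by (simp add: True)
  next
    case False
    then have "agree K (smult (1 / k) p) f" using p by (simp add: agree_def)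
    then have "poly (A (smult (1 / k) p)) (- gam t m) = f' (- gam t m)" by (rule K)
    then show ?thesis using False by (simp add: hecke_homogeneous[OF A] field_simps)
  qed
  then show "\<exists>K. \<forall>p. agree K p (\<lambda>\<gamma>. k * f \<gamma>) \<longrightarrow> poly (A p) (- gam t m) = k * f' (- gam t m)"
    by blast
qed

section \<open>The representation and its uniqueness\<close>

definition rep :: "(complex poly \<Rightarrow> complex poly) \<Rightarrow> (complex \<Rightarrow> complex) \<Rightarrow> (complex \<Rightarrow> complex)" where
  "rep A f = (THE g. g \<in> finsupp t \<and> acts A f g)"

lemma rep_eqI: "acts A f g \<Longrightarrow> g \<in> finsupp t \<Longrightarrow> rep A f = g"
  unfolding rep_def by (rule the_equality) (auto intro: acts_unique)

lemma rep_acts: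
  assumes "A \<in> hecke (dual t)" "f \<in> finsupp t"
  shows "rep A f \<in> finsupp t" "acts A f (rep A f)"
proof -
  obtain g where "g \<in> finsupp t" "acts A f g" using acts_exists[OF assms] by blast
  then show "rep A f \<in> finsupp t" "acts A f (rep A f)" using rep_eqI by auto
qed

text \<open>Each law holds because the right-hand side is finitely supported and realises the
  operator in the sense of \<open>acts\<close>, which determines it.\<close>

lemma is_rep_rep: "is_rep t rep"
  unfolding is_rep_def
proof (intro conjI ballI allI)
  fix A assume A: "A \<in> hecke (dual t)"
  show "rep A \<in> finsupp_end t"
    unfolding finsupp_end_def using A
    by (auto intro!: rep_eqI acts_additive acts_homogeneous rep_acts finsupp_add finsupp_scale)
  fix f assume f: "f \<in> finsupp t"
  show "rep (\<lambda>q. smult k (A q)) f = (\<lambda>\<gamma>. k * rep A f \<gamma>)" for k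
    using A f by (intro rep_eqI acts_scale finsupp_scale rep_acts)
  fix B assume B: "B \<in> hecke (dual t)"
  show "rep (\<lambda>q. A q + B q) f = (\<lambda>\<gamma>. rep A f \<gamma> + rep B f \<gamma>)"
    using A B f by (intro rep_eqI acts_add finsupp_add rep_acts)
  show "rep (A \<circ> B) f = rep A (rep B f)"
    using A B f by (intro rep_eqI acts_comp[OF rep_acts(2)[OF B f]] rep_acts)
qed (intro rep_eqI acts_id)

lemma extends_rep: "extends_assignments t rep"
  unfolding extends_assignments_def
  by (auto simp del: spT0.simps spT1.simps intro!: rep_eqI acts_opT0 acts_opT1 acts_mult
      spT0_finsupp spT1_finsupp finsupp_scale)

lemma rep_unique:
  assumes \<rho>: "is_rep t \<rho>" "extends_assignments t \<rho>" and "A \<in> hecke (dual t)" "f \<in> finsupp t"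
  shows "\<rho> A f = rep A f"
  using assms(3,4)
proof (induction arbitrary: f rule: hecke.induct)
  case id
  then show ?case using \<rho>(1) is_rep_rep unfolding is_rep_def by metis
next
  case T0
  then show ?case using \<rho> extends_rep by (simp add: extends_assignments_def)
next
  case T1
  then show ?case using \<rho> extends_rep by (simp add: extends_assignments_def)
next
  case Z
  have "opZ = (*) [:0, 1:]" by (simp add: fun_eq_iff opZ_def)
  then show ?case using \<rho>(2) extends_rep Z unfolding extends_assignments_def by metis
next
  case (add A B)
  then show ?case using \<rho> is_rep_rep by (simp add: is_rep_def)
next
  case (scale A k)
  then show ?case using \<rho> is_rep_rep by (simp add: is_rep_def)
next
  case (comp A B)
  have "\<rho> (A \<circ> B) f = \<rho> A (\<rho> B f)" "rep (A \<circ> B) f = rep A (rep B f)"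
    using comp(1,2,5) \<rho>(1) is_rep_rep unfolding is_rep_def by blast+
  then show ?case using comp rep_acts(1) by metis
qed

end

section \<open>Decay of the weight function\<close>

text \<open>The ratio |Gamma(s + iy)| / Gamma(s) is nondecreasing in s: in Euler's limit the powers
  n^s cancel, and each factor (s + k) / |s + k + iy| is nondecreasing.\<close>

lemma norm_Gamma_le_shift:
  assumes "0 < s" "s \<le> s'"
  shows "norm (Gamma (Complex s y)) * Gamma s' \<le> norm (Gamma (Complex s' y)) * Gamma s"
proof (rule LIMSEQ_le)
  have gs: "norm (Gamma_series (Complex r y) n) = fact n * exp (r * ln (of_nat n)) /
      (\<Prod>k\<in>{0..n}. norm (Complex (r + of_nat k) y))" for r n
  proof -
    have "Complex r y + of_nat k = Complex (r + of_nat k) y" for k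
      by (simp add: complex_eq_iff)
    then show ?thesis
      by (simp add: Gamma_series_def norm_divide norm_mult pochhammer_prod prod_norm
          atLeastLessThanSuc_atLeastAtMost)
  qed
  have gr: "Gamma_series r n = fact n * exp (r * ln (of_nat n)) / (\<Prod>k\<in>{0..n}. r + of_nat k)" for r :: real and n
    by (simp add: Gamma_series_def pochhammer_prod atLeastLessThanSuc_atLeastAtMost)
  have le: "norm (Gamma_series (Complex s y) n) * Gamma_series s' n
      \<le> norm (Gamma_series (Complex s' y) n) * Gamma_series s n" for n
  proof -
    define P where "P r = (\<Prod>k\<in>{0..n}. norm (Complex (r + of_nat k) y))" for r
    define Q where "Q r = (\<Prod>k\<in>{0..n}. r + of_nat k)" for r :: real
    have pos: "P s > 0" "P s' > 0" "Q s > 0" "Q s' > 0"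
      unfolding P_def Q_def using assms by (auto intro!: prod_pos simp: complex_eq_iff)
    have "norm (Complex b y) * a \<le> norm (Complex a y) * b" if "0 < a" "a \<le> b" for a b
    proof (rule power2_le_imp_le)
      have "a\<^sup>2 * y\<^sup>2 \<le> b\<^sup>2 * y\<^sup>2" using that by (intro mult_right_mono power_mono) auto
      then show "(norm (Complex b y) * a)\<^sup>2 \<le> (norm (Complex a y) * b)\<^sup>2"
        by (simp add: power_mult_distrib cmod_power2 algebra_simps)
    qed (use that in auto)
    then have "P s' * Q s \<le> P s * Q s'"
      unfolding P_def Q_def prod.distrib[symmetric] using assms by (intro prod_mono) auto
    then have "1 / (P s * Q s') \<le> 1 / (P s' * Q s)" using pos by (intro divide_left_mono) auto
    then have "(fact n * exp (s * ln (of_nat n)) * (fact n * exp (s' * ln (of_nat n)))) * (1 / (P s * Q s'))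
      \<le> (fact n * exp (s * ln (of_nat n)) * (fact n * exp (s' * ln (of_nat n)))) * (1 / (P s' * Q s))"
      by (intro mult_left_mono) auto
    then show ?thesis unfolding gs gr P_def[symmetric] Q_def[symmetric] by (simp add: mult_ac)
  qed
  show "\<exists>N. \<forall>n\<ge>N. norm (Gamma_series (Complex s y) n) * Gamma_series s' n
      \<le> norm (Gamma_series (Complex s' y) n) * Gamma_series s n"
    using le by blast
qed (intro tendsto_intros)+

text \<open>The values at 1/2 + iy and 1/2 - iy are conjugate, so reflection gives |Gamma|^2 = pi /
  cosh(pi y) exactly; then cosh u \<ge> exp |u| / 2.\<close>

lemma norm_Gamma_half: "norm (Gamma (Complex (1/2) y)) \<le> sqrt (2 * pi) * exp (- pi * \<bar>y\<bar> / 2)"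
proof -
  have z: "1 - Complex (1/2) y = cnj (Complex (1/2) y)" by (simp add: complex_eq_iff)
  have "norm (Gamma (Complex (1/2) y)) ^ 2 = norm (Gamma (Complex (1/2) y) * Gamma (1 - Complex (1/2) y))"
    unfolding z by (simp add: norm_mult power2_eq_square del: complex_cnj flip: cnj_Gamma)
  also have "\<dots> = pi / norm (sin (of_real pi * Complex (1/2) y))"
    unfolding Gamma_reflection_complex by (simp add: norm_divide)
  also have "norm (sin (of_real pi * Complex (1/2) y)) = cosh (pi * y)"
  proof -
    have "of_real pi * Complex (1/2) y = of_real pi / 2 + \<i> * of_real (pi * y)"
      by (simp add: complex_eq_iff)
    then have "sin (of_real pi * Complex (1/2) y) = cos (\<i> * of_real (pi * y))"
      by (simp add: sin_add)
    also have "\<dots> = of_real (cosh (pi * y))"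
      by (simp add: cos_i_times cosh_def exp_of_real exp_minus del: of_real_mult)
    finally show ?thesis by simp
  qed
  also have "pi / cosh (pi * y) \<le> pi / (exp (pi * \<bar>y\<bar>) / 2)"
    by (intro divide_left_mono) (auto simp: cosh_def abs_if mult_pos_pos add_pos_pos)
  also have "\<dots> = (sqrt (2 * pi) * exp (- pi * \<bar>y\<bar> / 2))\<^sup>2"
    by (simp add: power_mult_distrib exp_minus field_simps flip: exp_double)
  finally show ?thesis by (rule power2_le_imp_le) simp
qed

text \<open>From (1 + u/n)^n \<le> exp u with u = \<epsilon> (c + x): polynomial growth costs an
  arbitrarily small exponential rate.\<close>

lemma power_le_exp:
  fixes c \<epsilon> :: real
  assumes "c \<ge> 0" "\<epsilon> > 0"
  shows "\<exists>K\<ge>0. \<forall>x\<ge>0. (c + x) ^ n \<le> K * exp (\<epsilon> * x)"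
proof (cases "n = 0")
  case True
  then show ?thesis using assms by (intro exI[of _ 1]) simp
next
  case False
  define K where "K = (n / \<epsilon>) ^ n * exp (\<epsilon> * c)"
  have "(c + x) ^ n \<le> K * exp (\<epsilon> * x)" if "x \<ge> 0" for x
  proof -
    have "(\<epsilon> * (c + x) / n) ^ n \<le> (1 + \<epsilon> * (c + x) / n) ^ n"
      using assms that by (intro power_mono) auto
    also have "\<dots> \<le> exp (\<epsilon> * (c + x))"
      using False assms that by (intro exp_ge_one_plus_x_over_n_power_n) (auto intro: order_trans[of _ 0])
    finally have "(n / \<epsilon>) ^ n * (\<epsilon> * (c + x) / n) ^ n \<le> (n / \<epsilon>) ^ n * exp (\<epsilon> * (c + x))"
      using assms by (intro mult_left_mono) auto
    moreover have "(n / \<epsilon>) ^ n * (\<epsilon> * (c + x) / n) ^ n = (c + x) ^ n"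
      using False assms by (simp flip: power_mult_distrib)
    ultimately show ?thesis
      by (simp add: K_def exp_add algebra_simps)
  qed
  moreover have "K \<ge> 0" using assms by (simp add: K_def)
  ultimately show ?thesis by blast
qed

text \<open>Shift the real part to a half-integer, where the reflection formula gives the exact size.\<close>

lemma norm_Gamma_strip:
  "\<exists>K\<ge>0. \<forall>z. \<bar>Re z\<bar> \<le> A \<and> \<bar>Im z\<bar> \<ge> 1 \<longrightarrow> norm (Gamma z) \<le> K * exp (- (5/4) * \<bar>Im z\<bar>)"
proof -
  \<comment> \<open>Adding N takes the real parts into the interval from 1 to 2N - 1, and s = 2N +
    1/2 lies beyond it.\<close>
  obtain N :: nat where N: "A + 1 \<le> real N" using real_arch_simple by blast
  define M where "M = 2 * N"
  define s where "s = real M + 1/2"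
  have "continuous_on {1..s} (Gamma :: real \<Rightarrow> real)"
    by (intro continuous_on_Gamma) (auto elim!: nonpos_Ints_cases)
  then have "bounded (Gamma ` {1..s})"
    by (intro compact_imp_bounded compact_continuous_image) auto
  then obtain B where B: "\<And>x. 1 \<le> x \<Longrightarrow> x \<le> s \<Longrightarrow> Gamma x \<le> B" "B > 0"
    unfolding bounded_pos by (force simp: abs_le_iff)
  \<comment> \<open>Origin of the rate 5/4: on the line Re = 1/2 the rate is pi/2 > 3/2, and the
    polynomial factor may use up 1/4.\<close>
  obtain L where L: "L \<ge> 0" "\<And>x. x \<ge> 0 \<Longrightarrow> (1/2 + real M + x) ^ M \<le> L * exp (1/4 * x)"
    using power_le_exp[of "1/2 + real M" "1/4" M] by auto
  have Gs: "Gamma s > 0" unfolding s_def by (intro Gamma_real_pos) simp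
  define K where "K = L * sqrt (2 * pi) * B / Gamma s"
  have "norm (Gamma z) \<le> K * exp (- (5/4) * \<bar>Im z\<bar>)" if z: "\<bar>Re z\<bar> \<le> A" "\<bar>Im z\<bar> \<ge> 1" for z
  proof -
    define y where "y = Im z"
    define x where "x = Re z + real N"
    have x: "1 \<le> x" "x \<le> s" using z N by (auto simp: x_def s_def M_def)
    have zN: "z + of_nat N = Complex x y" by (simp add: complex_eq_iff x_def y_def)
    \<comment> \<open>As |Im z| \<ge> 1, every factor has modulus at least 1, so moving z to the
      right by N does not decrease |Gamma|.\<close>
    have poch: "norm (pochhammer z N) \<ge> 1"
      unfolding pochhammer_prod prod_norm[symmetric]
    proof (intro prod_ge_1)
      fix k :: nat
      show "1 \<le> norm (z + of_nat k)" using z(2) abs_Im_le_cmod[of "z + of_nat k"] by simp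
    qed
    have "Gamma z = Gamma (z + of_nat N) / pochhammer z N"
      using pochhammer_rGamma[of z N] by (simp add: Gamma_def field_simps)
    then have "norm (Gamma z) \<le> norm (Gamma (Complex x y))"
      unfolding zN using poch by (simp add: norm_divide divide_le_eq mult_le_cancel_left1)
    also have "\<dots> \<le> norm (Gamma (Complex s y)) * Gamma x / Gamma s"
      using norm_Gamma_le_shift[of x s y] x Gs by (simp add: field_simps)
    also have "\<dots> \<le> norm (Gamma (Complex s y)) * B / Gamma s"
      using B x Gs by (intro divide_right_mono mult_left_mono) auto
    also have "norm (Gamma (Complex s y)) \<le> L * sqrt (2 * pi) * exp (- (5/4) * \<bar>y\<bar>)"
    proof -
      let ?h = "Complex (1/2) y"
      have h: "?h + of_nat M = Complex s y" by (simp add: complex_eq_iff s_def)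
      have nz: "pochhammer ?h M \<noteq> 0"
        using z(2) by (auto simp: pochhammer_eq_0_iff y_def dest!: arg_cong[where f = Im])
      have "Gamma (Complex s y) = pochhammer ?h M * Gamma ?h"
        using pochhammer_rGamma[of ?h M] nz unfolding h by (simp add: Gamma_def field_simps)
      then have "norm (Gamma (Complex s y)) = norm (pochhammer ?h M) * norm (Gamma ?h)"
        by (simp add: norm_mult)
      also have "norm (pochhammer ?h M) \<le> (1/2 + real M + \<bar>y\<bar>) ^ M"
      proof -
        have "norm (?h + of_nat k) \<le> 1/2 + real M + \<bar>y\<bar>" if "k < M" for k
          using cmod_le[of "?h + of_nat k"] that by simp
        then have "(\<Prod>k\<in>{0..<M}. norm (?h + of_nat k)) \<le> (\<Prod>k\<in>{0..<M}. 1/2 + real M + \<bar>y\<bar>)"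
          by (intro prod_mono) auto
        then show ?thesis by (simp add: pochhammer_prod prod_norm)
      qed
      also have "\<dots> \<le> L * exp (1/4 * \<bar>y\<bar>)" by (intro L) simp
      also have "norm (Gamma ?h) \<le> sqrt (2 * pi) * exp (- pi * \<bar>y\<bar> / 2)"
        by (rule norm_Gamma_half)
      also have "\<dots> \<le> sqrt (2 * pi) * exp (- (6/4) * \<bar>y\<bar>)"
        using mult_right_mono[of 3 pi "\<bar>y\<bar>"] pi_gt3 by (intro mult_left_mono) auto
      finally have "norm (Gamma (Complex s y))
          \<le> L * exp (1/4 * \<bar>y\<bar>) * (sqrt (2 * pi) * exp (- (6/4) * \<bar>y\<bar>))"
        using L(1) by (auto simp: mult_right_mono mult_left_mono)
      also have "\<dots> = L * sqrt (2 * pi) * (exp (1/4 * \<bar>y\<bar>) * exp (- (6/4) * \<bar>y\<bar>))"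
        by simp
      also have "exp (1/4 * \<bar>y\<bar>) * exp (- (6/4) * \<bar>y\<bar>) = exp (- (5/4) * \<bar>y\<bar>)"
        by (simp flip: exp_add)
      finally show ?thesis .
    qed
    finally show ?thesis
      using B Gs by (simp add: K_def y_def divide_right_mono mult_right_mono mult_ac)
  qed
  moreover have "K \<ge> 0" using L B Gs by (simp add: K_def)
  ultimately show ?thesis by blast
qed

lemma norm_Gamma_pair:
  fixes e j :: complex
  assumes "j = 0 \<or> j = 1"
  shows "\<exists>K\<ge>0. \<forall>x. 0 \<le> Re x \<and> Re x \<le> 1 \<and> \<bar>Im x\<bar> \<ge> 1 + \<bar>Im e\<bar> \<longrightarrow>
    norm (Gamma (e + x) * Gamma (e + j - x)) \<le> K * exp (- (5/2) * \<bar>Im x\<bar>)"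
proof -
  obtain K where K: "K \<ge> 0" "\<And>z. \<bar>Re z\<bar> \<le> \<bar>Re e\<bar> + 2 \<Longrightarrow> \<bar>Im z\<bar> \<ge> 1 \<Longrightarrow>
      norm (Gamma z) \<le> K * exp (- (5/4) * \<bar>Im z\<bar>)"
    using norm_Gamma_strip[of "\<bar>Re e\<bar> + 2"] by blast
  have "norm (Gamma (e + x) * Gamma (e + j - x)) \<le> K\<^sup>2 * exp (- (5/2) * \<bar>Im x\<bar>)"
    if x: "0 \<le> Re x" "Re x \<le> 1" "\<bar>Im x\<bar> \<ge> 1 + \<bar>Im e\<bar>" for x
  proof -
    have "norm (Gamma (e + x) * Gamma (e + j - x))
      \<le> (K * exp (- (5/4) * \<bar>Im (e + x)\<bar>)) * (K * exp (- (5/4) * \<bar>Im (e + j - x)\<bar>))"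
      unfolding norm_mult using x assms K(1) by (intro mult_mono K(2)) auto
    also have "\<dots> = K\<^sup>2 * exp (- (5/4) * (\<bar>Im (e + x)\<bar> + \<bar>Im (e + j - x)\<bar>))"
      by (simp add: power2_eq_square algebra_simps flip: exp_add)
    also have "\<dots> \<le> K\<^sup>2 * exp (- (5/2) * \<bar>Im x\<bar>)"
    proof -
      \<comment> \<open>The two arguments differ by 2x - j, so Im e drops out.\<close>
      have "Im j = 0" using assms by auto
      then have "2 * \<bar>Im x\<bar> \<le> \<bar>Im (e + x)\<bar> + \<bar>Im (e + j - x)\<bar>"
        unfolding plus_complex.sel minus_complex.sel by linarith
      then have "- (5/4) * (\<bar>Im (e + x)\<bar> + \<bar>Im (e + j - x)\<bar>) \<le> - (5/2) * \<bar>Im x\<bar>" by (simp del: plus_complex.sel minus_complex.sel)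
      then show ?thesis by (intro mult_left_mono) (simp_all only: exp_le_cancel_iff zero_le_power2)
    qed
    finally show ?thesis .
  qed
  then show ?thesis using K(1) by (intro exI[of _ "K\<^sup>2"]) auto
qed

lemma norm_poly_le_power:
  fixes p :: "complex poly"
  shows "\<exists>K\<ge>0. \<exists>n. \<forall>z. norm (poly p z) \<le> K * (1 + norm z) ^ n"
proof (induction p)
  case 0
  then show ?case by (intro exI[of _ 0]) simp
next
  case (pCons a p)
  then obtain K n where K: "K \<ge> 0" "\<And>z. norm (poly p z) \<le> K * (1 + norm z) ^ n" by blast
  have "norm (poly (pCons a p) z) \<le> (norm a + K) * (1 + norm z) ^ Suc n" for z
  proof -
    have "norm (poly (pCons a p) z) \<le> norm a + norm z * norm (poly p z)"
      using norm_triangle_ineq[of a "z * poly p z"] by (simp add: norm_mult)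
    also have "norm z * norm (poly p z) \<le> (1 + norm z) * (K * (1 + norm z) ^ n)"
      using K by (intro mult_mono) auto
    also have "norm a \<le> norm a * (1 + norm z) ^ Suc n"
      using one_le_power[of "1 + norm z" "Suc n"] by (simp add: mult_le_cancel_left1)
    finally show ?thesis by (simp add: algebra_simps)
  qed
  then show ?case using K(1) 
    by (intro exI[of _ "norm a + K"] conjI exI[of _ "Suc n"]) auto
qed

text \<open>\<open>rGamma\<close> is entire, so the denominator becomes a holomorphic factor. The
  pairs have the shape of \<open>norm_Gamma_pair\<close>, with j = 1 for a, b and j = 0 for c,
  d.\<close>

lemma Delta_altdef:
  "Delta t x = (Gamma (par_a t + x) * Gamma (par_a t + 1 - x)) * (Gamma (par_b t + x) * Gamma (par_b t + 1 - x)) *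
     (Gamma (par_c t + x) * Gamma (par_c t + 0 - x)) * (Gamma (par_d t + x) * Gamma (par_d t + 0 - x)) *
     (rGamma (2 * x) * rGamma (1 - 2 * x))"
  by (simp add: Delta_def rGamma_inverse_Gamma divide_inverse mult_ac)

text \<open>The rates add up to -1: four Gamma pairs give -10, the factor sin(2 pi x) / pi costs 2
  pi < 8, and the polynomial costs 1. The strip contains the axis, its image under x \<mapsto> 1 - x
  and the segments between them.\<close>

lemma Delta_decay:
  "\<exists>K\<ge>0. \<exists>R. \<forall>x. 0 \<le> Re x \<and> Re x \<le> 1 \<and> \<bar>Im x\<bar> \<ge> R \<longrightarrow>
     norm (Delta t x * poly p x) \<le> K * exp (- \<bar>Im x\<bar>)"
proof -
  define R where "R = 1 + (\<bar>Im (par_a t)\<bar> + \<bar>Im (par_b t)\<bar> + \<bar>Im (par_c t)\<bar> + \<bar>Im (par_d t)\<bar>)"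
  have pair: "\<exists>K\<ge>0. \<forall>x. 0 \<le> Re x \<and> Re x \<le> 1 \<and> \<bar>Im x\<bar> \<ge> R \<longrightarrow>
      norm (Gamma (e + x) * Gamma (e + j - x)) \<le> K * exp (- (5/2) * \<bar>Im x\<bar>)"
    if "j = 0 \<or> j = 1" "1 + \<bar>Im e\<bar> \<le> R" for e j :: complex
    using norm_Gamma_pair[OF that(1), of e] that(2) by (meson order_trans)
  obtain Ka where Ka: "Ka \<ge> 0" "\<And>x. 0 \<le> Re x \<Longrightarrow> Re x \<le> 1 \<Longrightarrow> \<bar>Im x\<bar> \<ge> R \<Longrightarrow>
      norm (Gamma (par_a t + x) * Gamma (par_a t + 1 - x)) \<le> Ka * exp (- (5/2) * \<bar>Im x\<bar>)"
    using pair[of 1 "par_a t"] unfolding R_def by fastforce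
  obtain Kb where Kb: "Kb \<ge> 0" "\<And>x. 0 \<le> Re x \<Longrightarrow> Re x \<le> 1 \<Longrightarrow> \<bar>Im x\<bar> \<ge> R \<Longrightarrow>
      norm (Gamma (par_b t + x) * Gamma (par_b t + 1 - x)) \<le> Kb * exp (- (5/2) * \<bar>Im x\<bar>)"
    using pair[of 1 "par_b t"] unfolding R_def by fastforce
  obtain Kc where Kc: "Kc \<ge> 0" "\<And>x. 0 \<le> Re x \<Longrightarrow> Re x \<le> 1 \<Longrightarrow> \<bar>Im x\<bar> \<ge> R \<Longrightarrow>
      norm (Gamma (par_c t + x) * Gamma (par_c t + 0 - x)) \<le> Kc * exp (- (5/2) * \<bar>Im x\<bar>)"
    using pair[of 0 "par_c t"] unfolding R_def by fastforce
  obtain Kd where Kd: "Kd \<ge> 0" "\<And>x. 0 \<le> Re x \<Longrightarrow> Re x \<le> 1 \<Longrightarrow> \<bar>Im x\<bar> \<ge> R \<Longrightarrow>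
      norm (Gamma (par_d t + x) * Gamma (par_d t + 0 - x)) \<le> Kd * exp (- (5/2) * \<bar>Im x\<bar>)"
    using pair[of 0 "par_d t"] unfolding R_def by fastforce
  obtain Kp n where Kp: "Kp \<ge> 0" "\<And>z. norm (poly p z) \<le> Kp * (1 + norm z) ^ n"
    using norm_poly_le_power by blast
  obtain L where L: "L \<ge> 0" "\<And>x::real. x \<ge> 0 \<Longrightarrow> (2 + x) ^ n \<le> L * exp (1 * x)"
    using power_le_exp[of 2 1 n] by auto
  have "norm (Delta t x * poly p x) \<le> (Ka * Kb * Kc * Kd * (Kp * L)) * exp (- \<bar>Im x\<bar>)"
    if x: "0 \<le> Re x" "Re x \<le> 1" "\<bar>Im x\<bar> \<ge> R" for x
  proof -
    let ?y = "\<bar>Im x\<bar>"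
    have sin: "norm (rGamma (2 * x) * rGamma (1 - 2 * x)) \<le> exp (8 * ?y)"
    proof -
      have "norm (rGamma (2 * x) * rGamma (1 - 2 * x)) = norm (sin (of_real pi * (2 * x))) / pi"
        unfolding rGamma_reflection_complex by (simp add: norm_divide)
      also have "\<dots> \<le> exp \<bar>Im (of_real pi * (2 * x))\<bar> / 1"
        using cmod_sin_le_exp[of 1 "of_real pi * (2 * x)"] pi_gt3 by (intro frac_le) auto
      also have "\<dots> \<le> exp (8 * ?y)"
        using mult_right_mono[of "pi * 2" 8 ?y] pi_less_4 by (simp add: abs_mult mult_ac)
      finally show ?thesis .
    qed
    have pol: "norm (poly p x) \<le> Kp * (L * exp (1 * ?y))"
    proof -
      have "norm (poly p x) \<le> Kp * (1 + norm x) ^ n" by (rule Kp)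
      also have "\<dots> \<le> Kp * (2 + ?y) ^ n"
        using Kp(1) cmod_le[of x] x by (intro mult_left_mono power_mono) auto
      also have "\<dots> \<le> Kp * (L * exp (1 * ?y))" using Kp(1) by (intro mult_left_mono L) auto
      finally show ?thesis .
    qed
    have "norm (Delta t x * poly p x) \<le>
        (Ka * exp (- (5/2) * ?y)) * (Kb * exp (- (5/2) * ?y)) * (Kc * exp (- (5/2) * ?y)) *
        (Kd * exp (- (5/2) * ?y)) * exp (8 * ?y) * (Kp * (L * exp (1 * ?y)))"
      unfolding Delta_altdef norm_mult[of _ "poly p x"] norm_mult[of _ "rGamma (2 * x) * rGamma (1 - 2 * x)"]
        norm_mult[of _ "Gamma (par_d t + x) * _"] norm_mult[of _ "Gamma (par_c t + x) * _"]
        norm_mult[of _ "Gamma (par_b t + x) * _"]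
      by (intro mult_mono Ka(2) Kb(2) Kc(2) Kd(2) sin pol x mult_nonneg_nonneg norm_ge_zero
          Ka(1) Kb(1) Kc(1) Kd(1) exp_ge_zero)
    also have "\<dots> = (Ka * Kb * Kc * Kd * (Kp * L)) *
        (exp (- (5/2) * ?y) * exp (- (5/2) * ?y) * exp (- (5/2) * ?y) * exp (- (5/2) * ?y) * exp (8 * ?y) * exp (1 * ?y))"
      by (simp add: mult_ac)
    also have "exp (- (5/2) * ?y) * exp (- (5/2) * ?y) * exp (- (5/2) * ?y) * exp (- (5/2) * ?y) * exp (8 * ?y) * exp (1 * ?y)
       = exp (- ?y)"
      by (simp flip: exp_add)
    finally show ?thesis .
  qed
  moreover have "Ka * Kb * Kc * Kd * (Kp * L) \<ge> 0"
    using Ka(1) Kb(1) Kc(1) Kd(1) Kp(1) L(1) by simp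
  ultimately show ?thesis by blast
qed

section \<open>Contours along the imaginary axis\<close>

text \<open>Two such numbers differ by a nonzero multiple of 2 pi i.\<close>

lemma exp_eq_1_discrete:
  fixes w z :: complex
  assumes "exp w = 1" "exp z = 1" "w \<noteq> z"
  shows "1 \<le> norm (w - z)"
proof -
  from assms obtain m n :: int where w: "Re w = 0" "Im w = of_int (2 * m) * pi"
    and z: "Re z = 0" "Im z = of_int (2 * n) * pi"
    unfolding exp_eq_1 by blast
  then have "m \<noteq> n" using assms(3) by (auto simp: complex_eq_iff)
  then have "1 * 1 \<le> \<bar>real_of_int (2 * (m - n))\<bar> * pi" using pi_gt3 by (intro mult_mono) auto
  also have "\<dots> = \<bar>Im (w - z)\<bar>" using w z by (simp flip: left_diff_distrib add: abs_mult)
  also have "\<dots> \<le> norm (w - z)" by (rule abs_Im_le_cmod)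
  finally show ?thesis by simp
qed

section \<open>Truncated contours\<close>

locale contour =
  fixes C :: "real \<Rightarrow> complex" and R :: real
  assumes R_pos: "R > 0"
    and axis: "\<And>s. \<bar>s\<bar> \<ge> R \<Longrightarrow> C s = \<i> * of_real s"
    and smooth: "C piecewise_C1_differentiable_on {-R..R}"
begin

lemma smooth_ge: 
  assumes "n \<ge> R"
  shows "C piecewise_C1_differentiable_on {-n..n}"
proof -
  let ?a = "\<lambda>s. \<i> * of_real s"
  have a: "?a piecewise_C1_differentiable_on S" for S :: "real set"
    by (intro C1_differentiable_imp_piecewise derivative_intros)
  have "(\<lambda>s. if s \<le> -R then ?a s else (if s \<le> R then C s else ?a s)) piecewise_C1_differentiable_on {-n..n}"
    using assms R_pos by (intro piecewise_C1_differentiable_cases a smooth) (auto simp: axis)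
  moreover have "(\<lambda>s. if s \<le> -R then ?a s else (if s \<le> R then C s else ?a s)) = C"
    by (auto simp: axis)
  ultimately show ?thesis by simp
qed

definition cpath :: "real \<Rightarrow> real \<Rightarrow> complex" where
  "cpath n = C \<circ> (\<lambda>x. (2 * n) *\<^sub>R x + - n)"

lemma affine_image: "n \<ge> R \<Longrightarrow> (\<lambda>x. 2 * n * x + - n) ` {0..1} = {-n..n}"
  using R_pos image_affinity_atLeastAtMost[of "2 * n" "- n" 0 1] by simp

lemma valid_cpath: "n \<ge> R \<Longrightarrow> valid_path (cpath n)"
  unfolding valid_path_def cpath_def
  by (intro piecewise_C1_differentiable_affine) (simp only: affine_image smooth_ge)

lemma path_image_cpath: "n \<ge> R \<Longrightarrow> path_image (cpath n) = C ` {-n..n}"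
  unfolding path_image_def cpath_def image_comp[symmetric] by (simp only: real_scaleR_def affine_image)

lemma cpath_ends: "n \<ge> R \<Longrightarrow> pathstart (cpath n) = - \<i> * of_real n"
  "n \<ge> R \<Longrightarrow> pathfinish (cpath n) = \<i> * of_real n"
  using R_pos by (simp_all add: pathstart_def pathfinish_def cpath_def axis)

lemma has_contour_integral_cpath:
  assumes "n \<ge> R"
  shows "(f has_contour_integral I) (cpath n) \<longleftrightarrow>
    ((\<lambda>s. f (C s) * vector_derivative C (at s)) has_integral I) {-n..n}"
proof -
  let ?F = "\<lambda>s. f (C s) * vector_derivative C (at s)"
  let ?h = "\<lambda>x. (2 * n) *\<^sub>R x + - n"
  have n: "n > 0" using assms R_pos by simp
  obtain S where S: "finite S" "C C1_differentiable_on ({-n..n} - S)"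
    using smooth_ge[OF assms] by (auto simp: piecewise_C1_differentiable_on_def)
  \<comment> \<open>The finitely many points where C may fail to be differentiable do not affect the
    integral.\<close>
  have fin: "finite (?h -` S)"
    using S(1) n by (intro finite_vimageI) (auto simp: inj_def)
  have vd: "f (cpath n x) * vector_derivative (cpath n) (at x) = (2 * n) *\<^sub>R ?F (?h x)"
    if "x \<in> {0..1} - ?h -` S" for x
  proof -
    have "?h x \<in> {-n..n}" using that imageI[of x "{0..1}" "\<lambda>x. 2 * n * x + - n"] affine_image[OF assms] by simp
    then have "C differentiable at (?h x)"
      using S(2) that by (auto simp: C1_differentiable_on_eq)
    then have "(C has_vector_derivative vector_derivative C (at (?h x))) (at (?h x))"
      by (simp add: vector_derivative_works)
    moreover have "(?h has_vector_derivative 2 * n) (at x)"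
      by (auto intro!: derivative_eq_intros simp: has_vector_derivative_def)
    ultimately have "(C \<circ> ?h has_vector_derivative (2 * n) *\<^sub>R vector_derivative C (at (?h x))) (at x)"
      by (intro vector_diff_chain_at)
    then have "vector_derivative (cpath n) (at x) = (2 * n) *\<^sub>R vector_derivative C (at (?h x))"
      unfolding cpath_def by (rule vector_derivative_at)
    then show ?thesis by (simp add: cpath_def)
  qed
  have "(f has_contour_integral I) (cpath n) \<longleftrightarrow> ((\<lambda>x. (2 * n) *\<^sub>R ?F (?h x)) has_integral I) {0..1}"
    unfolding has_contour_integral by (rule has_integral_spike_finite_eq[OF fin]) (use vd in auto)
  also have "\<dots> \<longleftrightarrow> ((\<lambda>x. (2 * n) *\<^sub>R ?F (?h x)) has_integral ((2 * n) *\<^sub>R (I /\<^sub>R (2 * n)))) {0..1}"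
    using n by simp
  also have "\<dots> \<longleftrightarrow> ((\<lambda>x. ?F (?h x)) has_integral (I /\<^sub>R (2 * n))) {0..1}"
    using n by (intro has_integral_cmul_iff) simp
  also have "\<dots> \<longleftrightarrow> (?F has_integral I) {-n..n}"
    using has_integral_affinity_iff[of "2 * n" ?F "- n" I "- n" n] n by simp
  finally show ?thesis .
qed

text \<open>Makes the complement open, so that points of one component can be joined by a
  path.\<close>

lemma closed_range: "closed (range C)"
proof -
  have eq: "range C = C ` {-R..R} \<union> (\<lambda>s. \<i> * of_real s) ` ({..-R} \<union> {R..})"
  proof (intro equalityI subsetI)
    fix z assume "z \<in> range C"
    then obtain s where "z = C s" by blast
    then show "z \<in> C ` {-R..R} \<union> (\<lambda>s. \<i> * of_real s) ` ({..-R} \<union> {R..})"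
      using axis[of s] by (cases "\<bar>s\<bar> \<ge> R") (auto simp: abs_if split: if_splits)
  next
    fix z assume "z \<in> C ` {-R..R} \<union> (\<lambda>s. \<i> * of_real s) ` ({..-R} \<union> {R..})"
    then show "z \<in> range C" using R_pos by (force simp: axis[symmetric])
  qed
  have "closed (C ` {-R..R})"
    using smooth by (intro compact_imp_closed compact_continuous_image)
      (auto simp: piecewise_C1_differentiable_on_def)
  moreover have "closed ((\<lambda>s. \<i> * of_real s) ` ({..-R} \<union> {R..}))"
    by (intro closed_injective_linear_image closed_Un closed_atMost closed_atLeast)
      (auto simp: inj_def intro!: linearI simp: algebra_simps scaleR_conv_of_real)
  ultimately show ?thesis unfolding eq by (rule closed_Un)
qed

text \<open>Treats \<open>right_of\<close> (\<epsilon> = 1) and \<open>left_of\<close> (\<epsilon> =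
  -1) together.\<close>

definition side :: "real \<Rightarrow> complex \<Rightarrow> bool" where
  "side \<epsilon> w \<longleftrightarrow> (\<exists>r0. \<forall>r\<ge>r0. connected_component (- range C) w (of_real (\<epsilon> * r)))"

lemma sideD: "side \<epsilon> w \<Longrightarrow> w \<notin> range C"
  unfolding side_def using connected_component_in by blast

text \<open>The logarithmic value of the winding number of the non-closed truncated contour; it says that
  \<open>w\<close> lies to the right (\<open>\<epsilon> = 1\<close>) or to the left (\<open>\<epsilon> = - 1\<close>).\<close>

definition log_winding :: "real \<Rightarrow> real \<Rightarrow> complex \<Rightarrow> bool" where
  "log_winding \<epsilon> n w \<longleftrightarrow> 2 * of_real pi * \<i> * winding_number (cpath n) w =
     Ln (of_real \<epsilon> * (w - \<i> * of_real n)) - Ln (of_real \<epsilon> * (w + \<i> * of_real n))"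

text \<open>When w lies beyond the whole path, \<epsilon> (w - z) stays in the right half-plane,
  where its principal logarithm is a primitive of 1 / (z - w).\<close>

lemma log_winding_far:
  assumes n: "n \<ge> R" and \<epsilon>: "\<epsilon> = 1 \<or> \<epsilon> = -1"
    and far: "\<And>z. z \<in> path_image (cpath n) \<Longrightarrow> \<epsilon> * Re z < \<epsilon> * Re w"
  shows "log_winding \<epsilon> n w"
proof -
  let ?S = "{z. \<epsilon> * Re z < \<epsilon> * Re w}"
  have "((\<lambda>z. Ln (of_real \<epsilon> * (w - z))) has_field_derivative 1 / (z - w)) (at z within ?S)" if "z \<in> ?S" for z
  proof -
    have re: "Re (of_real \<epsilon> * (w - z)) > 0" using that by (simp add: algebra_simps)
    then have "of_real \<epsilon> * (w - z) \<notin> \<real>\<^sub>\<le>\<^sub>0" by (auto simp: complex_nonpos_Reals_iff)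
    moreover have "w \<noteq> z" using re by auto
    ultimately show ?thesis
      using \<epsilon> by (auto intro!: derivative_eq_intros simp: field_simps)
  qed
  then have "((\<lambda>z. 1 / (z - w)) has_contour_integral
      Ln (of_real \<epsilon> * (w - pathfinish (cpath n))) - Ln (of_real \<epsilon> * (w - pathstart (cpath n)))) (cpath n)"
    using far by (intro contour_integral_primitive[where S = ?S] valid_cpath n) auto
  moreover have "w \<notin> path_image (cpath n)" using far by blast
  ultimately show ?thesis
    unfolding log_winding_def using winding_number_valid_path[OF valid_cpath[OF n], of w]
    by (simp add: contour_integral_unique cpath_ends n)
qed

text \<open>The defect \<Phi> is continuous on K with exp \<Phi> = 1; its values are discrete, so it
  is constant on the connected set K. The bound on Im keeps both logarithms off the branch
  cut.\<close>

lemma log_winding_transport: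
  assumes n: "n \<ge> R" and \<epsilon>: "\<epsilon> = 1 \<or> \<epsilon> = -1"
    and K: "connected K" "K \<inter> path_image (cpath n) = {}" "\<And>z. z \<in> K \<Longrightarrow> \<bar>Im z\<bar> < n"
    and "v \<in> K" "w \<in> K" "log_winding \<epsilon> n v"
  shows "log_winding \<epsilon> n w"
proof -
  let ?W = "\<lambda>z. 2 * of_real pi * \<i> * winding_number (cpath n) z"
  let ?p = "\<lambda>z. of_real \<epsilon> * (z - \<i> * of_real n)" and ?q = "\<lambda>z. of_real \<epsilon> * (z + \<i> * of_real n)"
  define \<Phi> where "\<Phi> z = ?W z - (Ln (?p z) - Ln (?q z))" for z
  have slit: "?p z \<notin> \<real>\<^sub>\<le>\<^sub>0" "?q z \<notin> \<real>\<^sub>\<le>\<^sub>0" if "z \<in> K" for z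
    using K(3)[OF that] \<epsilon> by (auto simp: complex_nonpos_Reals_iff)
  have e: "exp (\<Phi> z) = 1" if z: "z \<in> K" for z
  proof -
    have zi: "z \<notin> path_image (cpath n)" using K(2) z by blast
    have nz: "?p z \<noteq> 0" "?q z \<noteq> 0" using slit[OF z] by auto
    have "\<i> * of_real n - z = exp (?W z) * (- \<i> * of_real n - z)"
      using winding_number_exp_2pi[OF valid_path_imp_path[OF valid_cpath[OF n]] zi]
      by (simp add: cpath_ends n)
    then have "?p z = exp (?W z) * ?q z"
      by (metis (no_types, lifting) add.commute minus_diff_eq minus_mult_minus mult.left_commute mult_minus_left mult_minus_right diff_minus_eq_add minus_add_distrib uminus_add_conv_diff)
    then have "exp (?W z) = ?p z / ?q z" using nz by simp
    then show ?thesis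
      unfolding \<Phi>_def exp_diff using nz by (simp add: exp_Ln)
  qed
  have "continuous_on K \<Phi>"
    unfolding \<Phi>_def using slit K(2)
    by (intro continuous_intros continuous_on_subset[OF continuous_on_winding_number]
        valid_path_imp_path valid_cpath n) auto
  then have "\<Phi> constant_on K"
  proof (rule continuous_discrete_range_constant[OF K(1)])
    fix x assume "x \<in> K"
    then show "\<exists>e>0. \<forall>y. y \<in> K \<and> \<Phi> y \<noteq> \<Phi> x \<longrightarrow> e \<le> norm (\<Phi> y - \<Phi> x)"
      using exp_eq_1_discrete e by (intro exI[of _ 1]) auto
  qed
  then have "\<Phi> w = \<Phi> v" using assms by (auto simp: constant_on_def)
  moreover have "\<Phi> v = 0" using assms unfolding \<Phi>_def log_winding_def by simp
  ultimately show ?thesis unfolding \<Phi>_def log_winding_def by simp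
qed

lemma bounded_Re: "\<exists>B. \<forall>s. \<bar>Re (C s)\<bar> \<le> B"
proof -
  have "compact (C ` {-R..R})"
    using smooth by (intro compact_continuous_image) (auto simp: piecewise_C1_differentiable_on_def)
  then obtain B where B: "\<And>s. s \<in> {-R..R} \<Longrightarrow> norm (C s) \<le> B"
    by (metis bounded_iff compact_imp_bounded image_eqI)
  have "\<bar>Re (C s)\<bar> \<le> max B 0" for s
  proof (cases "\<bar>s\<bar> \<ge> R")
    case True
    then show ?thesis by (simp add: axis)
  next
    case False
    then have "norm (C s) \<le> B" by (intro B) auto
    then show ?thesis using abs_Re_le_cmod[of "C s"] by linarith
  qed
  then show ?thesis by blast
qed

text \<open>A path avoiding the contour joins w to a real point beyond the bounded real parts of the
  contour. Once the truncation is higher than this path, the value found at the far end is carried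
  back to w.\<close>

lemma log_winding_eventually:
  assumes \<epsilon>: "\<epsilon> = 1 \<or> \<epsilon> = -1" and w: "side \<epsilon> w"
  shows "\<exists>N. \<forall>n\<ge>N. log_winding \<epsilon> n w"
proof -
  obtain r0 where r0: "\<And>r. r \<ge> r0 \<Longrightarrow> connected_component (- range C) w (of_real (\<epsilon> * r))"
    using w unfolding side_def by blast
  obtain B where B: "\<And>s. \<bar>Re (C s)\<bar> \<le> B" using bounded_Re by blast
  define r where "r = max r0 (B + 1)"
  have "path_component (- range C) w (of_real (\<epsilon> * r))"
    using r0[of r] closed_range by (simp add: r_def open_path_connected_component closed_def)
  then obtain g where g: "path g" "path_image g \<subseteq> - range C" "pathstart g = w" "pathfinish g = of_real (\<epsilon> * r)"
    unfolding path_component_def by blast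
  obtain b where b: "\<And>z. z \<in> path_image g \<Longrightarrow> norm z < b"
    using bounded_path_image[OF g(1)] unfolding bounded_pos_less by blast
  have "log_winding \<epsilon> n w" if n: "n \<ge> max R b" for n
  proof (rule log_winding_transport)
    show "n \<ge> R" using n by simp
    show "connected (path_image g)" using g(1) by (rule connected_path_image)
    show "path_image g \<inter> path_image (cpath n) = {}"
      using n g(2) by (auto simp: path_image_cpath)
    show "\<bar>Im z\<bar> < n" if "z \<in> path_image g" for z
      using b[OF that] abs_Im_le_cmod[of z] n by linarith
    show "of_real (\<epsilon> * r) \<in> path_image g" "w \<in> path_image g"
      using g(3,4) pathfinish_in_path_image pathstart_in_path_image by metis+
    show "log_winding \<epsilon> n (of_real (\<epsilon> * r))"
    proof (rule log_winding_far[OF _ \<epsilon>])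
      fix z assume "z \<in> path_image (cpath n)"
      then obtain s where "z = C s" using n by (auto simp: path_image_cpath)
      then show "\<epsilon> * Re z < \<epsilon> * Re (of_real (\<epsilon> * r))"
        using B[of s] \<epsilon> by (auto simp: r_def abs_le_iff)
    qed (use n in simp)
  qed (use \<epsilon> in auto)
  then show ?thesis by blast
qed

text \<open>One height for an infinite progression: all but finitely many of its points lie
  horizontally beyond the contour, where every n \<ge> R works, and the finitely many others have a
  largest bound.\<close>

lemma log_winding_uniform:
  assumes \<epsilon>: "\<epsilon> = 1 \<or> \<epsilon> = -1" and e: "\<And>m::nat. side \<epsilon> (of_real \<epsilon> * (e + of_nat m))"
  shows "\<exists>N. \<forall>n\<ge>N. \<forall>m::nat. log_winding \<epsilon> n (of_real \<epsilon> * (e + of_nat m))"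
proof -
  obtain B where B: "\<And>s. \<bar>Re (C s)\<bar> \<le> B" using bounded_Re by blast
  obtain M :: nat where M: "B - Re e < real M" using reals_Archimedean2 by blast
  have "\<forall>m. \<exists>N. \<forall>n\<ge>N. log_winding \<epsilon> n (of_real \<epsilon> * (e + of_nat m))"
    using log_winding_eventually[OF \<epsilon> e] by blast
  then obtain N where N: "\<And>m n. n \<ge> N m \<Longrightarrow> log_winding \<epsilon> n (of_real \<epsilon> * (e + of_nat m))" by metis
  have "log_winding \<epsilon> n (of_real \<epsilon> * (e + of_nat m))" if n: "n \<ge> Max (insert R (N ` {..<M}))" for n m
  proof (cases "m < M")
    case True
    then have "N m \<le> Max (insert R (N ` {..<M}))" by (intro Max_ge) auto
    then show ?thesis using n N by (meson order_trans)
  next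
    case False
    have nR: "n \<ge> R" using n by simp
    show ?thesis
    proof (rule log_winding_far[OF nR \<epsilon>])
      fix z assume "z \<in> path_image (cpath n)"
      then obtain s where "z = C s" using nR by (auto simp: path_image_cpath)
      then show "\<epsilon> * Re z < \<epsilon> * Re (of_real \<epsilon> * (e + of_nat m))"
        using B[of s] \<epsilon> M False by (auto simp: abs_le_iff)
    qed
  qed
  then show ?thesis by blast
qed

end

section \<open>Improper integrals over the real line\<close>

lemma exp_abs_integrable: "(\<lambda>s::real. exp (- \<bar>s\<bar>)) integrable_on UNIV"
proof -
  have p: "(\<lambda>s::real. exp (- s)) integrable_on {0..}"
    using integrable_on_exp_minus_to_infinity[of 1 0] by simp
  then have pa: "(\<lambda>s::real. exp (- s)) absolutely_integrable_on {0..}"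
    by (intro nonnegative_absolutely_integrable_1) auto
  have "uminus ` {..0} \<subseteq> {0::real..}" "uminus ` {0..} \<subseteq> {..0::real}" "{..0::real} \<in> sets lebesgue" by auto
  from has_absolute_integral_reflect_real[OF this, of "\<lambda>s. exp (- s)" "integral {0..} (\<lambda>s. exp (- s))"] pa
  have "(\<lambda>s::real. exp s) absolutely_integrable_on {..0}" by simp
  then have "(\<lambda>s::real. exp s) integrable_on {..0}"
    by (rule set_lebesgue_integral_eq_integral(1))
  then have "(\<lambda>s::real. exp (- \<bar>s\<bar>)) integrable_on {..0}"
    by (rule integrable_eq) simp
  moreover have "(\<lambda>s::real. exp (- \<bar>s\<bar>)) integrable_on {0..}"
    using p by (rule integrable_eq) simp
  moreover have "negligible ({..0} \<inter> {0::real..})"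
    by (rule negligible_subset[of "{0}"]) auto
  ultimately have "(\<lambda>s::real. exp (- \<bar>s\<bar>)) integrable_on ({..0} \<union> {0..})"
    by (intro integrable_Un)
  moreover have "{..0} \<union> {0..} = (UNIV :: real set)" by auto
  ultimately show ?thesis by simp
qed

lemma integrable_real_decay:
  fixes f :: "real \<Rightarrow> complex"
  assumes int: "\<And>n. n \<ge> R \<Longrightarrow> f integrable_on {-n..n}"
    and decay: "\<And>s. \<bar>s\<bar> > R \<Longrightarrow> norm (f s) \<le> K * exp (- \<bar>s\<bar>)" and K: "K \<ge> 0"
  shows "f integrable_on UNIV"
proof -
  \<comment> \<open>The bound is known only outside [-R, R]; the middle part is split off so that
    the rest is dominated everywhere.\<close>
  define g where "g s = (if s \<in> {-R..R} then f s else 0)" for s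
  have g: "g integrable_on UNIV"
    unfolding g_def integrable_restrict_UNIV by (rule int) simp
  have "(\<lambda>s. f s - g s) integrable_on UNIV"
  proof (rule integrable_on_all_intervals_UNIV)
    fix a b :: real
    define n where "n = max R (max \<bar>a\<bar> \<bar>b\<bar>)"
    have "(\<lambda>s. f s - g s) integrable_on {-n..n}"
      using g by (intro integrable_diff int integrable_on_subinterval[of g UNIV]) (auto simp: n_def)
    then show "(\<lambda>s. f s - g s) integrable_on cbox a b"
      by (rule integrable_on_subcbox) (auto simp: n_def)
  next
    show "norm (f s - g s) \<le> K * exp (- \<bar>s\<bar>)" for s
      using decay[of s] K by (cases "\<bar>s\<bar> > R") (auto simp: g_def abs_le_iff)
  next
    show "(\<lambda>s. K * exp (- \<bar>s\<bar>)) integrable_on UNIV"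
      by (intro integrable_on_mult_right exp_abs_integrable)
  qed
  then have "(\<lambda>s. (f s - g s) + g s) integrable_on UNIV"
    using g by (rule integrable_add)
  then show ?thesis by simp
qed

lemma has_integral_UNIV_zero:
  fixes f :: "real \<Rightarrow> complex"
  assumes J: "(f has_integral J) UNIV"
    and small: "\<And>n. n \<ge> N \<Longrightarrow> norm (integral {-n..n} f) \<le> K * exp (- n)"
  shows "J = 0"
proof (rule ccontr)
  assume "J \<noteq> 0"
  define e where "e = norm J / 2"
  have e: "e > 0" using \<open>J \<noteq> 0\<close> by (simp add: e_def)
  have "\<forall>e>0. \<exists>B>0. \<forall>a b. ball 0 B \<subseteq> cbox a b \<longrightarrow> norm (integral (cbox a b) f - J) < e"
    using J unfolding has_integral_alt'[of f] by simp
  from this[rule_format, OF e] obtain B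
    where B: "\<And>a b. ball 0 B \<subseteq> cbox a b \<Longrightarrow> norm (integral (cbox a b) f - J) < e"
    by blast
  have "((\<lambda>n::real. K * exp (- n)) \<longlongrightarrow> K * 0) at_top"
    by (intro tendsto_mult_left filterlim_compose[OF exp_at_bot filterlim_uminus_at_bot_at_top])
  then have "eventually (\<lambda>n. K * exp (- n) < e) at_top"
    using e by (intro order_tendstoD(2)[of _ "K * 0"]) auto
  then have "eventually (\<lambda>n. K * exp (- n) < e \<and> n \<ge> N \<and> n \<ge> B) at_top"
    by (intro eventually_conj eventually_ge_at_top)
  then obtain n where n: "K * exp (- n) < e" "n \<ge> N" "n \<ge> B"
    by (metis (mono_tags, lifting) eventually_at_top_linorder order_refl)
  have "ball 0 B \<subseteq> cbox (- n) n" using n(3) by (auto simp: dist_norm)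
  then have "norm (integral {-n..n} f - J) < e" using B[of "- n" n] by simp
  moreover have "norm (integral {-n..n} f) < e" using small[OF n(2)] n(1) by simp
  moreover have "norm J \<le> norm (integral {-n..n} f) + norm (integral {-n..n} f - J)"
    using norm_triangle_ineq4[of "integral {-n..n} f" "integral {-n..n} f - J"] by simp
  ultimately show False by (simp add: e_def)
qed

text \<open>Along the segment w - z has a constant nonzero imaginary part, so the principal
  logarithm is a primitive. The sign \<epsilon> is left free to match
  \<open>log_winding\<close>.\<close>

lemma winding_number_horizontal:
  assumes \<epsilon>: "\<epsilon> = 1 \<or> \<epsilon> = -1" and ab: "Im a = y" "Im b = y" "Im w \<noteq> y"
  shows "2 * of_real pi * \<i> * winding_number (linepath a b) w = Ln (of_real \<epsilon> * (w - b)) - Ln (of_real \<epsilon> * (w - a))"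
    and "w \<notin> path_image (linepath a b)"
proof -
  let ?S = "{z. Im z = y}"
  have "convex ?S" unfolding convex_alt by (auto simp: algebra_simps)
  then have sub: "path_image (linepath a b) \<subseteq> ?S"
    using ab by (simp add: closed_segment_subset)
  have "((\<lambda>z. Ln (of_real \<epsilon> * (w - z))) has_field_derivative 1 / (z - w)) (at z within ?S)" if "z \<in> ?S" for z
  proof -
    have im: "Im (of_real \<epsilon> * (w - z)) \<noteq> 0" using that ab \<epsilon> by auto
    then have "of_real \<epsilon> * (w - z) \<notin> \<real>\<^sub>\<le>\<^sub>0" by (auto simp: complex_nonpos_Reals_iff)
    moreover have "w \<noteq> z" using im by auto
    ultimately show ?thesis
      using \<epsilon> by (auto intro!: derivative_eq_intros simp: field_simps)
  qed
  then have "((\<lambda>z. 1 / (z - w)) has_contour_integral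
      Ln (of_real \<epsilon> * (w - pathfinish (linepath a b))) - Ln (of_real \<epsilon> * (w - pathstart (linepath a b)))) (linepath a b)"
    using sub by (intro contour_integral_primitive[where S = ?S]) auto
  moreover show w: "w \<notin> path_image (linepath a b)" using sub ab by blast
  ultimately show "2 * of_real pi * \<i> * winding_number (linepath a b) w = Ln (of_real \<epsilon> * (w - b)) - Ln (of_real \<epsilon> * (w - a))"
    using winding_number_valid_path[OF _ w] by (simp add: contour_integral_unique)
qed

section \<open>Reflected contours and Cauchy's theorem\<close>

lemma contour_integral_reflect:
  assumes "valid_path g"
  shows "valid_path ((\<lambda>z. d - z) \<circ> g)"
    and "contour_integral ((\<lambda>z. d - z) \<circ> g) f = - contour_integral g (\<lambda>x. f (d - x))"
proof -
  have eq: "(\<lambda>z. d - z) \<circ> g = (+) d \<circ> (uminus \<circ> g)" by (simp add: fun_eq_iff)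
  show "valid_path ((\<lambda>z. d - z) \<circ> g)"
    unfolding eq valid_path_translation_eq using assms by (rule valid_path_negatepath)
  show "contour_integral ((\<lambda>z. d - z) \<circ> g) f = - contour_integral g (\<lambda>x. f (d - x))"
    unfolding eq contour_integral_translate contour_integral_negatepath[OF assms] by simp
qed

context contour
begin

lemma integral_cpath:
  "n \<ge> R \<Longrightarrow> f contour_integrable_on cpath n \<Longrightarrow>
    (\<lambda>s. f (C s) * vector_derivative C (at s)) integrable_on {-n..n} \<and>
    integral {-n..n} (\<lambda>s. f (C s) * vector_derivative C (at s)) = contour_integral (cpath n) f"
  using has_contour_integral_cpath[of n f "contour_integral (cpath n) f"] has_contour_integral_integral
  by (auto simp: integral_unique)

lemma integrable_contour:
  assumes S: "open S" "f holomorphic_on S" "range C \<subseteq> S"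
    and decay: "\<And>s. \<bar>s\<bar> \<ge> r \<Longrightarrow> norm (f (\<i> * of_real s)) \<le> K * exp (- \<bar>s\<bar>)"
  shows "(\<lambda>s. f (C s) * vector_derivative C (at s)) integrable_on UNIV"
proof (rule integrable_real_decay)
  fix n assume "n \<ge> max r R"
  then have n: "n \<ge> R" by simp
  have "f contour_integrable_on cpath n"
    using S n by (intro contour_integrable_holomorphic_simple[of f S] valid_cpath) (auto simp: path_image_cpath)
  then show "(\<lambda>s. f (C s) * vector_derivative C (at s)) integrable_on {-n..n}"
    using integral_cpath n by blast
next
  fix s assume s: "\<bar>s\<bar> > max r R"
  have "((\<lambda>s. \<i> * of_real s) has_vector_derivative \<i>) (at s)"
    by (auto intro!: derivative_eq_intros simp: has_vector_derivative_def scaleR_conv_of_real mult.commute)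
  then have "(C has_vector_derivative \<i>) (at s)"
  proof (rule has_vector_derivative_transform_within_open)
    show "open {x. \<bar>x\<bar> > R}" by (intro open_Collect_less continuous_intros)
  qed (use s in \<open>auto simp: axis\<close>)
  then have "vector_derivative C (at s) = \<i>" by (rule vector_derivative_at)
  then have "norm (f (C s) * vector_derivative C (at s)) = norm (f (\<i> * of_real s))"
    using s by (simp add: axis norm_mult)
  also have "\<dots> \<le> K * exp (- \<bar>s\<bar>)" using s by (intro decay) simp
  also have "\<dots> \<le> max 0 K * exp (- \<bar>s\<bar>)" by (intro mult_right_mono) auto
  finally show "norm (f (C s) * vector_derivative C (at s)) \<le> max 0 K * exp (- \<bar>s\<bar>)" .
qed simp

text \<open>The contour up to height \<open>n\<close>, its image under \<open>z \<mapsto> d - z\<close> and two horizontal segments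
  form a closed curve which winds around no singularity; both long pieces contribute the same.\<close>

lemma antisymmetric_contour_integral:
  fixes d :: real
  assumes n: "n \<ge> R" and S: "open S" "k holomorphic_on S"
    and anti: "\<And>x. k (of_real d - x) = - k x"
    and img: "range C \<subseteq> S" "\<And>w. w \<notin> S \<Longrightarrow> of_real d - w \<notin> range C"
    and wind: "\<And>w. w \<notin> S \<Longrightarrow> \<bar>Im w\<bar> < n \<and> (\<exists>\<epsilon>. (\<epsilon> = 1 \<or> \<epsilon> = -1) \<and>
       log_winding \<epsilon> n w \<and> log_winding (- \<epsilon>) n (of_real d - w))"
  shows "2 * contour_integral (cpath n) k
    + contour_integral (linepath (\<i> * of_real n) (of_real d + \<i> * of_real n)) k
    + contour_integral (linepath (of_real d - \<i> * of_real n) (- \<i> * of_real n)) k = 0"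
proof -
  let ?g1 = "cpath n" and ?g2 = "(\<lambda>z. of_real d - z) \<circ> cpath n"
  let ?l1 = "linepath (\<i> * of_real n) (of_real d + \<i> * of_real n)"
  let ?l2 = "linepath (of_real d - \<i> * of_real n) (- \<i> * of_real n)"
  have n0: "n > 0" using n R_pos by simp
  have v1: "valid_path ?g1" by (rule valid_cpath[OF n])
  note v2 = contour_integral_reflect(1)[OF v1, of "of_real d"]
  have ends: "pathstart ?g2 = of_real d + \<i> * of_real n" "pathfinish ?g2 = of_real d - \<i> * of_real n"
    using cpath_ends[OF n] by (simp_all add: pathstart_compose pathfinish_compose)
  have p1: "path_image ?g1 \<subseteq> S" using img n by (auto simp: path_image_cpath)
  have p2: "path_image ?g2 \<subseteq> S"
  proof
    fix z assume "z \<in> path_image ?g2"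
    then have "of_real d - z \<in> range C" using n by (auto simp: path_image_compose path_image_cpath)
    then show "z \<in> S" using img(2) by blast
  qed
  have hl: "w \<notin> path_image ?l1" "w \<notin> path_image ?l2" if "w \<notin> S" for w
    using wind[OF that] n0
    by (intro winding_number_horizontal(2)[of 1 _ n] winding_number_horizontal(2)[of 1 _ "- n"]; auto)+
  define \<gamma> where "\<gamma> = ?g1 +++ ?l1 +++ ?g2 +++ ?l2"
  have valid: "valid_path \<gamma>" "pathfinish \<gamma> = pathstart \<gamma>"
    unfolding \<gamma>_def using v1 v2 ends cpath_ends[OF n] by (auto intro!: valid_path_join)
  have int: "k contour_integrable_on g" if "valid_path g" "path_image g \<subseteq> S" for g
    using S that by (intro contour_integrable_holomorphic_simple[of k S])
  have l: "path_image ?l1 \<subseteq> S" "path_image ?l2 \<subseteq> S" using hl by blast+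
  have "(k has_contour_integral 0) \<gamma>"
  proof (rule Cauchy_theorem_global[OF S valid])
    show "path_image \<gamma> \<subseteq> S"
      unfolding \<gamma>_def using p1 p2 l ends cpath_ends[OF n] by (auto simp: path_image_join)
  next
    fix w assume w: "w \<notin> S"
    obtain \<epsilon> where \<epsilon>: "\<epsilon> = 1 \<or> \<epsilon> = -1" "\<bar>Im w\<bar> < n"
      "log_winding \<epsilon> n w" "log_winding (- \<epsilon>) n (of_real d - w)"
      using wind[OF w] by blast
    have nw: "w \<notin> path_image ?g1" "w \<notin> path_image ?g2" "of_real d - w \<notin> path_image ?g1"
      using p1 p2 w img(2)[OF w] path_image_cpath[OF n] by auto
    \<comment> \<open>The map x \<mapsto> d - x is a half-turn, which preserves winding
      numbers.\<close>
    have "winding_number ?g2 w = winding_number ?g1 (of_real d - w)"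
    proof -
      have "(\<lambda>x. 1 / (of_real d - x - w)) = (\<lambda>x. - (1 / (x - (of_real d - w))))"
        by (auto simp: fun_eq_iff minus_divide_right)
      then have "contour_integral ?g2 (\<lambda>x. 1 / (x - w)) = contour_integral ?g1 (\<lambda>x. 1 / (x - (of_real d - w)))"
        using contour_integral_reflect(2)[OF v1, of "of_real d" "\<lambda>x. 1 / (x - w)"]
        by (simp add: contour_integral_neg)
      then show ?thesis
        using winding_number_valid_path[OF v2 nw(2)] winding_number_valid_path[OF v1 nw(3)] by simp
    qed
    then have "winding_number \<gamma> w = winding_number ?g1 w + (winding_number ?l1 w +
        (winding_number ?g1 (of_real d - w) + winding_number ?l2 w))"
      unfolding \<gamma>_def using nw hl[OF w] ends cpath_ends[OF n] valid_path_imp_path[OF v1] valid_path_imp_path[OF v2]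
      by (simp add: winding_number_join path_image_join not_in_path_image_join)
    moreover have "2 * of_real pi * \<i> * (winding_number ?g1 w + (winding_number ?l1 w +
        (winding_number ?g1 (of_real d - w) + winding_number ?l2 w))) = 0"
    proof -
      have 1: "2 * of_real pi * \<i> * winding_number ?l1 w = Ln (of_real \<epsilon> * (w - (of_real d + \<i> * of_real n))) -
          Ln (of_real \<epsilon> * (w - \<i> * of_real n))"
        using \<epsilon> n0 by (intro winding_number_horizontal(1)[of _ _ n]) auto
      have 2: "2 * of_real pi * \<i> * winding_number ?l2 w = Ln (of_real \<epsilon> * (w - (- \<i> * of_real n))) -
          Ln (of_real \<epsilon> * (w - (of_real d - \<i> * of_real n)))"
        using \<epsilon> n0 by (intro winding_number_horizontal(1)[of _ _ "- n"]) auto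
      \<comment> \<open>Reflection turns -\<epsilon> into \<epsilon>. After this rewriting the eight
        logarithms, two at each corner of the closed curve, cancel in pairs.\<close>
      have 3: "of_real (- \<epsilon>) * (of_real d - w - \<i> * of_real n) = of_real \<epsilon> * (w - (of_real d - \<i> * of_real n))"
        "of_real (- \<epsilon>) * (of_real d - w + \<i> * of_real n) = of_real \<epsilon> * (w - (of_real d + \<i> * of_real n))"
        by (simp_all add: algebra_simps)
      show ?thesis
        using \<epsilon>(3,4) 1 2 unfolding log_winding_def 3 by (simp add: distrib_left)
    qed
    ultimately show "winding_number \<gamma> w = 0" by simp
  qed
  then have "contour_integral \<gamma> k = 0" by (rule contour_integral_unique)
  moreover have "contour_integral \<gamma> k = contour_integral ?g1 k + (contour_integral ?l1 k +
      (contour_integral ?g2 k + contour_integral ?l2 k))"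
    unfolding \<gamma>_def using v1 v2 ends cpath_ends[OF n] p1 p2 l
    by (simp add: contour_integral_join int path_image_join contour_integrable_joinI)
  moreover have "contour_integral ?g2 k = contour_integral ?g1 k"
    unfolding contour_integral_reflect(2)[OF v1] anti by (simp add: contour_integral_neg)
  ultimately show ?thesis by (simp add: algebra_simps)
qed

text \<open>The closing segments have length d \<le> 1 and lie in the strip where k decays, so the
  truncated integrals are O(exp(-n)).\<close>

lemma antisymmetric_integral_zero:
  fixes d :: real
  assumes S: "open S" "k holomorphic_on S" and d: "0 \<le> d" "d \<le> 1"
    and anti: "\<And>x. k (of_real d - x) = - k x"
    and img: "range C \<subseteq> S" "\<And>w. w \<notin> S \<Longrightarrow> of_real d - w \<notin> range C"
    and wind: "\<And>n w. n \<ge> N \<Longrightarrow> w \<notin> S \<Longrightarrow> \<bar>Im w\<bar> < n \<and> (\<exists>\<epsilon>. (\<epsilon> = 1 \<or> \<epsilon> = -1) \<and>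
       log_winding \<epsilon> n w \<and> log_winding (- \<epsilon>) n (of_real d - w))"
    and decay: "\<And>x. 0 \<le> Re x \<Longrightarrow> Re x \<le> 1 \<Longrightarrow> \<bar>Im x\<bar> \<ge> r \<Longrightarrow> norm (k x) \<le> K * exp (- \<bar>Im x\<bar>)"
  shows "integral UNIV (\<lambda>s. k (C s) * vector_derivative C (at s)) = 0"
proof -
  let ?F = "\<lambda>s. k (C s) * vector_derivative C (at s)"
  have "?F integrable_on UNIV"
    using decay[of "\<i> * of_real s" for s] by (intro integrable_contour[OF S img(1), of r K]) auto
  then have J: "(?F has_integral integral UNIV ?F) UNIV" by (rule integrable_integral)
  show ?thesis
  proof (rule has_integral_UNIV_zero[OF J])
    fix n assume "n \<ge> max (max R N) r"
    then have n: "n \<ge> R" "n \<ge> N" "n \<ge> r" "n > 0" using R_pos by auto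
    let ?l1 = "linepath (\<i> * of_real n) (of_real d + \<i> * of_real n)"
    let ?l2 = "linepath (of_real d - \<i> * of_real n) (- \<i> * of_real n)"
    have bound: "norm (contour_integral (linepath a b) k) \<le> max 0 K * exp (- n)"
      if ab: "\<bar>Im a\<bar> = n" "Im b = Im a" "0 \<le> Re a" "Re a \<le> 1" "0 \<le> Re b" "Re b \<le> 1" for a b
    proof -
      have seg: "closed_segment a b \<subseteq> {z. Im z = Im a \<and> 0 \<le> Re z \<and> Re z \<le> 1}"
        using ab by (auto simp: closed_segment_same_Im closed_segment_eq_real_ivl split: if_splits)
      have le: "norm (k x) \<le> max 0 K * exp (- n)" if "x \<in> closed_segment a b" for x
      proof -
        have "norm (k x) \<le> K * exp (- \<bar>Im x\<bar>)" using seg that ab n by (intro decay) auto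
        also have "\<dots> \<le> max 0 K * exp (- n)" using seg that ab by (intro mult_mono) auto
        finally show ?thesis .
      qed
      have "w \<notin> path_image (linepath a b)" if "w \<notin> S" for w
        using seg wind[OF n(2) that] ab by (auto simp: abs_if split: if_splits)
      then have "k contour_integrable_on linepath a b"
        using S by (intro contour_integrable_holomorphic_simple[of k S]) auto
      then have "norm (contour_integral (linepath a b) k) \<le> max 0 K * exp (- n) * norm (b - a)"
        using le by (intro contour_integral_bound_linepath) auto
      also have "norm (b - a) \<le> 1"
        using ab cmod_le[of "b - a"] by simp
      finally show ?thesis by (simp add: mult_left_mono)
    qed
    have "2 * norm (contour_integral (cpath n) k) = norm (contour_integral ?l1 k + contour_integral ?l2 k)"
    proof -
      have "2 * contour_integral (cpath n) k + contour_integral ?l1 k + contour_integral ?l2 k = 0"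
        by (rule antisymmetric_contour_integral[OF n(1) S anti]) (use img wind[OF n(2)] in auto)
      then have "2 * contour_integral (cpath n) k = - (contour_integral ?l1 k + contour_integral ?l2 k)"
        by (simp only: eq_neg_iff_add_eq_0 add.assoc)
      then show ?thesis by (metis norm_minus_cancel norm_mult norm_numeral)
    qed
    also have "\<dots> \<le> max 0 K * exp (- n) + max 0 K * exp (- n)"
      using n d by (intro norm_triangle_mono bound) auto
    finally have "norm (contour_integral (cpath n) k) \<le> max 0 K * exp (- n)" by simp
    moreover have "k contour_integrable_on cpath n"
      using S n img by (intro contour_integrable_holomorphic_simple[of k S] valid_cpath) (auto simp: path_image_cpath)
    ultimately show "norm (integral {-n..n} ?F) \<le> max 0 K * exp (- n)"
      using integral_cpath[OF n(1)] by simp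
  qed
qed

end

section \<open>Self-adjointness\<close>

text \<open>Two families exchanged by x \<mapsto> d - x. For d = 0 they contain the singularities of
  \<open>Delta\<close> and \<open>kernel1\<close>, for d = 1 those of \<open>kernel0\<close>;
  treating the four parameters alike may include regular points.\<close>

definition poles :: "params \<Rightarrow> nat \<Rightarrow> complex set" where
  "poles t d = {w. \<exists>e\<in>{par_a t, par_b t, par_c t, par_d t}. \<exists>m::nat.
     w = e + of_nat (d + m) \<or> w = - (e + of_nat m)}"

lemma closed_poles: "closed (poles t d)"
proof -
  have "poles t d = (\<Union>e\<in>{par_a t, par_b t, par_c t, par_d t}.
      ((+) (e + of_nat d) ` \<nat>) \<union> (uminus ` ((+) e ` \<nat>)))"
    unfolding poles_def Nats_def by (auto simp: image_iff add.assoc)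
  also have "closed \<dots>"
    by (intro closed_UN ballI closed_Un closed_translation closed_negations closed_Nats) simp
  finally show ?thesis .
qed

section \<open>Weight and kernels away from the poles\<close>

lemma not_nonpos_Ints_minus:
  assumes "x \<notin> poles t d" "e \<in> {par_a t, par_b t, par_c t, par_d t}"
  shows "e + of_nat (d + j) - x \<notin> \<int>\<^sub>\<le>\<^sub>0"
proof
  assume "e + of_nat (d + j) - x \<in> \<int>\<^sub>\<le>\<^sub>0"
  then obtain n where "e + of_nat (d + j) - x = - of_nat n" by (rule nonpos_Ints_cases')
  then have "x = e + of_nat (d + j) + of_nat n" by (simp add: algebra_simps)
  then have "x = e + of_nat (d + (j + n))" by simp
  then show False using assms unfolding poles_def by blast
qed

lemma not_nonpos_Ints_plus:
  assumes "x \<notin> poles t d" "e \<in> {par_a t, par_b t, par_c t, par_d t}"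
  shows "e + of_nat j + x \<notin> \<int>\<^sub>\<le>\<^sub>0"
proof
  assume "e + of_nat j + x \<in> \<int>\<^sub>\<le>\<^sub>0"
  then obtain n where "e + of_nat j + x = - of_nat n" by (rule nonpos_Ints_cases')
  then have "x = - of_nat n - e - of_nat j" by (simp add: algebra_simps)
  then have "x = - (e + of_nat (n + j))" by simp
  then show False using assms unfolding poles_def by blast
qed

lemma Delta_holomorphic: "Delta t holomorphic_on - poles t 0"
proof -
  have "x \<notin> poles t 0 \<Longrightarrow> par_a t + x \<notin> \<int>\<^sub>\<le>\<^sub>0 \<and> par_a t + 1 - x \<notin> \<int>\<^sub>\<le>\<^sub>0 \<and> par_b t + x \<notin> \<int>\<^sub>\<le>\<^sub>0 \<and>
     par_b t + 1 - x \<notin> \<int>\<^sub>\<le>\<^sub>0 \<and> par_c t + x \<notin> \<int>\<^sub>\<le>\<^sub>0 \<and> par_c t - x \<notin> \<int>\<^sub>\<le>\<^sub>0 \<and> par_d t + x \<notin> \<int>\<^sub>\<le>\<^sub>0 \<and> par_d t - x \<notin> \<int>\<^sub>\<le>\<^sub>0" for x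
    using not_nonpos_Ints_plus[of x t 0 _ 0] not_nonpos_Ints_minus[of x t 0 _ 0] not_nonpos_Ints_minus[of x t 0 _ 1]
    by simp
  then show ?thesis
    unfolding Delta_altdef[abs_def] by (intro holomorphic_intros) auto
qed

text \<open>\<open>\<Delta>\<close> times the coefficient of \<open>T\<^sub>1\<close> (of \<open>T\<^sub>0\<close>), rewritten so that the invariance under
  \<open>x \<mapsto> - x\<close> (under \<open>x \<mapsto> 1 - x\<close>) is visible.\<close>

definition kernel1 :: "params \<Rightarrow> complex \<Rightarrow> complex" where
  "kernel1 t x = Gamma (par_a t + 1 + x) * Gamma (par_a t + 1 - x) * Gamma (par_b t + 1 + x) *
     Gamma (par_b t + 1 - x) * Gamma (par_c t + x) * Gamma (par_c t - x) * Gamma (par_d t + x) *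
     Gamma (par_d t - x) * rGamma (1 + 2 * x) * rGamma (1 - 2 * x)"

definition kernel0 :: "params \<Rightarrow> complex \<Rightarrow> complex" where
  "kernel0 t x = Gamma (par_a t + x) * Gamma (par_a t + 1 - x) * Gamma (par_b t + x) *
     Gamma (par_b t + 1 - x) * Gamma (par_c t + x) * Gamma (par_c t + 1 - x) * Gamma (par_d t + x) *
     Gamma (par_d t + 1 - x) * rGamma (2 * x) * rGamma (2 - 2 * x)"

lemma kernel1_holomorphic: "kernel1 t holomorphic_on - poles t 0"
proof -
  have "x \<notin> poles t 0 \<Longrightarrow> par_a t + 1 + x \<notin> \<int>\<^sub>\<le>\<^sub>0 \<and> par_a t + 1 - x \<notin> \<int>\<^sub>\<le>\<^sub>0 \<and> par_b t + 1 + x \<notin> \<int>\<^sub>\<le>\<^sub>0 \<and>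
     par_b t + 1 - x \<notin> \<int>\<^sub>\<le>\<^sub>0 \<and> par_c t + x \<notin> \<int>\<^sub>\<le>\<^sub>0 \<and> par_c t - x \<notin> \<int>\<^sub>\<le>\<^sub>0 \<and> par_d t + x \<notin> \<int>\<^sub>\<le>\<^sub>0 \<and> par_d t - x \<notin> \<int>\<^sub>\<le>\<^sub>0" for x
    using not_nonpos_Ints_plus[of x t 0 _ 0] not_nonpos_Ints_plus[of x t 0 _ 1]
      not_nonpos_Ints_minus[of x t 0 _ 0] not_nonpos_Ints_minus[of x t 0 _ 1]
    by simp
  then show ?thesis
    unfolding kernel1_def[abs_def] by (intro holomorphic_intros) auto
qed

lemma kernel0_holomorphic: "kernel0 t holomorphic_on - poles t 1"
proof -
  have "x \<notin> poles t 1 \<Longrightarrow> par_a t + x \<notin> \<int>\<^sub>\<le>\<^sub>0 \<and> par_a t + 1 - x \<notin> \<int>\<^sub>\<le>\<^sub>0 \<and> par_b t + x \<notin> \<int>\<^sub>\<le>\<^sub>0 \<and>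
     par_b t + 1 - x \<notin> \<int>\<^sub>\<le>\<^sub>0 \<and> par_c t + x \<notin> \<int>\<^sub>\<le>\<^sub>0 \<and> par_c t + 1 - x \<notin> \<int>\<^sub>\<le>\<^sub>0 \<and> par_d t + x \<notin> \<int>\<^sub>\<le>\<^sub>0 \<and> par_d t + 1 - x \<notin> \<int>\<^sub>\<le>\<^sub>0" for x
    using not_nonpos_Ints_plus[of x t 1 _ 0] not_nonpos_Ints_minus[of x t 1 _ 0]
    by simp
  then show ?thesis
    unfolding kernel0_def[abs_def] by (intro holomorphic_intros) auto
qed

text \<open>The factors a + x and b + x raise two Gamma arguments by one, and 1 / Gamma(2x) = 2x /
  Gamma(1 + 2x) supplies the 2x that cancels the denominator of T1.\<close>

lemma Delta_kernel1:
  assumes "x \<notin> poles t 0"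
  shows "(par_a t + x) * (par_b t + x) * Delta t x = 2 * x * kernel1 t x"
proof -
  have "par_a t + x \<notin> \<int>\<^sub>\<le>\<^sub>0" "par_b t + x \<notin> \<int>\<^sub>\<le>\<^sub>0"
    using not_nonpos_Ints_plus[OF assms, of _ 0] by simp_all
  from this[THEN Gamma_plus1]
  have "Gamma (par_a t + 1 + x) = (par_a t + x) * Gamma (par_a t + x)"
    "Gamma (par_b t + 1 + x) = (par_b t + x) * Gamma (par_b t + x)"
    by (simp_all add: add_ac)
  moreover have "rGamma (2 * x) = 2 * x * rGamma (1 + 2 * x)"
    using rGamma_plus1[of "2 * x"] by (simp add: add.commute)
  ultimately show ?thesis by (simp add: Delta_altdef kernel1_def mult_ac)
qed

lemma Delta_kernel0:
  assumes "x \<notin> poles t 0"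
  shows "(par_c t - x) * (par_d t - x) * Delta t x = (1 - 2 * x) * kernel0 t x"
proof -
  have "par_c t - x \<notin> \<int>\<^sub>\<le>\<^sub>0" "par_d t - x \<notin> \<int>\<^sub>\<le>\<^sub>0"
    using not_nonpos_Ints_minus[OF assms, of _ 0] by simp_all
  from this[THEN Gamma_plus1]
  have "Gamma (par_c t + 1 - x) = (par_c t - x) * Gamma (par_c t - x)"
    "Gamma (par_d t + 1 - x) = (par_d t - x) * Gamma (par_d t - x)"
    by (simp_all add: algebra_simps)
  moreover have "rGamma (1 - 2 * x) = (1 - 2 * x) * rGamma (2 - 2 * x)"
    using rGamma_plus1[of "1 - 2 * x"] by (simp add: algebra_simps)
  ultimately show ?thesis by (simp add: Delta_altdef kernel0_def mult_ac)
qed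

text \<open>The scalar parts cancel, and so do the products f(x) g(x) from the two difference
  quotients; what remains of the polynomial part changes sign under x \<mapsto> -x.\<close>

lemma opT1_commutator:
  assumes "x \<notin> poles t 0"
  shows "poly (opT1 t f * g - f * opT1 t g) x * Delta t x =
    kernel1 t x * (poly f (- x) * poly g x - poly f x * poly g (- x))"
proof -
  obtain t0 u0 t1 u1 where t: "t = (t0, u0, t1, u1)" by (cases t)
  obtain q where q: "opT1 t f = smult t1 f + [:t1 + u1, 1:] * [:t1 - u1, 1:] * q"
    "2 * x * poly q x = poly f (- x) - poly f x"
    unfolding t using opT1_quotient by metis
  obtain r where r: "opT1 t g = smult t1 g + [:t1 + u1, 1:] * [:t1 - u1, 1:] * r"
    "2 * x * poly r x = poly g (- x) - poly g x"
    unfolding t using opT1_quotient by metis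
  have "poly (opT1 t f * g - f * opT1 t g) x * Delta t x =
      (par_a t + x) * (par_b t + x) * Delta t x * (poly q x * poly g x - poly f x * poly r x)"
    unfolding q(1) r(1) poly_diff poly_mult poly_add poly_smult by (simp add: t algebra_simps)
  also have "\<dots> = kernel1 t x * ((2 * x * poly q x) * poly g x - poly f x * (2 * x * poly r x))"
    unfolding Delta_kernel1[OF assms] by (simp add: algebra_simps)
  also have "\<dots> = kernel1 t x * (poly f (- x) * poly g x - poly f x * poly g (- x))"
    unfolding q(2) r(2) by (simp add: algebra_simps)
  finally show ?thesis .
qed

lemma opT0_commutator:
  assumes "x \<notin> poles t 0"
  shows "poly (opT0 t f * g - f * opT0 t g) x * Delta t x =
    kernel0 t x * (poly f (1 - x) * poly g x - poly f x * poly g (1 - x))"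
proof -
  obtain t0 u0 t1 u1 where t: "t = (t0, u0, t1, u1)" by (cases t)
  obtain q where q: "opT0 t f = smult t0 f + [:t0 + u0 + 1/2, -1:] * [:t0 - u0 + 1/2, -1:] * q"
    "(1 - 2 * x) * poly q x = poly f (1 - x) - poly f x"
    unfolding t using opT0_quotient by metis
  obtain r where r: "opT0 t g = smult t0 g + [:t0 + u0 + 1/2, -1:] * [:t0 - u0 + 1/2, -1:] * r"
    "(1 - 2 * x) * poly r x = poly g (1 - x) - poly g x"
    unfolding t using opT0_quotient by metis
  have cd: "t0 + u0 + 1/2 = par_c t" "t0 - u0 + 1/2 = par_d t" by (simp_all add: t)
  have "poly (opT0 t f * g - f * opT0 t g) x * Delta t x =
      (par_c t - x) * (par_d t - x) * Delta t x * (poly q x * poly g x - poly f x * poly r x)"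
    unfolding q(1) r(1) cd poly_diff poly_mult poly_add poly_smult by (simp add: algebra_simps)
  also have "\<dots> = kernel0 t x * (((1 - 2 * x) * poly q x) * poly g x - poly f x * ((1 - 2 * x) * poly r x))"
    unfolding Delta_kernel0[OF assms] by (simp add: algebra_simps)
  also have "\<dots> = kernel0 t x * (poly f (1 - x) * poly g x - poly f x * poly g (1 - x))"
    unfolding q(2) r(2) by (simp add: algebra_simps)
  finally show ?thesis .
qed

section \<open>Poles relative to a separating contour\<close>

lemma separating_contour_contour: "separating_contour t C \<Longrightarrow> \<exists>R. contour C R"
  unfolding separating_contour_def axis_contour_def contour_def by blast

locale separating = contour +
  fixes t :: params
  assumes sep: "separating_contour t C"
begin

lemma pole_side:
  assumes "e \<in> {par_a t, par_b t, par_c t, par_d t}"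
  shows "side 1 (e + of_nat m)" "side (-1) (- (e + of_nat m))"
proof -
  have "right_of C (e + of_nat m)" "left_of C (- (e + of_nat m))"
    using sep assms unfolding separating_contour_def by blast+
  then show "side 1 (e + of_nat m)" "side (-1) (- (e + of_nat m))"
    unfolding side_def right_of_def left_of_def by simp_all
qed

lemma range_poles: "range C \<inter> poles t d = {}"
proof -
  have False if C: "w \<in> range C" and p: "w \<in> poles t d" for w
  proof -
    obtain e m where e: "e \<in> {par_a t, par_b t, par_c t, par_d t}"
      and w: "w = e + of_nat (d + m) \<or> w = - (e + of_nat m)"
      using p unfolding poles_def by blast
    from w show False
    proof
      assume "w = e + of_nat (d + m)"
      then show False using C sideD[OF pole_side(1)[OF e]] by metis
    next
      assume "w = - (e + of_nat m)"
      then show False using C sideD[OF pole_side(2)[OF e]] by metis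
    qed
  qed
  then show ?thesis by blast
qed

lemma poles_reflect: "w \<in> poles t d \<Longrightarrow> of_nat d - w \<in> poles t d"
proof -
  assume "w \<in> poles t d"
  then obtain e m where e: "e \<in> {par_a t, par_b t, par_c t, par_d t}"
    and "w = e + of_nat (d + m) \<or> w = - (e + of_nat m)"
    unfolding poles_def by blast
  then have "of_nat d - w = - (e + of_nat m) \<or> of_nat d - w = e + of_nat (d + m)" by auto
  then show ?thesis using e unfolding poles_def by blast
qed

text \<open>Reflection exchanges the right-hand and left-hand families, whence the opposite signs. A
  common height exists because each family consists of four progressions.\<close>

lemma pole_winding:
  "\<exists>N. \<forall>n\<ge>N. \<forall>w\<in>poles t d. \<bar>Im w\<bar> < n \<and> (\<exists>\<epsilon>. (\<epsilon> = 1 \<or> \<epsilon> = -1) \<and>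
     log_winding \<epsilon> n w \<and> log_winding (- \<epsilon>) n (of_nat d - w))"
proof -
  let ?E = "{par_a t, par_b t, par_c t, par_d t}"
  have "\<forall>\<^sub>F n in at_top. \<forall>e\<in>?E. \<bar>Im e\<bar> < n \<and>
      (\<forall>m. log_winding 1 n (e + of_nat m)) \<and> (\<forall>m. log_winding (-1) n (- (e + of_nat m)))"
  proof (intro eventually_ball_finite ballI eventually_conj eventually_gt_at_top)
    fix e assume e: "e \<in> ?E"
    show "\<forall>\<^sub>F n in at_top. \<forall>m. log_winding 1 n (e + of_nat m)"
      using log_winding_uniform[of 1 e] pole_side(1)[OF e] by (simp add: eventually_at_top_linorder)
    show "\<forall>\<^sub>F n in at_top. \<forall>m. log_winding (-1) n (- (e + of_nat m))"
      using log_winding_uniform[of "-1" e] pole_side(2)[OF e] by (simp add: eventually_at_top_linorder)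
  qed simp
  then obtain N where N: "\<And>n e. n \<ge> N \<Longrightarrow> e \<in> ?E \<Longrightarrow> \<bar>Im e\<bar> < n \<and>
      (\<forall>m. log_winding 1 n (e + of_nat m)) \<and> (\<forall>m. log_winding (-1) n (- (e + of_nat m)))"
    unfolding eventually_at_top_linorder by blast
  have "\<bar>Im w\<bar> < n \<and> (\<exists>\<epsilon>. (\<epsilon> = 1 \<or> \<epsilon> = -1) \<and> log_winding \<epsilon> n w \<and> log_winding (- \<epsilon>) n (of_nat d - w))"
    if n: "n \<ge> N" and w: "w \<in> poles t d" for n w
  proof -
    obtain e m where e: "e \<in> ?E" and "w = e + of_nat (d + m) \<or> w = - (e + of_nat m)"
      using w unfolding poles_def by blast
    then consider "w = e + of_nat (d + m)" "of_nat d - w = - (e + of_nat m)"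
      | "w = - (e + of_nat m)" "of_nat d - w = e + of_nat (d + m)" by auto
    then show ?thesis
    proof cases
      case 1
      then have "log_winding 1 n w" "log_winding (- 1) n (of_nat d - w)"
        using N[OF n e] by metis+
      then show ?thesis using N[OF n e] 1(1) by (intro conjI exI[of _ 1]) simp_all
    next
      case 2
      then have "log_winding (- 1) n w" "log_winding 1 n (of_nat d - w)"
        using N[OF n e] by metis+
      then show ?thesis using N[OF n e] 2(1) by (intro conjI exI[of _ "-1"]) simp_all
    qed
  qed
  then show ?thesis by blast
qed

section \<open>The pairing and its symmetries\<close>

definition delta_integral :: "complex poly \<Rightarrow> complex" where
  "delta_integral p = integral UNIV (\<lambda>s. poly p (C s) * Delta t (C s) * vector_derivative C (at s))"

lemma integrable_delta_integral: "(\<lambda>s. poly p (C s) * Delta t (C s) * vector_derivative C (at s)) integrable_on UNIV"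
proof -
  obtain K r where K: "\<And>x. 0 \<le> Re x \<Longrightarrow> Re x \<le> 1 \<Longrightarrow> r \<le> \<bar>Im x\<bar> \<Longrightarrow>
      norm (Delta t x * poly p x) \<le> K * exp (- \<bar>Im x\<bar>)"
    using Delta_decay[of t p] by blast
  show ?thesis
  proof (rule integrable_contour[where f = "\<lambda>x. poly p x * Delta t x" and S = "- poles t 0" and r = r and K = K])
    show "(\<lambda>x. poly p x * Delta t x) holomorphic_on - poles t 0"
      by (intro holomorphic_intros Delta_holomorphic)
    show "norm (poly p (\<i> * of_real s) * Delta t (\<i> * of_real s)) \<le> K * exp (- \<bar>s\<bar>)" if "r \<le> \<bar>s\<bar>" for s
      using K[of "\<i> * of_real s"] that by (simp add: mult.commute)
    show "open (- poles t 0)" by (intro open_Compl closed_poles)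
    show "range C \<subseteq> - poles t 0" using range_poles by blast
  qed
qed

lemma delta_integral_add: "delta_integral (p + q) = delta_integral p + delta_integral q"
  unfolding delta_integral_def by (simp add: distrib_right integral_add integrable_delta_integral)

lemma delta_integral_smult: "delta_integral (smult k p) = k * delta_integral p"
  unfolding delta_integral_def using integral_mult_right[of UNIV k] by (simp add: mult.assoc)

text \<open>The function k may be regular where \<open>Delta\<close> is not. The two are therefore
  compared only off \<open>poles t 0\<close>, namely on the contour and at heights above all these
  poles.\<close>

lemma delta_integral_antisymmetric:
  assumes d: "d \<le> 1" and hol: "k holomorphic_on - poles t d"
    and anti: "\<And>x. k (of_nat d - x) = - k x"
    and eq: "\<And>x. x \<notin> poles t 0 \<Longrightarrow> poly p x * Delta t x = k x"
  shows "delta_integral p = 0"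
proof -
  obtain K r where K: "\<And>x. 0 \<le> Re x \<Longrightarrow> Re x \<le> 1 \<Longrightarrow> r \<le> \<bar>Im x\<bar> \<Longrightarrow>
      norm (Delta t x * poly p x) \<le> K * exp (- \<bar>Im x\<bar>)"
    using Delta_decay[of t p] by blast
  obtain N where N: "\<And>n w. n \<ge> N \<Longrightarrow> w \<in> poles t d \<Longrightarrow> \<bar>Im w\<bar> < n \<and> (\<exists>\<epsilon>. (\<epsilon> = 1 \<or> \<epsilon> = -1) \<and>
     log_winding \<epsilon> n w \<and> log_winding (- \<epsilon>) n (of_nat d - w))"
    using pole_winding[of d] by blast
  obtain N0 where N0: "\<And>w. w \<in> poles t 0 \<Longrightarrow> \<bar>Im w\<bar> < N0"
    using pole_winding[of 0] by blast
  have "integral UNIV (\<lambda>s. k (C s) * vector_derivative C (at s)) = 0"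
  proof (rule antisymmetric_integral_zero[where S = "- poles t d" and d = "real d" and N = N and r = "max r N0" and K = K])
    show "open (- poles t d)" by (intro open_Compl closed_poles)
    show "range C \<subseteq> - poles t d" using range_poles by blast
    show "of_real (real d) - w \<notin> range C" if "w \<notin> - poles t d" for w
      using that poles_reflect[of w d] range_poles[of d] by auto
    show "norm (k x) \<le> K * exp (- \<bar>Im x\<bar>)" if "0 \<le> Re x" "Re x \<le> 1" "max r N0 \<le> \<bar>Im x\<bar>" for x
    proof -
      have "x \<notin> poles t 0" using N0[of x] that by auto
      then show ?thesis using K[of x] that eq[of x] by (simp add: mult.commute)
    qed
  qed (use N d hol anti in auto)
  moreover have "poly p (C s) * Delta t (C s) = k (C s)" for s
    using eq range_poles[of 0] by blast
  ultimately show ?thesis by (simp add: delta_integral_def)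
qed

lemma pairing_delta_integral: "pairing t C f g = 1 / (2 * of_real pi * \<i>) * delta_integral (f * g)"
  by (simp add: pairing_def delta_integral_def)

lemma pairing_linear:
  "pairing t C (f + f') g = pairing t C f g + pairing t C f' g"
  "pairing t C f (g + g') = pairing t C f g + pairing t C f g'"
  "pairing t C (smult k f) g = k * pairing t C f g"
  "pairing t C f (smult k g) = k * pairing t C f g"
  by (simp_all add: pairing_delta_integral distrib_left distrib_right delta_integral_add delta_integral_smult)

lemma pairing_diff_right: "pairing t C f (g - g') = pairing t C f g - pairing t C f g'"
  using pairing_linear(2)[of f "g - g'" g'] by simp

lemma delta_integral_diff_zero: "delta_integral (p - q) = 0 \<Longrightarrow> delta_integral p = delta_integral q"
  using delta_integral_add[of "p - q" q] by simp

lemma pairing_opT1: "pairing t C (opT1 t f) g = pairing t C f (opT1 t g)"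
proof -
  have "delta_integral (opT1 t f * g - f * opT1 t g) = 0"
  proof (rule delta_integral_antisymmetric[where d = 0])
    show "(\<lambda>x. kernel1 t x * (poly f (- x) * poly g x - poly f x * poly g (- x))) holomorphic_on - poles t 0"
      by (intro holomorphic_intros kernel1_holomorphic)
    have "kernel1 t (- x) = kernel1 t x" for x
      by (simp add: kernel1_def mult_ac)
    then show "kernel1 t (of_nat 0 - x) * (poly f (- (of_nat 0 - x)) * poly g (of_nat 0 - x)
        - poly f (of_nat 0 - x) * poly g (- (of_nat 0 - x)))
      = - (kernel1 t x * (poly f (- x) * poly g x - poly f x * poly g (- x)))" for x
      by (simp add: algebra_simps)
  qed (use opT1_commutator in auto)
  then show ?thesis unfolding pairing_delta_integral by (metis delta_integral_diff_zero)
qed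

lemma pairing_opT0: "pairing t C (opT0 t f) g = pairing t C f (opT0 t g)"
proof -
  have "delta_integral (opT0 t f * g - f * opT0 t g) = 0"
  proof (rule delta_integral_antisymmetric[where d = 1])
    show "(\<lambda>x. kernel0 t x * (poly f (1 - x) * poly g x - poly f x * poly g (1 - x))) holomorphic_on - poles t 1"
      by (intro holomorphic_intros kernel0_holomorphic)
    have "kernel0 t (1 - x) = kernel0 t x" for x
    proof -
      have "e + (1 - x) = e + 1 - x" "e + 1 - (1 - x) = e + x" for e by simp_all
      moreover have "2 * (1 - x) = 2 - 2 * x" "2 - 2 * (1 - x) = 2 * x" by simp_all
      ultimately show ?thesis unfolding kernel0_def by (simp only: mult_ac)
    qed
    then show "kernel0 t (of_nat 1 - x) * (poly f (1 - (of_nat 1 - x)) * poly g (of_nat 1 - x)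
        - poly f (of_nat 1 - x) * poly g (1 - (of_nat 1 - x)))
      = - (kernel0 t x * (poly f (1 - x) * poly g x - poly f x * poly g (1 - x)))" for x
      by (simp add: algebra_simps)
  qed (use opT0_commutator in auto)
  then show ?thesis unfolding pairing_delta_integral by (metis delta_integral_diff_zero)
qed

lemma pairing_opZ: "pairing t C (opZ f) g = pairing t C f (opZ g)"
  by (simp add: pairing_delta_integral opZ_def)

lemma pairing_opY: "pairing t C (opY t f) g = pairing t C f (opY t g)"
  by (simp add: opY_def pairing_linear pairing_opT0 pairing_opT1)

lemma pairing_opS: "pairing t C (opS t f) g = pairing t C f (opS t g)"
proof -
  have "opS t f = smult (-1) (opT1 t f + opZ f)" for f by (simp add: opS_def)
  then show ?thesis by (simp only: pairing_linear pairing_opT1 pairing_opZ)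
qed

end

section \<open>The Fourier transform\<close>

locale fourier_setting = generic_params t0 u0 t1 u1 + separating C R "(t0, u0, t1, u1)"
  for t0 u0 t1 u1 C R
begin

abbreviation "\<Phi> \<equiv> fourier t C"

lemma fourier_gam: "\<Phi> p (- gam t m) = pairing t C p (E m)"
  using in_spec by (simp add: fourier_def E_def)

lemma fourier_outside: "\<gamma> \<notin> spec t \<Longrightarrow> \<Phi> p \<gamma> = 0"
  by (simp add: fourier_def)

lemma fourier_eqI:
  assumes "\<And>\<gamma>. \<gamma> \<notin> spec t \<Longrightarrow> g \<gamma> = 0" "\<And>m. pairing t C p (E m) = g (- gam t m)"
  shows "\<Phi> p = g"
proof
  fix \<gamma>
  show "\<Phi> p \<gamma> = g \<gamma>"
  proof (cases "\<gamma> \<in> spec t")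
    case True
    then obtain m where "\<gamma> = - gam t m" by (rule specE)
    then show ?thesis using assms(2) fourier_gam by simp
  qed (use assms(1) fourier_outside in simp)
qed

text \<open>Y is self-adjoint and its eigenvalues are distinct; the pairing is bilinear, without
  conjugation.\<close>

lemma pairing_E_E: "j \<noteq> m \<Longrightarrow> pairing t C (E j) (E m) = 0"
proof -
  assume "j \<noteq> m"
  have "gam t j * pairing t C (E j) (E m) = gam t m * pairing t C (E j) (E m)"
    using pairing_opY[of "E j" "E m"] by (simp only: opY_E pairing_linear)
  then show ?thesis using injD[OF inj_gam, of j m] \<open>j \<noteq> m\<close> by auto
qed

text \<open>Expanding p in eigenpolynomials of degree below m reduces this to orthogonality. It is
  the reason why transforms of polynomials have finite support.\<close>

lemma pairing_E_degree_less: "degree p < m \<Longrightarrow> pairing t C p (E m) = 0"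
proof (induction "degree p" arbitrary: p rule: less_induct)
  case less
  define n where "n = degree p"
  define c where "c = lead_coeff p / lead_coeff (E n)"
  define r where "r = p - smult c (E n)"
  have En: "lead_coeff (E n) \<noteq> 0"
    using poly_E_base[of n] by auto
  have p: "p = r + smult c (E n)" by (simp add: r_def)
  have 0: "pairing t C (E n) (E m) = 0"
    using less.prems by (intro pairing_E_E) (simp add: n_def)
  have "coeff r n = 0" using En by (simp add: r_def c_def n_def degree_E)
  moreover have "degree r \<le> n"
    unfolding r_def n_def by (intro degree_diff_le) (auto simp: degree_E)
  ultimately consider "r = 0" | "degree r < n"
    by (metis le_neq_implies_less leading_coeff_0_iff)
  then have "pairing t C r (E m) = 0"
  proof cases
    case 1
    then show ?thesis using pairing_linear(3)[of 0 0 "E m"] by simp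
  next
    case 2
    then show ?thesis using less.prems by (intro less.hyps) (auto simp: n_def)
  qed
  then show ?case unfolding p using 0 by (simp add: pairing_linear)
qed

lemma fourier_finsupp: "\<Phi> p \<in> finsupp t"
proof -
  have "{\<gamma>. \<Phi> p \<gamma> \<noteq> 0} \<subseteq> (\<lambda>m. - gam t m) ` {..degree p}"
  proof
    fix \<gamma> assume "\<gamma> \<in> {\<gamma>. \<Phi> p \<gamma> \<noteq> 0}"
    then have nz: "\<Phi> p \<gamma> \<noteq> 0" by simp
    then have "\<gamma> \<in> spec t" using fourier_outside by blast
    then obtain m where m: "\<gamma> = - gam t m" by (rule specE)
    then have "\<not> degree p < m" using nz fourier_gam pairing_E_degree_less by auto
    then show "\<gamma> \<in> (\<lambda>m. - gam t m) ` {..degree p}" using m by auto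
  qed
  then have "finite {\<gamma>. \<Phi> p \<gamma> \<noteq> 0}" by (rule finite_subset) simp
  then show ?thesis unfolding finsupp_def using fourier_outside by blast
qed

lemma fourier_add: "\<Phi> (p + q) = (\<lambda>\<gamma>. \<Phi> p \<gamma> + \<Phi> q \<gamma>)"
  by (rule fourier_eqI) (simp_all add: fourier_outside fourier_gam pairing_linear)

lemma fourier_smult: "\<Phi> (smult k p) = (\<lambda>\<gamma>. k * \<Phi> p \<gamma>)"
  by (rule fourier_eqI) (simp_all add: fourier_outside fourier_gam pairing_linear)

section \<open>Transforms of the generators\<close>

lemma fourier_opY: "\<Phi> (opY t p) = (\<lambda>\<gamma>. - \<gamma> * \<Phi> p \<gamma>)"
proof (rule fourier_eqI)
  show "pairing t C (opY t p) (E m) = - (- gam t m) * \<Phi> p (- gam t m)" for m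
    by (simp add: pairing_opY opY_E pairing_linear fourier_gam)
qed (simp add: fourier_outside)

lemma fourier_opT1: "\<Phi> (opT1 t p) = spT1 t (\<Phi> p)"
proof (rule fourier_eqI)
  fix m
  show "pairing t C (opT1 t p) (E m) = spT1 t (\<Phi> p) (- gam t m)"
  proof (cases "m = 0")
    case True
    show ?thesis
      unfolding pairing_opT1 True opT1_E_0 spT1_base fourier_gam pairing_linear ..
  next
    case False
    then obtain k where k: "gam t m = - gam t k" using reflect1 by blast
    have nz: "gam t m \<noteq> 0" using gam_nz False by simp
    have ne: "- gam t m \<noteq> - gam t 0" using False injD[OF inj_gam, of m 0] by auto
    have k': "- (- gam t m) = - gam t k" "gam t k = - gam t m" using k by simp_all
    show ?thesis
      unfolding pairing_opT1 opT1_E[OF k'(2) nz] spT1_spec(2)[OF in_spec ne] k'(1) fourier_gam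
        pairing_linear pairing_diff_right by simp
  qed
qed simp

lemma fourier_opS: "\<Phi> (opS t p) = spT0 t (\<Phi> p)"
proof (rule fourier_eqI)
  fix m
  obtain k where k: "1 + gam t m = - gam t k" using reflect0 by blast
  have k': "1 - (- gam t m) = - gam t k" "gam t k = - 1 - gam t m"
    using k by (simp, metis diff_conv_add_uminus minus_add_distrib minus_minus)
  show "pairing t C (opS t p) (E m) = spT0 t (\<Phi> p) (- gam t m)"
    unfolding pairing_opS opS_E[OF k'(2)] spT0_spec(2)[OF in_spec] k'(1) fourier_gam
      pairing_linear pairing_diff_right by simp
qed simp

lemma fourier_opT0: "\<Phi> (opT0 t p) = (\<lambda>\<gamma>. - (spT1 t (\<Phi> p) \<gamma> + \<gamma> * \<Phi> p \<gamma>))"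
proof -
  have "opY t p = opT0 t p + opT1 t p" by (simp add: opY_def)
  then have "\<Phi> (opY t p) = (\<lambda>\<gamma>. \<Phi> (opT0 t p) \<gamma> + \<Phi> (opT1 t p) \<gamma>)" by (simp only: fourier_add)
  then have "- \<gamma> * \<Phi> p \<gamma> = \<Phi> (opT0 t p) \<gamma> + spT1 t (\<Phi> p) \<gamma>" for \<gamma>
    unfolding fourier_opY fourier_opT1 by (rule fun_cong)
  then have "\<Phi> (opT0 t p) \<gamma> = - (spT1 t (\<Phi> p) \<gamma> + \<gamma> * \<Phi> p \<gamma>)" for \<gamma>
    by (simp add: algebra_simps eq_diff_eq del: spT1.simps)
  then show ?thesis by (intro ext)
qed

lemma fourier_opZ: "\<Phi> (opZ p) = (\<lambda>\<gamma>. - (spT0 t (\<Phi> p) \<gamma> + spT1 t (\<Phi> p) \<gamma>))"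
proof -
  have "opZ p = smult (-1) (opS t p + opT1 t p)" by (simp add: opS_def)
  then have "\<Phi> (opZ p) = (\<lambda>\<gamma>. -1 * (\<Phi> (opS t p) \<gamma> + \<Phi> (opT1 t p) \<gamma>))"
    by (simp only: fourier_add fourier_smult)
  then show ?thesis unfolding fourier_opS fourier_opT1 by simp
qed

text \<open>The values of \<sigma> on generators carry a minus sign, which \<open>hecke\<close>
  provides as scaling by -1.\<close>

lemma rep_neg_add:
  assumes "A \<in> hecke (dual t)" "B \<in> hecke (dual t)" "f \<in> finsupp t"
  shows "rep (\<lambda>q. - (A q + B q)) f = (\<lambda>\<gamma>. - (rep A f \<gamma> + rep B f \<gamma>))"
proof -
  have "acts (\<lambda>q. smult (-1) (A q + B q)) f (\<lambda>\<gamma>. -1 * (rep A f \<gamma> + rep B f \<gamma>))"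
    using assms by (intro acts_scale acts_add rep_acts)
  moreover have "(\<lambda>\<gamma>. -1 * (rep A f \<gamma> + rep B f \<gamma>)) \<in> finsupp t"
    using assms by (intro finsupp_scale finsupp_add rep_acts)
  ultimately show ?thesis using rep_eqI by simp
qed

text \<open>The property passes to sums, multiples and compositions, so the generators decide.
  Besides its values there, \<sigma> enters through the homomorphism laws and by mapping into the
  dual algebra.\<close>

lemma fourier_intertwines:
  assumes \<sigma>: "is_sigma t \<sigma>" and A: "A \<in> hecke t"
  shows "\<Phi> (A p) = rep (\<sigma> A) (\<Phi> p)"
  using A
proof (induction arbitrary: p rule: hecke.induct)
  have iso: "hecke_iso t (dual t) \<sigma>"
    and gens: "\<sigma> (opT0 t) = (\<lambda>q. - (opT1 (dual t) q + opZ q))" "\<sigma> (opT1 t) = opT1 (dual t)"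
      "\<sigma> opZ = (\<lambda>q. - (opT0 (dual t) q + opT1 (dual t) q))"
    using \<sigma> unfolding is_sigma_def by blast+
  have repT: "rep (opT0 (dual t)) f = spT0 t f" "rep (opT1 (dual t)) f = spT1 t f"
    "rep opZ f = (\<lambda>\<gamma>. \<gamma> * f \<gamma>)" if f: "f \<in> finsupp t" for f
  proof -
    have "opZ = (*) [:0, 1:]" by (simp add: fun_eq_iff opZ_def)
    moreover have "rep ((*) [:0, 1:]) f = (\<lambda>\<gamma>. poly [:0, 1:] \<gamma> * f \<gamma>)"
      using extends_rep f unfolding extends_assignments_def by blast
    ultimately show "rep opZ f = (\<lambda>\<gamma>. \<gamma> * f \<gamma>)" by simp
    show "rep (opT0 (dual t)) f = spT0 t f" "rep (opT1 (dual t)) f = spT1 t f"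
      using extends_rep f unfolding extends_assignments_def by blast+
  qed
  have "bij_betw \<sigma> (hecke t) (hecke (dual t))"
    using iso unfolding hecke_iso_def by blast
  from bij_betwE[OF this] have in_dual: "\<sigma> B \<in> hecke (dual t)" if "B \<in> hecke t" for B
    using that by blast
  {
    case id
    have "\<sigma> id = id" using iso unfolding hecke_iso_def by blast
    moreover have "rep id (\<Phi> p) = \<Phi> p" by (intro rep_eqI acts_id fourier_finsupp)
    ultimately show ?case by (simp only: id_apply[of p])
  next
    case T0
    show ?case
      unfolding gens fourier_opT0 rep_neg_add[OF hecke.T1 hecke.Z fourier_finsupp] repT[OF fourier_finsupp] ..
  next
    case T1
    show ?case unfolding gens fourier_opT1 repT[OF fourier_finsupp] ..
  next
    case Z
    show ?case
      unfolding gens fourier_opZ rep_neg_add[OF hecke.T0 hecke.T1 fourier_finsupp] repT[OF fourier_finsupp] ..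
  next
    case (add A B)
    have "\<sigma> (\<lambda>q. A q + B q) = (\<lambda>q. \<sigma> A q + \<sigma> B q)"
      using iso add.hyps unfolding hecke_iso_def by blast
    moreover have "rep (\<lambda>q. \<sigma> A q + \<sigma> B q) (\<Phi> p) = (\<lambda>\<gamma>. rep (\<sigma> A) (\<Phi> p) \<gamma> + rep (\<sigma> B) (\<Phi> p) \<gamma>)"
      using is_rep_rep in_dual[OF add.hyps(1)] in_dual[OF add.hyps(2)] fourier_finsupp
      unfolding is_rep_def by blast
    ultimately show ?case by (simp only: fourier_add add.IH)
  next
    case (scale A k)
    have "\<sigma> (\<lambda>q. smult k (A q)) = (\<lambda>q. smult k (\<sigma> A q))"
      using iso scale.hyps unfolding hecke_iso_def by blast
    moreover have "rep (\<lambda>q. smult k (\<sigma> A q)) (\<Phi> p) = (\<lambda>\<gamma>. k * rep (\<sigma> A) (\<Phi> p) \<gamma>)"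
      using is_rep_rep in_dual[OF scale.hyps] fourier_finsupp unfolding is_rep_def by blast
    ultimately show ?case by (simp only: fourier_smult scale.IH)
  next
    case (comp A B)
    have "\<sigma> (A \<circ> B) = \<sigma> A \<circ> \<sigma> B"
      using iso comp.hyps unfolding hecke_iso_def by blast
    moreover have "rep (\<sigma> A \<circ> \<sigma> B) (\<Phi> p) = rep (\<sigma> A) (rep (\<sigma> B) (\<Phi> p))"
      using is_rep_rep in_dual[OF comp.hyps(1)] in_dual[OF comp.hyps(2)] fourier_finsupp
      unfolding is_rep_def by blast
    moreover have "\<Phi> ((A \<circ> B) p) = rep (\<sigma> A) (rep (\<sigma> B) (\<Phi> p))"
      by (simp only: comp_apply comp.IH)
    ultimately show ?case by (simp only:)
  }
qed

lemma fourier_transform: "is_sigma t \<sigma> \<Longrightarrow> is_fourier_transform t \<sigma> rep \<Phi>"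
  unfolding is_fourier_transform_def
  using fourier_finsupp fourier_add fourier_smult fourier_intertwines by blast

end

theorem proposition4p1:
  fixes t :: params
  assumes "generic t"
  shows "\<exists>\<rho>. is_rep t \<rho> \<and> extends_assignments t \<rho> \<and>
    (\<forall>\<rho>'. is_rep t \<rho>' \<and> extends_assignments t \<rho>' \<longrightarrow>
       (\<forall>A\<in>hecke (dual t). \<forall>f\<in>finsupp t. \<rho>' A f = \<rho> A f)) \<and>
    (\<forall>\<sigma> C. is_sigma t \<sigma> \<and> separating_contour t C \<longrightarrow>
       is_fourier_transform t \<sigma> \<rho> (fourier t C))"
proof -
  obtain t0 u0 t1 u1 where t: "t = (t0, u0, t1, u1)" by (cases t)
  interpret generic_params t0 u0 t1 u1
    using assms unfolding t by unfold_locales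
  \<comment> \<open>The witness \<open>rep\<close> depends on neither \<sigma> nor C, so it serves
    all of them at once.\<close>
  have "is_fourier_transform t \<sigma> rep (fourier t C)"
    if \<sigma>: "is_sigma t \<sigma>" and C: "separating_contour t C" for \<sigma> C
  proof -
    obtain R where "contour C R" using separating_contour_contour C by blast
    then interpret fourier_setting t0 u0 t1 u1 C R
      using C unfolding t
      by (intro fourier_setting.intro generic_params_axioms separating.intro separating_axioms.intro)
    show ?thesis using fourier_transform \<sigma> unfolding t by blast
  qed
  then show ?thesis
    using is_rep_rep extends_rep rep_unique unfolding t by blast
qed

end
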